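(* Let $(A,H,Q)$ be a pre-Lie-Rinehart triple such that both $H$ and $Q$ have property P, and such that the canonical map $\mathrm{Alt}_A(H,A)\otimes_AQ\to\mathrm{Alt}_A(H,Q)$ is an isomorphism. Then $(A,H,Q)$ is a Lie-Rinehart triple if and only if the pair $(\mathcal A,\mathcal Q)=(\mathrm{Alt}_A(H,A),\mathrm{Alt}_A(H,Q))$, endowed with the pairing $\mathcal Q\otimes_R\mathcal A\to\mathcal A$, the bracket $[\cdot,\cdot]_{\mathcal Q}$ and the operation $\langle\cdot,\cdot;\cdot\rangle_Q$ described in the context, is a quasi-Lie-Rinehart algebra.
   Context: $R$ is a commutative ring with $1$, $A$ a commutative $R$-algebra. A Lie-Rinehart algebra $(A,L)$ is an $R$-Lie algebra $L$ with an $A$-module structure and a morphism of $R$-Lie algebras $L\to\mathrm{Der}_R(A)$, $x\mapsto(a\mapsto x(a))$, with $(ax)(b)=a(x(b))$ and $[x,ay]=x(a)y+a[x,y]$. An $A$-module $M$ has property P if $m\in M$ and $\phi(m)=0$ for all $A$-linear $\phi\colon M\to A$ imply $m=0$. **Triples.** An almost pre-Lie-Rinehart triple $(A,H,Q)$ consists of $A$-modules $H,Q$ with alternating $R$-bilinear brackets $[\cdot,\cdot]_H\colon H\times H\to H$, $[\cdot,\cdot]_Q\colon Q\times Q\to Q$; $R$-bilinear maps $H\times A\to A$, $(x,a)\mapsto x(a)$, $Q\times A\to A$, $(\xi,a)\mapsto \xi(a)$, $H\times Q\to Q$, $(x,\xi)\mapsto x\cdot\xi$, $Q\times H\to H$,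 $(\xi,x)\mapsto \xi\cdot x$; and an alternating $A$-bilinear map $\delta\colon Q\times Q\to H$, such that: every $x\in H$ and every $\xi\in Q$ acts on $A$ by $R$-derivations; $(ax)(b)=a(x(b))$, $[x,ay]_H=x(a)y+a[x,y]_H$, $(a\xi)(b)=a(\xi(b))$, $[\xi,a\eta]_Q=\xi(a)\eta+a[\xi,\eta]_Q$; $x\cdot(a\xi)=x(a)\xi+a(x\cdot\xi)$, $(ax)\cdot\xi=a(x\cdot\xi)$, $\xi\cdot(ax)=\xi(a)x+a(\xi\cdot x)$, $(a\xi)\cdot x=a(\xi\cdot x)$. It is a pre-Lie-Rinehart triple if moreover $(A,H)$ is a Lie-Rinehart algebra and $[x,y]_H\cdot\xi=x\cdot(y\cdot\xi)-y\cdot(x\cdot\xi)$. It is a Lie-Rinehart triple if $L=H\oplus Q$ with the bracket $[(x,\xi),(y,\eta)]=[x,y]_H+[\xi,\eta]_Q+\delta(\xi,\eta)+x\cdot\eta-\eta\cdot x+\xi\cdot y-y\cdot\xi$ and the action $(x,\xi)(a)=x(a)+\xi(a)$ is such that $(A,L)$ is a Lie-Rinehart algebra. **Quasi-Lie-Rinehart algebras.** Let $\mathcal A$ be a differential graded commutative $R$-algebra with $\mathcal A^q=0$ for $q<0$, $d\colon\mathcal A^q\to\mathcal A^{q+1}$; $\alpha\in\mathcal A^q$ has degree $|\alpha|=-q$; put $A=\mathcal A^0$. Let $Q$ be an $A$-module (degree $0$) and $\mathcal Q=\mathcal A\otimes_AQ$ the induced graded $\mathcal A$-module, with a differential making it a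 differential graded $\mathcal A$-module. Suppose given: a degree zero $R$-bilinear bracket $[\cdot,\cdot]_{\mathcal Q}$ on $\mathcal Q$, graded skew-symmetric, $[u,v]=-(-1)^{|u||v|}[v,u]$, restricting to a bracket $[\cdot,\cdot]_Q$ on $Q$; a degree zero $R$-bilinear pairing $\mathcal Q\otimes_R\mathcal A\to\mathcal A$, $(u,\alpha)\mapsto u(\alpha)$; an $A$-trilinear operation $\langle\cdot,\cdot;\cdot\rangle_Q\colon Q\otimes_AQ\otimes_A\mathcal A^q\to\mathcal A^{q-1}$, alternating in the two $Q$-variables. $(\mathcal A,\mathcal Q)$ is a pre-quasi-Lie-Rinehart algebra if (i) each homogeneous $u\in\mathcal Q$ acts on $\mathcal A$ as a graded derivation, and $\langle\xi,\eta;\beta\alpha\rangle_Q=(-1)^{|\alpha|}\langle\xi,\eta;\beta\rangle_Q\alpha+\beta\langle\xi,\eta;\alpha\rangle_Q$; (ii) $(au)(b)=a(u(b))$ and $[u,av]_{\mathcal Q}=u(a)v+(-1)^{|u||a|}a[u,v]_{\mathcal Q}$ for homogeneous $a,b\in\mathcal A$, $u,v\in\mathcal Q$. Let $\mathrm{Alt}^p_A(Q,\mathcal A^q)$ be the $A$-multilinear alternating $p$-forms on $Q$ with values in $\mathcal A^q$; such $f$ has degree $|f|=-(p+q)$, and is extended to $\mathcal Q$ $\mathcal A$-multilinearly, so that $f(\xi_1,\dots,\alpha\xi_j,\dots,\xi_p)=(-1)^{|f||\alpha|}\alpha f(\xi_1,\dots,\xi_p)$ for $\xi_i\in Q$. For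 $\xi_i\in Q$ put $$(d_0f)(\xi_1,\dots,\xi_p)=d(f(\xi_1,\dots,\xi_p))+(-1)^{|f|+1}\sum_jf(\xi_1,\dots,d\xi_j,\dots,\xi_p),$$ $$(-1)^{|f|+1}(d_1f)(\xi_1,\dots,\xi_{p+1})=\sum_j(-1)^{j-1}\xi_j(f(\dots\widehat{\xi_j}\dots))+\sum_{j<k}(-1)^{j+k}f([\xi_j,\xi_k]_Q,\dots\widehat{\xi_j}\dots\widehat{\xi_k}\dots),$$ $$(-1)^{|f|+1}(d_2f)(\xi_1,\dots,\xi_{p+2})=(-1)^p\sum_{j<k}(-1)^{j+k}\langle\xi_j,\xi_k;f(\dots\widehat{\xi_j}\dots\widehat{\xi_k}\dots)\rangle_Q.$$ A pre-quasi-Lie-Rinehart algebra is a quasi-Lie-Rinehart algebra if (1) $d_0$ is an operator on $\mathrm{Alt}_A(Q,\mathcal A)$; (2) $d[u,v]_{\mathcal Q}=[du,v]_{\mathcal Q}+(-1)^{|u|}[u,dv]_{\mathcal Q}$; (3) $d(u(\alpha))=(du)(\alpha)+(-1)^{|u|}u(d\alpha)$; (4) $\xi(\eta(\alpha))-\eta(\xi(\alpha))-[\xi,\eta]_Q(\alpha)=((d_0d_2+d_2d_0)(\alpha))(\xi,\eta)$ for $\xi,\eta\in Q$, $\alpha\in\mathcal A$; (5) for $\xi,\eta,\vartheta\in Q$ and $\alpha\in\mathrm{Hom}_A(Q,A)$, $\sum_{\mathrm{cyclic}}\alpha([[\xi,\eta]_Q,\vartheta]_Q)=(d_2d_0\alpha)(\xi,\eta,\vartheta)-\sum_{\mathrm{cyclic}}(d_2d_0(\alpha(\vartheta)))(\xi,\eta)$,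 the sums being over cyclic permutations of $(\xi,\eta,\vartheta)$; (6) $d_1d_2+d_2d_1=0$ on $\mathrm{Alt}_A(Q,\mathcal A)$. **The pair of a triple.** $\mathcal A^q=\mathrm{Alt}^q_A(H,A)$ (alternating $A$-multilinear forms) with product $\alpha\beta=(-1)^{|\alpha||\beta|}\alpha\wedge\beta$ ($\wedge$ the shuffle product); $\mathcal Q=\mathrm{Alt}_A(H,Q)\cong\mathcal A\otimes_AQ$, where $\alpha\otimes\xi$ is the form $(x_1,\dots,x_q)\mapsto\alpha(x_1,\dots,x_q)\xi$. For $M=A$ or $M=Q$ and $f\in\mathrm{Alt}^{q}_A(H,M)$, $(-1)^{q+1}(df)(x_1,\dots,x_{q+1})=\sum_j(-1)^{j-1}x_j\cdot f(\dots\widehat{x_j}\dots)+\sum_{j<k}(-1)^{j+k}f([x_j,x_k]_H,\dots\widehat{x_j}\dots\widehat{x_k}\dots)$ (with $x\cdot a=x(a)$). For $\xi\in Q$, $\alpha\in\mathcal A^q$: $(\xi(\alpha))(x_1,\dots,x_q)=\xi(\alpha(x_1,\dots,x_q))-\sum_j\alpha(x_1,\dots,\xi\cdot x_j,\dots,x_q)$, extended by $(\alpha\otimes\xi)(\beta)=\alpha\,\xi(\beta)$. The bracket is $[\alpha\otimes\xi,\beta\otimes\eta]_{\mathcal Q}=(\alpha\,\xi(\beta))\otimes\eta-(-1)^{|\alpha||\beta|}(\beta\,\eta(\alpha))\otimes\xi+(\alpha\beta)\otimes[\xi,\eta]_Q$. Finally $\langle\xi,\eta;\alpha\rangle_Q(x_1,\dots,x_{q-1})=\alpha(\delta(\xi,\eta),x_1,\dots,x_{q-1})$.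 *)

theory Defs
  imports Main "HOL-Library.Multiset" "HOL-Library.Function_Algebras" "HOL-Library.Product_Plus"
begin

text \<open>
  Commutative rings with 1 are types of sort \<open>{comm_ring, comm_monoid_mult}\<close>. Unlike the class
  \<open>comm_ring_1\<close>, on which the locale \<open>module\<close> of the library is based, this sort does not
  exclude the zero ring.
\<close>

section \<open>Modules, algebras, linear maps\<close>

locale unital_module =
  fixes scale :: "'a::{comm_ring,comm_monoid_mult} \<Rightarrow> 'm::ab_group_add \<Rightarrow> 'm"
  assumes scale_add_right: "scale a (x + y) = scale a x + scale a y"
    and scale_add_left: "scale (a + b) x = scale a x + scale b x"
    and scale_scale: "scale a (scale b x) = scale (a * b) x"
    and scale_one: "scale 1 x = x"

locale comm_algebra = unital_module rsc
  for rsc :: "'r::{comm_ring,comm_monoid_mult} \<Rightarrow> 'a::{comm_ring,comm_monoid_mult} \<Rightarrow> 'a" +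
  assumes rsc_mult: "rsc r (a * b) = rsc r a * b"

definition lin_on ::
  "'s set \<Rightarrow> 'x set \<Rightarrow> ('s \<Rightarrow> 'x \<Rightarrow> 'x) \<Rightarrow> ('s \<Rightarrow> 'y \<Rightarrow> 'y) \<Rightarrow> ('x::plus \<Rightarrow> 'y::plus) \<Rightarrow> bool" where
  "lin_on S X sx sy f \<longleftrightarrow>
     (\<forall>x\<in>X. \<forall>y\<in>X. f (x + y) = f x + f y) \<and> (\<forall>s\<in>S. \<forall>x\<in>X. f (sx s x) = sy s (f x))"

definition bilin_on ::
  "'s set \<Rightarrow> 'x set \<Rightarrow> 'y set \<Rightarrow> ('s \<Rightarrow> 'x \<Rightarrow> 'x) \<Rightarrow> ('s \<Rightarrow> 'y \<Rightarrow> 'y) \<Rightarrow> ('s \<Rightarrow> 'z \<Rightarrow> 'z) \<Rightarrow>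
   ('x::plus \<Rightarrow> 'y::plus \<Rightarrow> 'z::plus) \<Rightarrow> bool" where
  "bilin_on S X Y sx sy sz b \<longleftrightarrow>
     (\<forall>y\<in>Y. lin_on S X sx sz (\<lambda>x. b x y)) \<and> (\<forall>x\<in>X. lin_on S Y sy sz (b x))"

abbreviation linear_map where "linear_map \<equiv> lin_on UNIV UNIV"
abbreviation bilinear_map where "bilinear_map \<equiv> bilin_on UNIV UNIV UNIV"

definition derivation ::
  "('r \<Rightarrow> 'a \<Rightarrow> 'a) \<Rightarrow> ('a::{comm_ring,comm_monoid_mult} \<Rightarrow> 'a) \<Rightarrow> bool" where
  "derivation rsc D \<longleftrightarrow> linear_map rsc rsc D \<and> (\<forall>a b. D (a * b) = D a * b + a * D b)"

definition property_P :: "('a::{comm_ring,comm_monoid_mult} \<Rightarrow> 'm::ab_group_add \<Rightarrow> 'm) \<Rightarrow> bool" where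
  "property_P scale \<longleftrightarrow>
     (\<forall>m. (\<forall>\<phi>. linear_map scale (*) \<phi> \<longrightarrow> \<phi> m = 0) \<longrightarrow> m = 0)"

definition add_subgroup :: "'m::ab_group_add set \<Rightarrow> bool" where
  "add_subgroup X \<longleftrightarrow> 0 \<in> X \<and> (\<forall>x\<in>X. \<forall>y\<in>X. x + y \<in> X) \<and> (\<forall>x\<in>X. - x \<in> X)"

text \<open>\<open>sg n x\<close> is $(-1)^n x$. Since $|\alpha| = -q$ for $\alpha$ in $\mathcal{A}^q$ and a sign
  depends only on a parity, degrees $|\cdot|$ are replaced by their absolute values throughout.\<close>

definition sg :: "nat \<Rightarrow> 'm::ab_group_add \<Rightarrow> 'm" where
  "sg n x = (if even n then x else - x)"


section \<open>Tensor products\<close>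

text \<open>
  The tensor product over the scalars \<open>S\<close> of the modules with carriers \<open>M\<close> and \<open>N\<close>:
  finite formal sums of pairs (multisets) modulo the congruence generated by the bilinearity
  relations. Formal negatives are not needed, because the classes of \<open>(m, n)\<close> and \<open>(- m, n)\<close>
  add up to the class of \<open>(0, n)\<close>, which is zero.
\<close>

inductive tensor_rel ::
  "'s set \<Rightarrow> ('s \<Rightarrow> 'm \<Rightarrow> 'm) \<Rightarrow> 'm::ab_group_add set \<Rightarrow> ('s \<Rightarrow> 'n \<Rightarrow> 'n) \<Rightarrow> 'n::ab_group_add set \<Rightarrow>
   ('m \<times> 'n) multiset \<Rightarrow> ('m \<times> 'n) multiset \<Rightarrow> bool"
  for S sm M sn N where
  refl: "set_mset z \<subseteq> M \<times> N \<Longrightarrow> tensor_rel S sm M sn N z z"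
| sym: "tensor_rel S sm M sn N z w \<Longrightarrow> tensor_rel S sm M sn N w z"
| trans: "tensor_rel S sm M sn N z w \<Longrightarrow> tensor_rel S sm M sn N w v \<Longrightarrow> tensor_rel S sm M sn N z v"
| cong: "tensor_rel S sm M sn N z w \<Longrightarrow> set_mset v \<subseteq> M \<times> N \<Longrightarrow> tensor_rel S sm M sn N (z + v) (w + v)"
| add_left: "m \<in> M \<Longrightarrow> m' \<in> M \<Longrightarrow> n \<in> N \<Longrightarrow> tensor_rel S sm M sn N {#(m + m', n)#} {#(m, n), (m', n)#}"
| add_right: "m \<in> M \<Longrightarrow> n \<in> N \<Longrightarrow> n' \<in> N \<Longrightarrow> tensor_rel S sm M sn N {#(m, n + n')#} {#(m, n), (m, n')#}"
| zero: "n \<in> N \<Longrightarrow> tensor_rel S sm M sn N {#(0, n)#} {#}"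
| balance: "s \<in> S \<Longrightarrow> m \<in> M \<Longrightarrow> n \<in> N \<Longrightarrow> tensor_rel S sm M sn N {#(sm s m, n)#} {#(m, sn s n)#}"

definition tensor ::
  "'s set \<Rightarrow> ('s \<Rightarrow> 'm \<Rightarrow> 'm) \<Rightarrow> 'm::ab_group_add set \<Rightarrow> ('s \<Rightarrow> 'n \<Rightarrow> 'n) \<Rightarrow> 'n::ab_group_add set \<Rightarrow>
   ('m \<times> 'n) multiset set set" where
  "tensor S sm M sn N = {z. set_mset z \<subseteq> M \<times> N} // {(z, w). tensor_rel S sm M sn N z w}"

text \<open>The additive map on a tensor product that is induced by a balanced biadditive \<open>F\<close>;
  all representatives of a class have the same image.\<close>

definition tensor_map :: "('m \<Rightarrow> 'n \<Rightarrow> 'z::comm_monoid_add) \<Rightarrow> ('m \<times> 'n) multiset set \<Rightarrow> 'z" where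
  "tensor_map F C = the_elem ((\<lambda>z. \<Sum>(m, n)\<in>#z. F m n) ` C)"

text \<open>If \<open>t\<close> induces an isomorphism from \<open>T\<close> onto a module \<open>U\<close>, this is the additive map on \<open>U\<close>
  with \<open>t m n \<mapsto> F m n\<close>.\<close>

definition along_iso ::
  "('m \<times> 'n) multiset set set \<Rightarrow> ('m \<Rightarrow> 'n \<Rightarrow> 'u::comm_monoid_add) \<Rightarrow>
   ('m \<Rightarrow> 'n \<Rightarrow> 'z::comm_monoid_add) \<Rightarrow> 'u \<Rightarrow> 'z" where
  "along_iso T t F u = tensor_map F (the_inv_into T (tensor_map t) u)"


section \<open>Alternating forms\<close>

text \<open>
  Alternating \<open>S\<close>-multilinear \<open>p\<close>-forms on \<open>X\<close> with values in \<open>Y\<close>, as functions of the list of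
  their arguments; they are \<open>0\<close> on all lists that are not in $X^p$.
\<close>

definition alt_forms ::
  "'s set \<Rightarrow> ('s \<Rightarrow> 'x \<Rightarrow> 'x) \<Rightarrow> 'x::ab_group_add set \<Rightarrow> ('s \<Rightarrow> 'y \<Rightarrow> 'y) \<Rightarrow> 'y::ab_group_add set \<Rightarrow> nat \<Rightarrow>
   ('x list \<Rightarrow> 'y) set" where
  "alt_forms S sx X sy Y p = {f.
     (\<forall>xs. if length xs = p \<and> set xs \<subseteq> X then f xs \<in> Y else f xs = 0) \<and>
     (\<forall>xs i. length xs = p \<longrightarrow> set xs \<subseteq> X \<longrightarrow> i < p \<longrightarrow> lin_on S X sx sy (\<lambda>x. f (xs[i := x]))) \<and>
     (\<forall>xs i j. length xs = p \<longrightarrow> set xs \<subseteq> X \<longrightarrow> i < j \<longrightarrow> j < p \<longrightarrow> xs ! i = xs ! j \<longrightarrow> f xs = 0)}"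

definition form0 :: "'y::zero \<Rightarrow> 'x list \<Rightarrow> 'y" where
  "form0 y = (\<lambda>xs. if xs = [] then y else 0)"

text \<open>The shuffle product of a \<open>p\<close>-form with another form: \<open>I\<close> is the set of positions of the
  arguments of \<open>\<alpha>\<close>, and the sign of the shuffle is given by its number of inversions.\<close>

definition wedge ::
  "('a \<Rightarrow> 'm \<Rightarrow> 'm) \<Rightarrow> nat \<Rightarrow> ('x list \<Rightarrow> 'a) \<Rightarrow> ('x list \<Rightarrow> 'm::ab_group_add) \<Rightarrow> 'x list \<Rightarrow> 'm" where
  "wedge scale p \<alpha> f = (\<lambda>xs. \<Sum>I | I \<subseteq> {..<length xs} \<and> card I = p.
     sg (card {(i, j). i \<in> I \<and> j < length xs \<and> j \<notin> I \<and> j < i})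
       (scale (\<alpha> (nths xs I)) (f (nths xs (- I)))))"


section \<open>Lie-Rinehart algebras\<close>

text \<open>The \<open>R\<close>-module structure of an \<open>A\<close>-module is the one induced by $R \to A$.\<close>

definition induced_rscale ::
  "('r \<Rightarrow> 'a \<Rightarrow> 'a::{comm_ring,comm_monoid_mult}) \<Rightarrow> ('a \<Rightarrow> 'm \<Rightarrow> 'm) \<Rightarrow> 'r \<Rightarrow> 'm \<Rightarrow> 'm" where
  "induced_rscale rsc scale r = scale (rsc r 1)"

locale lie_rinehart = comm_algebra rsc + L: unital_module scale
  for rsc :: "'r::{comm_ring,comm_monoid_mult} \<Rightarrow> 'a::{comm_ring,comm_monoid_mult} \<Rightarrow> 'a"
    and scale :: "'a \<Rightarrow> 'l::ab_group_add \<Rightarrow> 'l" +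
  fixes br :: "'l \<Rightarrow> 'l \<Rightarrow> 'l" and act :: "'l \<Rightarrow> 'a \<Rightarrow> 'a"
  assumes br_bilinear: "bilinear_map (induced_rscale rsc scale) (induced_rscale rsc scale)
      (induced_rscale rsc scale) br"
    and br_self: "br x x = 0"
    and jacobi: "br x (br y z) + br y (br z x) + br z (br x y) = 0"
    and act_derivation: "derivation rsc (act x)"
    and act_linear: "linear_map (induced_rscale rsc scale) rsc (\<lambda>x. act x a)"
    and act_br: "act (br x y) a = act x (act y a) - act y (act x a)"
    and act_scale: "act (scale a x) b = a * act x b"
    and br_scale: "br x (scale a y) = scale (act x a) y + scale a (br x y)"


section \<open>Triples\<close>

text \<open>In the field names, \<open>HQ x \<xi>\<close> is $x \cdot \xi$ and \<open>QH \<xi> x\<close> is $\xi \cdot x$.\<close>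

record ('r, 'a, 'h, 'q) triple =
  rsc :: "'r \<Rightarrow> 'a \<Rightarrow> 'a"
  sH :: "'a \<Rightarrow> 'h \<Rightarrow> 'h"
  sQ :: "'a \<Rightarrow> 'q \<Rightarrow> 'q"
  brH :: "'h \<Rightarrow> 'h \<Rightarrow> 'h"
  brQ :: "'q \<Rightarrow> 'q \<Rightarrow> 'q"
  actH :: "'h \<Rightarrow> 'a \<Rightarrow> 'a"
  actQ :: "'q \<Rightarrow> 'a \<Rightarrow> 'a"
  HQ :: "'h \<Rightarrow> 'q \<Rightarrow> 'q"
  QH :: "'q \<Rightarrow> 'h \<Rightarrow> 'h"
  dlt :: "'q \<Rightarrow> 'q \<Rightarrow> 'h"

abbreviation rH where "rH T \<equiv> induced_rscale (rsc T) (sH T)"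
abbreviation rQ where "rQ T \<equiv> induced_rscale (rsc T) (sQ T)"

locale almost_pre_lie_rinehart_triple =
  fixes T :: "('r::{comm_ring,comm_monoid_mult}, 'a::{comm_ring,comm_monoid_mult},
      'h::ab_group_add, 'q::ab_group_add) triple"
  assumes algebra_A: "comm_algebra (rsc T)"
    and module_H: "unital_module (sH T)"
    and module_Q: "unital_module (sQ T)"
    and brH_bilinear: "bilinear_map (rH T) (rH T) (rH T) (brH T)"
    and brH_self: "brH T x x = 0"
    and brQ_bilinear: "bilinear_map (rQ T) (rQ T) (rQ T) (brQ T)"
    and brQ_self: "brQ T \<xi> \<xi> = 0"
    and actH_bilinear: "bilinear_map (rH T) (rsc T) (rsc T) (actH T)"
    and actQ_bilinear: "bilinear_map (rQ T) (rsc T) (rsc T) (actQ T)"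
    and HQ_bilinear: "bilinear_map (rH T) (rQ T) (rQ T) (HQ T)"
    and QH_bilinear: "bilinear_map (rQ T) (rH T) (rH T) (QH T)"
    and dlt_bilinear: "bilinear_map (sQ T) (sQ T) (sH T) (dlt T)"
    and dlt_self: "dlt T \<xi> \<xi> = 0"
    and actH_derivation: "derivation (rsc T) (actH T x)"
    and actQ_derivation: "derivation (rsc T) (actQ T \<xi>)"
    and actH_scale: "actH T (sH T a x) b = a * actH T x b"
    and brH_scale: "brH T x (sH T a y) = sH T (actH T x a) y + sH T a (brH T x y)"
    and actQ_scale: "actQ T (sQ T a \<xi>) b = a * actQ T \<xi> b"
    and brQ_scale: "brQ T \<xi> (sQ T a \<eta>) = sQ T (actQ T \<xi> a) \<eta> + sQ T a (brQ T \<xi> \<eta>)"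
    and HQ_scale_right: "HQ T x (sQ T a \<xi>) = sQ T (actH T x a) \<xi> + sQ T a (HQ T x \<xi>)"
    and HQ_scale_left: "HQ T (sH T a x) \<xi> = sQ T a (HQ T x \<xi>)"
    and QH_scale_right: "QH T \<xi> (sH T a x) = sH T (actQ T \<xi> a) x + sH T a (QH T \<xi> x)"
    and QH_scale_left: "QH T (sQ T a \<xi>) x = sH T a (QH T \<xi> x)"

locale pre_lie_rinehart_triple = almost_pre_lie_rinehart_triple T
  for T :: "('r::{comm_ring,comm_monoid_mult}, 'a::{comm_ring,comm_monoid_mult},
      'h::ab_group_add, 'q::ab_group_add) triple" +
  assumes lie_rinehart_H: "lie_rinehart (rsc T) (sH T) (brH T) (actH T)"
    and HQ_br: "HQ T (brH T x y) \<xi> = HQ T x (HQ T y \<xi>) - HQ T y (HQ T x \<xi>)"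

definition sL :: "('r, 'a, 'h, 'q) triple \<Rightarrow> 'a \<Rightarrow> 'h \<times> 'q \<Rightarrow> 'h \<times> 'q" where
  "sL T a = (\<lambda>(x, \<xi>). (sH T a x, sQ T a \<xi>))"

definition brL ::
  "('r, 'a, 'h::ab_group_add, 'q::ab_group_add) triple \<Rightarrow> 'h \<times> 'q \<Rightarrow> 'h \<times> 'q \<Rightarrow> 'h \<times> 'q" where
  "brL T = (\<lambda>(x, \<xi>) (y, \<eta>).
     (brH T x y + dlt T \<xi> \<eta> - QH T \<eta> x + QH T \<xi> y, brQ T \<xi> \<eta> + HQ T x \<eta> - HQ T y \<xi>))"

definition actL :: "('r, 'a::plus, 'h, 'q) triple \<Rightarrow> 'h \<times> 'q \<Rightarrow> 'a \<Rightarrow> 'a" where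
  "actL T = (\<lambda>(x, \<xi>) a. actH T x a + actQ T \<xi> a)"

locale lie_rinehart_triple = almost_pre_lie_rinehart_triple T
  for T :: "('r::{comm_ring,comm_monoid_mult}, 'a::{comm_ring,comm_monoid_mult},
      'h::ab_group_add, 'q::ab_group_add) triple" +
  assumes lie_rinehart_L: "lie_rinehart (rsc T) (sL T) (brL T) (actL T)"


section \<open>Quasi-Lie-Rinehart algebras\<close>

text \<open>
  A graded object is the family of its homogeneous components, and an operation on graded objects
  is the family of its restrictions to components. Thus \<open>mul p q\<close> is the multiplication
  $\mathcal{A}^p \times \mathcal{A}^q \to \mathcal{A}^{p+q}$, and \<open>d q\<close> is the differential
  $\mathcal{A}^q \to \mathcal{A}^{q+1}$. The ring $A$ is \<open>A 0\<close>.
\<close>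

locale dg_comm_algebra =
  fixes rsc :: "'r::{comm_ring,comm_monoid_mult} \<Rightarrow> 'c::ab_group_add \<Rightarrow> 'c"
    and A :: "nat \<Rightarrow> 'c set"
    and mul :: "nat \<Rightarrow> nat \<Rightarrow> 'c \<Rightarrow> 'c \<Rightarrow> 'c"
    and one :: 'c
    and d :: "nat \<Rightarrow> 'c \<Rightarrow> 'c"
  assumes A_subgroup: "add_subgroup (A q)"
    and rsc_closed: "a \<in> A q \<Longrightarrow> rsc r a \<in> A q"
    and rsc_add_right: "a \<in> A q \<Longrightarrow> b \<in> A q \<Longrightarrow> rsc r (a + b) = rsc r a + rsc r b"
    and rsc_add_left: "a \<in> A q \<Longrightarrow> rsc (r + s) a = rsc r a + rsc s a"
    and rsc_rsc: "a \<in> A q \<Longrightarrow> rsc r (rsc s a) = rsc (r * s) a"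
    and rsc_one: "a \<in> A q \<Longrightarrow> rsc 1 a = a"
    and mul_closed: "a \<in> A p \<Longrightarrow> b \<in> A q \<Longrightarrow> mul p q a b \<in> A (p + q)"
    and mul_bilinear: "bilin_on UNIV (A p) (A q) rsc rsc rsc (mul p q)"
    and mul_assoc: "a \<in> A p \<Longrightarrow> b \<in> A q \<Longrightarrow> c \<in> A n \<Longrightarrow>
      mul (p + q) n (mul p q a b) c = mul p (q + n) a (mul q n b c)"
    and one_closed: "one \<in> A 0"
    and mul_one: "a \<in> A q \<Longrightarrow> mul 0 q one a = a"
    and mul_commute: "a \<in> A p \<Longrightarrow> b \<in> A q \<Longrightarrow> mul p q a b = sg (p * q) (mul q p b a)"
    and d_closed: "a \<in> A q \<Longrightarrow> d q a \<in> A (q + 1)"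
    and d_linear: "lin_on UNIV (A q) rsc rsc (d q)"
    and d_square: "a \<in> A q \<Longrightarrow> d (q + 1) (d q a) = 0"
    and d_mul: "a \<in> A p \<Longrightarrow> b \<in> A q \<Longrightarrow>
      d (p + q) (mul p q a b) = mul (p + 1) q (d p a) b + sg p (mul p (q + 1) a (d q b))"

locale dg_module = dg_comm_algebra rsc A mul one d
  for rsc :: "'r::{comm_ring,comm_monoid_mult} \<Rightarrow> 'c::ab_group_add \<Rightarrow> 'c"
    and A mul one d +
  fixes Q :: "nat \<Rightarrow> 'd::ab_group_add set"
    and sm :: "nat \<Rightarrow> nat \<Rightarrow> 'c \<Rightarrow> 'd \<Rightarrow> 'd"
    and dQ :: "nat \<Rightarrow> 'd \<Rightarrow> 'd"
  assumes Q_subgroup: "add_subgroup (Q q)"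
    and sm_closed: "a \<in> A p \<Longrightarrow> u \<in> Q q \<Longrightarrow> sm p q a u \<in> Q (p + q)"
    and sm_add_right: "a \<in> A p \<Longrightarrow> u \<in> Q q \<Longrightarrow> v \<in> Q q \<Longrightarrow>
      sm p q a (u + v) = sm p q a u + sm p q a v"
    and sm_add_left: "a \<in> A p \<Longrightarrow> b \<in> A p \<Longrightarrow> u \<in> Q q \<Longrightarrow>
      sm p q (a + b) u = sm p q a u + sm p q b u"
    and sm_sm: "a \<in> A p \<Longrightarrow> b \<in> A q \<Longrightarrow> u \<in> Q r \<Longrightarrow>
      sm (p + q) r (mul p q a b) u = sm p (q + r) a (sm q r b u)"
    and sm_one: "u \<in> Q q \<Longrightarrow> sm 0 q one u = u"
    and dQ_closed: "u \<in> Q q \<Longrightarrow> dQ q u \<in> Q (q + 1)"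
    and dQ_linear: "lin_on UNIV (Q q) (\<lambda>r. sm 0 q (rsc r one)) (\<lambda>r. sm 0 (q + 1) (rsc r one)) (dQ q)"
    and dQ_square: "u \<in> Q q \<Longrightarrow> dQ (q + 1) (dQ q u) = 0"
    and dQ_sm: "a \<in> A p \<Longrightarrow> u \<in> Q q \<Longrightarrow>
      dQ (p + q) (sm p q a u) = sm (p + 1) q (d p a) u + sg p (sm p (q + 1) a (dQ q u))"
begin

abbreviation rQ_mod :: "nat \<Rightarrow> 'r \<Rightarrow> 'd \<Rightarrow> 'd" where
  "rQ_mod q r \<equiv> sm 0 q (rsc r one)"

definition tensor_Q :: "nat \<Rightarrow> ('c \<times> 'd) multiset set set" where
  "tensor_Q q = tensor (A 0) (mul 0 q) (A q) (sm 0 0) (Q 0)"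

end

text \<open>The module $Q$ is \<open>Q 0\<close>; that the graded module is $\mathcal{A} \otimes_A Q$ is expressed by
  \<open>induced\<close>. In \<open>tri q \<xi> \<eta> \<alpha>\<close> (which is $\langle\xi,\eta;\alpha\rangle_Q$) the case \<open>q = 0\<close>
  is the one with values in $\mathcal{A}^{-1} = 0$.\<close>

locale pre_quasi_lie_rinehart = dg_module rsc A mul one d Q sm dQ
  for rsc :: "'r::{comm_ring,comm_monoid_mult} \<Rightarrow> 'c::ab_group_add \<Rightarrow> 'c"
    and A mul one d
    and Q :: "nat \<Rightarrow> 'd::ab_group_add set"
    and sm dQ +
  fixes br :: "nat \<Rightarrow> nat \<Rightarrow> 'd \<Rightarrow> 'd \<Rightarrow> 'd"
    and pair :: "nat \<Rightarrow> nat \<Rightarrow> 'd \<Rightarrow> 'c \<Rightarrow> 'c"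
    and tri :: "nat \<Rightarrow> 'd \<Rightarrow> 'd \<Rightarrow> 'c \<Rightarrow> 'c"
  assumes induced: "bij_betw (tensor_map (sm q 0)) (tensor_Q q) (Q q)"
    and br_closed: "u \<in> Q p \<Longrightarrow> v \<in> Q q \<Longrightarrow> br p q u v \<in> Q (p + q)"
    and br_bilinear: "bilin_on UNIV (Q p) (Q q) (rQ_mod p) (rQ_mod q) (rQ_mod (p + q)) (br p q)"
    and br_skew: "u \<in> Q p \<Longrightarrow> v \<in> Q q \<Longrightarrow> br p q u v = - sg (p * q) (br q p v u)"
    and pair_closed: "u \<in> Q p \<Longrightarrow> a \<in> A q \<Longrightarrow> pair p q u a \<in> A (p + q)"
    and pair_bilinear: "bilin_on UNIV (Q p) (A q) (rQ_mod p) rsc rsc (pair p q)"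
    and tri_closed: "\<xi> \<in> Q 0 \<Longrightarrow> \<eta> \<in> Q 0 \<Longrightarrow> a \<in> A q \<Longrightarrow> tri q \<xi> \<eta> a \<in> A (q - 1)"
    and tri_degree_0: "\<xi> \<in> Q 0 \<Longrightarrow> \<eta> \<in> Q 0 \<Longrightarrow> a \<in> A 0 \<Longrightarrow> tri 0 \<xi> \<eta> a = 0"
    and tri_linear_1: "\<eta> \<in> Q 0 \<Longrightarrow> a \<in> A q \<Longrightarrow>
      lin_on (A 0) (Q 0) (sm 0 0) (mul 0 (q - 1)) (\<lambda>\<xi>. tri q \<xi> \<eta> a)"
    and tri_linear_2: "\<xi> \<in> Q 0 \<Longrightarrow> a \<in> A q \<Longrightarrow>
      lin_on (A 0) (Q 0) (sm 0 0) (mul 0 (q - 1)) (\<lambda>\<eta>. tri q \<xi> \<eta> a)"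
    and tri_linear_3: "\<xi> \<in> Q 0 \<Longrightarrow> \<eta> \<in> Q 0 \<Longrightarrow>
      lin_on (A 0) (A q) (mul 0 q) (mul 0 (q - 1)) (tri q \<xi> \<eta>)"
    and tri_self: "\<xi> \<in> Q 0 \<Longrightarrow> a \<in> A q \<Longrightarrow> tri q \<xi> \<xi> a = 0"
    and pair_derivation: "u \<in> Q p \<Longrightarrow> a \<in> A q \<Longrightarrow> b \<in> A r \<Longrightarrow>
      pair p (q + r) u (mul q r a b) =
        mul (p + q) r (pair p q u a) b + sg (p * q) (mul q (p + r) a (pair p r u b))"
    and tri_derivation: "\<xi> \<in> Q 0 \<Longrightarrow> \<eta> \<in> Q 0 \<Longrightarrow> b \<in> A p \<Longrightarrow> a \<in> A q \<Longrightarrow>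
      tri (p + q) \<xi> \<eta> (mul p q b a) =
        sg q (mul (p - 1) q (tri p \<xi> \<eta> b) a) + mul p (q - 1) b (tri q \<xi> \<eta> a)"
    and pair_sm: "a \<in> A r \<Longrightarrow> u \<in> Q p \<Longrightarrow> b \<in> A q \<Longrightarrow>
      pair (r + p) q (sm r p a u) b = mul r (p + q) a (pair p q u b)"
    and br_sm: "u \<in> Q p \<Longrightarrow> a \<in> A r \<Longrightarrow> v \<in> Q q \<Longrightarrow>
      br p (r + q) u (sm r q a v) =
        sm (p + r) q (pair p r u a) v + sg (p * r) (sm r (p + q) a (br p q u v))"
begin

definition AltQ :: "nat \<Rightarrow> nat \<Rightarrow> ('d list \<Rightarrow> 'c) set" where
  "AltQ p q = alt_forms (A 0) (sm 0 0) (Q 0) (mul 0 q) (A q) p"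

text \<open>The value of the \<open>\<A>\<close>-multilinear extension of \<open>f \<in> AltQ p q\<close> when the argument in position
  \<open>j\<close> is replaced by \<open>u \<in> Q r\<close> and the others are in \<open>Q 0\<close>.\<close>

definition extended :: "nat \<Rightarrow> nat \<Rightarrow> nat \<Rightarrow> ('d list \<Rightarrow> 'c) \<Rightarrow> 'd list \<Rightarrow> nat \<Rightarrow> 'd \<Rightarrow> 'c" where
  "extended p q r f xs j u =
     along_iso (tensor_Q r) (sm r 0) (\<lambda>a \<xi>. sg ((p + q) * r) (mul r q a (f (xs[j := \<xi>])))) u"

text \<open>In the following operators on \<open>AltQ p q\<close> positions are counted from 0; this does not change
  the parity of \<open>j + k\<close> but turns $j - 1$ into \<open>j\<close>.\<close>

definition d0 :: "nat \<Rightarrow> nat \<Rightarrow> ('d list \<Rightarrow> 'c) \<Rightarrow> 'd list \<Rightarrow> 'c" where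
  "d0 p q f = (\<lambda>xs. if length xs = p \<and> set xs \<subseteq> Q 0
     then d q (f xs) + sg (p + q + 1) (\<Sum>j<p. extended p q 1 f xs j (dQ 0 (xs ! j)))
     else 0)"

definition d1 :: "nat \<Rightarrow> nat \<Rightarrow> ('d list \<Rightarrow> 'c) \<Rightarrow> 'd list \<Rightarrow> 'c" where
  "d1 p q f = (\<lambda>xs. if length xs = p + 1 \<and> set xs \<subseteq> Q 0
     then sg (p + q + 1)
       ((\<Sum>j<p + 1. sg j (pair 0 q (xs ! j) (f (nths xs (- {j}))))) +
        (\<Sum>k<p + 1. \<Sum>j<k. sg (j + k) (f (br 0 0 (xs ! j) (xs ! k) # nths xs (- {j, k})))))
     else 0)"

definition d2 :: "nat \<Rightarrow> nat \<Rightarrow> ('d list \<Rightarrow> 'c) \<Rightarrow> 'd list \<Rightarrow> 'c" where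
  "d2 p q f = (\<lambda>xs. if length xs = p + 2 \<and> set xs \<subseteq> Q 0
     then sg (p + q + 1) (sg p
       (\<Sum>k<p + 2. \<Sum>j<k. sg (j + k) (tri q (xs ! j) (xs ! k) (f (nths xs (- {j, k}))))))
     else 0)"

end

text \<open>The operator \<open>d2\<close> maps \<open>AltQ p q\<close> to \<open>AltQ (p + 2) (q - 1)\<close>, being zero if \<open>q = 0\<close>. An element
  of $\mathcal{A}^q$ is a 0-form via \<open>form0\<close>, and $\mathrm{Hom}_A(Q,A)$ is \<open>AltQ 1 0\<close>.\<close>

locale quasi_lie_rinehart = pre_quasi_lie_rinehart rsc A mul one d Q sm dQ br pair tri
  for rsc :: "'r::{comm_ring,comm_monoid_mult} \<Rightarrow> 'c::ab_group_add \<Rightarrow> 'c"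
    and A mul one d
    and Q :: "nat \<Rightarrow> 'd::ab_group_add set"
    and sm dQ br pair tri +
  assumes d0_operator: "f \<in> AltQ p q \<Longrightarrow> d0 p q f \<in> AltQ p (q + 1)"
    and dQ_br: "u \<in> Q p \<Longrightarrow> v \<in> Q q \<Longrightarrow>
      dQ (p + q) (br p q u v) = br (p + 1) q (dQ p u) v + sg p (br p (q + 1) u (dQ q v))"
    and d_pair: "u \<in> Q p \<Longrightarrow> a \<in> A q \<Longrightarrow>
      d (p + q) (pair p q u a) = pair (p + 1) q (dQ p u) a + sg p (pair p (q + 1) u (d q a))"
    and pair_br: "\<xi> \<in> Q 0 \<Longrightarrow> \<eta> \<in> Q 0 \<Longrightarrow> a \<in> A q \<Longrightarrow>
      pair 0 q \<xi> (pair 0 q \<eta> a) - pair 0 q \<eta> (pair 0 q \<xi> a) - pair 0 q (br 0 0 \<xi> \<eta>) a =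
        d0 2 (q - 1) (d2 0 q (form0 a)) [\<xi>, \<eta>] + d2 0 (q + 1) (d0 0 q (form0 a)) [\<xi>, \<eta>]"
    and jacobi_br: "\<xi> \<in> Q 0 \<Longrightarrow> \<eta> \<in> Q 0 \<Longrightarrow> \<theta> \<in> Q 0 \<Longrightarrow> f \<in> AltQ 1 0 \<Longrightarrow>
      f [br 0 0 (br 0 0 \<xi> \<eta>) \<theta>] + f [br 0 0 (br 0 0 \<eta> \<theta>) \<xi>] + f [br 0 0 (br 0 0 \<theta> \<xi>) \<eta>] =
        d2 1 1 (d0 1 0 f) [\<xi>, \<eta>, \<theta>] -
          (d2 0 1 (d0 0 0 (form0 (f [\<theta>]))) [\<xi>, \<eta>] +
           d2 0 1 (d0 0 0 (form0 (f [\<xi>]))) [\<eta>, \<theta>] +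
           d2 0 1 (d0 0 0 (form0 (f [\<eta>]))) [\<theta>, \<xi>])"
    and d1_d2: "f \<in> AltQ p q \<Longrightarrow> d1 (p + 2) (q - 1) (d2 p q f) xs + d2 (p + 1) q (d1 p q f) xs = 0"


section \<open>The pair of a triple\<close>

definition AltHA :: "('r, 'a::{comm_ring,comm_monoid_mult}, 'h::ab_group_add, 'q) triple \<Rightarrow> nat \<Rightarrow>
    ('h list \<Rightarrow> 'a) set" where
  "AltHA T q = alt_forms UNIV (sH T) UNIV (*) UNIV q"

definition AltHQ :: "('r, 'a::{comm_ring,comm_monoid_mult}, 'h::ab_group_add, 'q::ab_group_add) triple \<Rightarrow> nat \<Rightarrow>
    ('h list \<Rightarrow> 'q) set" where
  "AltHQ T q = alt_forms UNIV (sH T) UNIV (sQ T) UNIV q"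

definition pair_rscale :: "('r, 'a, 'h, 'q) triple \<Rightarrow> 'r \<Rightarrow> ('h list \<Rightarrow> 'a) \<Rightarrow> 'h list \<Rightarrow> 'a" where
  "pair_rscale T r \<alpha> = (\<lambda>xs. rsc T r (\<alpha> xs))"

definition pair_mul :: "nat \<Rightarrow> nat \<Rightarrow> ('h list \<Rightarrow> 'a::{comm_ring,comm_monoid_mult}) \<Rightarrow> ('h list \<Rightarrow> 'a) \<Rightarrow>
    'h list \<Rightarrow> 'a" where
  "pair_mul p q \<alpha> \<beta> = sg (p * q) (wedge (*) p \<alpha> \<beta>)"

definition pair_scale :: "('r, 'a, 'h, 'q::ab_group_add) triple \<Rightarrow> nat \<Rightarrow> nat \<Rightarrow> ('h list \<Rightarrow> 'a) \<Rightarrow>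
    ('h list \<Rightarrow> 'q) \<Rightarrow> 'h list \<Rightarrow> 'q" where
  "pair_scale T p q \<alpha> f = sg (p * q) (wedge (sQ T) p \<alpha> f)"

definition alt_diff :: "('h \<Rightarrow> 'h \<Rightarrow> 'h) \<Rightarrow> ('h \<Rightarrow> 'm \<Rightarrow> 'm) \<Rightarrow> nat \<Rightarrow> ('h list \<Rightarrow> 'm::ab_group_add) \<Rightarrow>
    'h list \<Rightarrow> 'm" where
  "alt_diff br act q f = (\<lambda>xs. if length xs = q + 1
     then sg (q + 1)
       ((\<Sum>j<q + 1. sg j (act (xs ! j) (f (nths xs (- {j}))))) +
        (\<Sum>k<q + 1. \<Sum>j<k. sg (j + k) (f (br (xs ! j) (xs ! k) # nths xs (- {j, k})))))
     else 0)"

definition simple_tensor :: "('r, 'a, 'h, 'q) triple \<Rightarrow> ('h list \<Rightarrow> 'a) \<Rightarrow> 'q \<Rightarrow> 'h list \<Rightarrow> 'q" where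
  "simple_tensor T \<alpha> \<xi> = (\<lambda>xs. sQ T (\<alpha> xs) \<xi>)"

definition AltHA_tensor_Q ::
  "('r, 'a::{comm_ring,comm_monoid_mult}, 'h::ab_group_add, 'q::ab_group_add) triple \<Rightarrow> nat \<Rightarrow>
   (('h list \<Rightarrow> 'a) \<times> 'q) multiset set set" where
  "AltHA_tensor_Q T q = tensor UNIV (\<lambda>a \<alpha> xs. a * \<alpha> xs) (AltHA T q) (sQ T) UNIV"

definition canonical_map_iso ::
  "('r, 'a::{comm_ring,comm_monoid_mult}, 'h::ab_group_add, 'q::ab_group_add) triple \<Rightarrow> bool" where
  "canonical_map_iso T \<longleftrightarrow>
     (\<forall>q. bij_betw (tensor_map (simple_tensor T)) (AltHA_tensor_Q T q) (AltHQ T q))"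

definition Q_action ::
  "('r, 'a::ab_group_add, 'h, 'q) triple \<Rightarrow> 'q \<Rightarrow> ('h list \<Rightarrow> 'a) \<Rightarrow> 'h list \<Rightarrow> 'a" where
  "Q_action T \<xi> \<alpha> = (\<lambda>xs. actQ T \<xi> (\<alpha> xs) - (\<Sum>j<length xs. \<alpha> (xs[j := QH T \<xi> (xs ! j)])))"

definition pair_pairing ::
  "('r, 'a::{comm_ring,comm_monoid_mult}, 'h::ab_group_add, 'q::ab_group_add) triple \<Rightarrow> nat \<Rightarrow> nat \<Rightarrow>
   ('h list \<Rightarrow> 'q) \<Rightarrow> ('h list \<Rightarrow> 'a) \<Rightarrow> 'h list \<Rightarrow> 'a" where
  "pair_pairing T p q u \<beta> = along_iso (AltHA_tensor_Q T p) (simple_tensor T)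
     (\<lambda>\<alpha> \<xi>. pair_mul p q \<alpha> (Q_action T \<xi> \<beta>)) u"

definition pair_bracket ::
  "('r, 'a::{comm_ring,comm_monoid_mult}, 'h::ab_group_add, 'q::ab_group_add) triple \<Rightarrow> nat \<Rightarrow> nat \<Rightarrow>
   ('h list \<Rightarrow> 'q) \<Rightarrow> ('h list \<Rightarrow> 'q) \<Rightarrow> 'h list \<Rightarrow> 'q" where
  "pair_bracket T p q u v =
     along_iso (AltHA_tensor_Q T p) (simple_tensor T) (\<lambda>\<alpha> \<xi>.
       along_iso (AltHA_tensor_Q T q) (simple_tensor T) (\<lambda>\<beta> \<eta>.
         simple_tensor T (pair_mul p q \<alpha> (Q_action T \<xi> \<beta>)) \<eta>
         - sg (p * q) (simple_tensor T (pair_mul q p \<beta> (Q_action T \<eta> \<alpha>)) \<xi>)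
         + simple_tensor T (pair_mul p q \<alpha> \<beta>) (brQ T \<xi> \<eta>)) v) u"

text \<open>An element \<open>\<xi>\<close> of $Q$ is the 0-form \<open>form0 \<xi>\<close> in \<open>AltHQ T 0\<close>, and is recovered as its value at
  \<open>[]\<close>. For a 0-form \<open>\<alpha>\<close> the result is 0, since \<open>\<alpha>\<close> vanishes on nonempty lists.\<close>

definition pair_tri ::
  "('r, 'a, 'h, 'q) triple \<Rightarrow> nat \<Rightarrow> ('h list \<Rightarrow> 'q) \<Rightarrow> ('h list \<Rightarrow> 'q) \<Rightarrow> ('h list \<Rightarrow> 'a) \<Rightarrow> 'h list \<Rightarrow> 'a" where
  "pair_tri T q u v \<alpha> = (\<lambda>xs. \<alpha> (dlt T (u []) (v []) # xs))"

end

theory Submission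
  imports Defs "HOL.Modules"
begin

text \<open>
  Everything rests on Cartan's formulas, taken as recursions on the list of arguments: the
  Chevalley-Eilenberg differential satisfies $\iota_x d = L_x - d \iota_x$, the shuffle product
  $\iota_x(\alpha \wedge f) = \iota_x\alpha \wedge f + (-1)^{|\alpha|} \alpha \wedge \iota_x f$. With
  them, each identity between forms becomes an induction on the length of the argument list.

  The pair of a pre-Lie-Rinehart triple is always a pre-quasi-Lie-Rinehart algebra. The axioms of a
  Lie-Rinehart algebra for $H \oplus Q$ that are not automatic split into seven conditions that relate
  the operations of $H$ and $Q$: the $H$- and $Q$-components of the Jacobi identity and the
  compatibility of action and bracket, for arguments from $H$ or $Q$. On the other side, axiom (1) always
  holds; axiom (3) need only be checked for $u \in Q$, where it is equivalent to the two conditions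
  \<open>compat_A\<close> and \<open>compat_H\<close>; granted (3), axiom (2) need only be checked on $Q$, where it is
  \<open>compat_Q\<close>; (4) amounts to \<open>compat_act\<close> and \<open>compat_curv\<close>, (5) to \<open>compat_jac_Q\<close>, and (6)
  to \<open>compat_jac_H\<close>. Property P serves to recover an identity in $H$ or $Q$ from its images under all
  linear forms.
\<close>

section \<open>Signs and modules\<close>

text \<open>Three obstacles shape the development. The pairing and the bracket are prescribed on
  simple tensors only, and the bracket contains derivatives of both factors. On
  \<open>AltHQ T q\<close> they exist only through the inverse of the canonical isomorphism, so each
  formula must be shown balanced, and every later identity is proved by induction over sums of
  simple tensors. The degree 0 parts of the pair are forms on the empty list instead of
  \<open>'a\<close> and \<open>'q\<close>; \<open>form0\<close> and evaluation at \<open>[]\<close>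
  pass between the two. Finally 2 need not be invertible, so skew-symmetry (enough for moving
  arguments) is kept apart from vanishing on equal arguments (part of being a form). The operators
  of the calculus are defined on arbitrary functions of lists and carry no degree; signs depending
  on a degree are read off from a list length and become a fixed \<open>sg p\<close> once the
  support is known. The test forms for property P are as small as possible: 0-forms give the
  identities in A, and 1-forms made from a linear form on H, or a linear form on Q, give those in H
  or Q. \<open>compat_Q\<close> is read off directly, because both sides of its axiom are
  Q-valued.\<close>

lemma sg_0 [simp]: "sg 0 x = x"
  and sg_Suc [simp]: "sg (Suc n) x = - sg n x"
  and sg_zero [simp]: "sg n 0 = 0"
  and sg_sg: "sg m (sg n x) = sg (m + n) x"
  and sg_self [simp]: "sg n (sg n x) = x"
  and sg_add: "sg n (x + y) = sg n x + sg n y"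
  and sg_diff: "sg n (x - y) = sg n x - sg n y"
  and sg_minus: "sg n (- x) = - sg n x"
  by (auto simp: sg_def)

lemma sg_sum: "sg n (sum f A) = (\<Sum>x\<in>A. sg n (f x))"
  by (simp add: sg_def sum_negf)

lemma sg_apply: "sg n f x = sg n (f x)"
  by (simp add: sg_def)

lemma additive_sg: "additive f \<Longrightarrow> f (sg n x) = sg n (f x)"
  by (simp add: sg_def additive.minus)

lemma sum_apply: "sum f A x = (\<Sum>i\<in>A. f i x)"
  by (induction A rule: infinite_finite_induct) auto

lemma unital_module_mult: "unital_module ((*) :: 'a \<Rightarrow> 'a \<Rightarrow> 'a::{comm_ring,comm_monoid_mult})"
  by unfold_locales (auto simp: algebra_simps)

context unital_module
begin

lemma additive_right: "additive (scale a)"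
  by unfold_locales (rule scale_add_right)

lemma additive_left: "additive (\<lambda>a. scale a x)"
  by unfold_locales (rule scale_add_left)

lemmas scale_zero_right [simp] = additive.zero [OF additive_right]
  and scale_minus_right = additive.minus [OF additive_right]
  and scale_diff_right = additive.diff [OF additive_right]
  and scale_sum_right = additive.sum [OF additive_right]
  and scale_sg_right = additive_sg [OF additive_right]

lemmas scale_zero_left [simp] = additive.zero [OF additive_left]
  and scale_minus_left = additive.minus [OF additive_left]
  and scale_diff_left = additive.diff [OF additive_left]
  and scale_sg_left = additive_sg [OF additive_left]

end


section \<open>Cartan calculus for functions of lists\<close>

text \<open>Contraction with a first argument. Being an abbreviation, it disappears under
  simplification, so that the recursions below act as rewrite rules on a consed list.\<close>

abbreviation ctr :: "'x \<Rightarrow> ('x list \<Rightarrow> 'm) \<Rightarrow> 'x list \<Rightarrow> 'm" where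
  "ctr x f \<equiv> \<lambda>xs. f (x # xs)"

text \<open>A Lie derivative with independent parts: \<open>D\<close> acts on values and
  \<open>N\<close> on arguments. It serves as L_x for x in H, as the action of an element of Q, and,
  with \<open>D\<close> zero, as minus the sum over all substitutions of \<open>N\<close> into one
  argument.\<close>

definition lie :: "('m \<Rightarrow> 'm) \<Rightarrow> ('x \<Rightarrow> 'x) \<Rightarrow> ('x list \<Rightarrow> 'm) \<Rightarrow> 'x list \<Rightarrow> 'm::ab_group_add" where
  "lie D N f xs = D (f xs) - (\<Sum>j<length xs. f (xs[j := N (xs ! j)]))"

text \<open>Alternating sums over one removed argument, and in \<open>fan2\<close> over two. The
  differentials on H and the operators \<open>d1\<close> and \<open>d2\<close> on Q are all built
  from them.\<close>

definition fan :: "('x \<Rightarrow> 'x list \<Rightarrow> 'm) \<Rightarrow> 'x list \<Rightarrow> 'm::ab_group_add" where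
  "fan F xs = (\<Sum>j<length xs. sg j (F (xs ! j) (nths xs (- {j}))))"

definition fan2 :: "('x \<Rightarrow> 'x \<Rightarrow> 'x list \<Rightarrow> 'm) \<Rightarrow> 'x list \<Rightarrow> 'm::ab_group_add" where
  "fan2 G xs = (\<Sum>k<length xs. \<Sum>j<k. sg (j + k) (G (xs ! j) (xs ! k) (nths xs (- {j, k}))))"

text \<open>This agrees with the usual formula for the differential only on skew-symmetric functions
  (\<open>ce_eq\<close>).\<close>

primrec ce :: "('x \<Rightarrow> 'x \<Rightarrow> 'x) \<Rightarrow> ('x \<Rightarrow> 'm \<Rightarrow> 'm) \<Rightarrow> ('x list \<Rightarrow> 'm) \<Rightarrow> 'x list \<Rightarrow> 'm::ab_group_add" where
  "ce br act f [] = 0"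
| "ce br act f (x # xs) = lie (act x) (br x) f xs - ce br act (ctr x f) xs"

text \<open>Adjacent transpositions anywhere in the list change the sign; no length is fixed. In
  characteristic 2 this is weaker than alternating, but it is all that moving an argument
  requires.\<close>

definition skew :: "('x list \<Rightarrow> 'm::ab_group_add) \<Rightarrow> bool" where
  "skew f \<longleftrightarrow> (\<forall>us x y vs. f (us @ x # y # vs) = - f (us @ y # x # vs))"

definition madd :: "('x::ab_group_add list \<Rightarrow> 'm::ab_group_add) \<Rightarrow> bool" where
  "madd f \<longleftrightarrow> (\<forall>us vs. additive (\<lambda>x. f (us @ x # vs)))"

lemma skewI:
  assumes "\<And>us x y vs. f (us @ x # y # vs) = - f (us @ y # x # vs)"
  shows "skew f"
  using assms unfolding skew_def by blast

lemma skewD: "skew f \<Longrightarrow> f (us @ x # y # vs) = - f (us @ y # x # vs)"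
  unfolding skew_def by blast

lemma skew_ctr:
  assumes "skew f"
  shows "skew (ctr z f)"
  by (rule skewI) (rule skewD[OF assms, of "z # us" for us, unfolded append_Cons])

lemma skew_swap:
  assumes "skew f"
  shows "f (x # y # vs) = - f (y # x # vs)"
  by (rule skewD[OF assms, of "[]", simplified append_Nil])

lemma madd_additive: "madd f \<Longrightarrow> additive (\<lambda>x. f (us @ x # vs))"
  unfolding madd_def by blast

lemma madd_ctr:
  assumes "madd f"
  shows "madd (ctr z f)"
  unfolding madd_def using madd_additive[OF assms, of "z # us" for us] by simp

lemma madd_head:
  assumes "madd f"
  shows "additive (\<lambda>x. f (x # vs))"
  using madd_additive[OF assms, of "[]"] by simp

lemma nths_compl_0 [simp]: "nths (x # xs) (- {0}) = xs"
  by (simp add: nths_Cons nths_all)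

lemma nths_compl_Suc [simp]: "nths (x # xs) (- {Suc j}) = x # nths xs (- {j})"
  by (simp add: nths_Cons Compl_eq)

lemma nths_compl_0_Suc [simp]: "nths (x # xs) (- {0, Suc k}) = nths xs (- {k})"
  by (simp add: nths_Cons Compl_eq)

lemma nths_compl_Suc_Suc [simp]: "nths (x # xs) (- {Suc j, Suc k}) = x # nths xs (- {j, k})"
  by (simp add: nths_Cons Compl_eq)

lemma lie_Nil [simp]: "lie D N f [] = D (f [])"
  by (simp add: lie_def)

lemma lie_Cons [simp]: "lie D N f (x # xs) = lie D N (ctr x f) xs - f (N x # xs)"
  unfolding lie_def by (simp add: sum.lessThan_Suc_shift algebra_simps del: sum.lessThan_Suc)

lemma fan_Nil [simp]: "fan F [] = 0"
  by (simp add: fan_def)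

lemma fan_Cons [simp]: "fan F (x # xs) = F x xs - fan (\<lambda>y. ctr x (F y)) xs"
  unfolding fan_def by (simp add: sum.lessThan_Suc_shift sum_negf del: sum.lessThan_Suc)

lemma fan2_Nil [simp]: "fan2 G [] = 0"
  by (simp add: fan2_def)

lemma fan2_Cons [simp]: "fan2 G (x # xs) = fan2 (\<lambda>y z. ctr x (G y z)) xs - fan (G x) xs"
  unfolding fan2_def fan_def
  by (simp add: sum.lessThan_Suc_shift sum_negf sum.distrib sum_subtractf
      del: sum.lessThan_Suc)

lemma fan_diff: "fan (\<lambda>y ys. F y ys - G y ys) xs = fan F xs - fan G xs"
  and fan_add: "fan (\<lambda>y ys. F y ys + G y ys) xs = fan F xs + fan G xs"
  and fan_minus: "fan (\<lambda>y ys. - F y ys) xs = - fan F xs"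
  and fan_zero [simp]: "fan (\<lambda>y ys. 0) xs = 0"
  by (auto simp: fan_def sg_diff sg_add sg_minus sum_subtractf sum.distrib sum_negf)

lemma lie_diff: "additive D \<Longrightarrow> lie D N (\<lambda>ys. f ys - g ys) xs = lie D N f xs - lie D N g xs"
  and lie_add: "additive D \<Longrightarrow> lie D N (\<lambda>ys. f ys + g ys) xs = lie D N f xs + lie D N g xs"
  and lie_minus: "additive D \<Longrightarrow> lie D N (\<lambda>ys. - f ys) xs = - lie D N f xs"
  and lie_zero: "additive D \<Longrightarrow> lie D N (\<lambda>ys. 0) xs = 0"
  by (auto simp: lie_def sum_subtractf sum.distrib sum_negf additive.add additive.diff
      additive.minus additive.zero)

lemma ce_diff:
  assumes "\<And>x. additive (act x)"
  shows "ce br act (\<lambda>ys. f ys - g ys) xs = ce br act f xs - ce br act g xs"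
  by (induction xs arbitrary: f g) (auto simp: lie_diff assms)

lemma ce_add:
  assumes "\<And>x. additive (act x)"
  shows "ce br act (\<lambda>ys. f ys + g ys) xs = ce br act f xs + ce br act g xs"
  by (induction xs arbitrary: f g) (auto simp: lie_add assms)

lemma ce_zero:
  assumes "\<And>x. additive (act x)"
  shows "ce br act (\<lambda>ys. 0) xs = 0"
  by (induction xs) (auto simp: lie_zero assms)

lemma ce_minus:
  assumes "\<And>x. additive (act x)"
  shows "ce br act (\<lambda>ys. - f ys) xs = - ce br act f xs"
  by (induction xs arbitrary: f) (auto simp: lie_minus assms)

text \<open>Bringing the argument at position i to the front takes i adjacent
  transpositions.\<close>

lemma skew_move:
  assumes "skew f" "i < length xs"
  shows "f (xs[i := y]) = sg i (f (y # nths xs (- {i})))"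
  using assms
proof (induction xs arbitrary: f i)
  case (Cons x xs)
  show ?case
  proof (cases i)
    case (Suc j)
    with Cons.prems Cons.IH[of "ctr x f" j] skew_ctr[of f x]
    have "f ((x # xs)[i := y]) = sg j (f (x # y # nths xs (- {j})))"
      by simp
    also have "\<dots> = - sg j (f (y # x # nths xs (- {j})))"
      using skew_swap[OF \<open>skew f\<close>, of x y] by (simp add: sg_minus)
    finally show ?thesis
      using Suc by simp
  qed simp
qed simp

text \<open>The sign of the fan is exactly the cost of moving the new argument from its old position
  to the front, so the alternating sum becomes a plain sum of substitutions.\<close>

lemma fan_skew:
  assumes "skew f"
  shows "fan (\<lambda>y ys. f (N y # ys)) xs = - lie (\<lambda>m. 0) N f xs"
  by (simp add: fan_def lie_def skew_move[OF assms])

text \<open>Splitting off the first argument x, the pairs that contain x form a fan of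
  \<open>f (br x y # ys)\<close>, which \<open>fan_skew\<close> identifies with the argument part of
  L_x; the remaining pairs make up the differential of the contraction.\<close>

lemma ce_eq:
  assumes "skew f"
  shows "fan (\<lambda>x ys. act x (f ys)) xs + fan2 (\<lambda>x y ys. f (br x y # ys)) xs = ce br act f xs"
  using assms
proof (induction xs arbitrary: f)
  case (Cons x xs)
  \<comment> \<open>The usual formula puts the bracket in front of x; one transposition brings x
    back to the front.\<close>
  have *: "fan2 (\<lambda>y z. ctr x (\<lambda>ys. f (br y z # ys))) xs = - fan2 (\<lambda>y z ys. ctr x f (br y z # ys)) xs"
    by (simp add: fan2_def sg_minus sum_negf skew_swap[OF Cons.prems, of _ x])
  have "fan (\<lambda>y ys. f (br x y # ys)) xs = - lie (\<lambda>m. 0) (br x) f xs"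
    by (rule fan_skew) fact
  with Cons.IH[OF skew_ctr[OF Cons.prems], of x] * show ?case
    by (simp add: lie_def algebra_simps)
qed simp

text \<open>Substitutions into two different arguments commute and cancel. Those into the same
  argument leave both composites of \<open>N\<close> and \<open>N'\<close>, which additivity
  combines into their commutator.\<close>

lemma lie_lie:
  assumes "madd f" and add: "additive D" "additive D'"
  shows "lie D N (lie D' N' f) xs - lie D' N' (lie D N f) xs
    = lie (\<lambda>m. D (D' m) - D' (D m)) (\<lambda>x. N (N' x) - N' (N x)) f xs"
  using assms(1)
proof (induction xs arbitrary: f)
  case (Cons x xs)
  show ?case
    by (simp add: lie_diff add additive.diff[OF madd_head[OF Cons.prems]]
        Cons.IH[OF madd_ctr[OF Cons.prems], of x, symmetric])
qed simp

lemma lie_pair_add: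
  assumes "madd f"
  shows "lie D N f xs + lie D' N' f xs = lie (\<lambda>m. D m + D' m) (\<lambda>x. N x + N' x) f xs"
  using assms
proof (induction xs arbitrary: f)
  case (Cons x xs)
  show ?case
    by (simp add: additive.add[OF madd_head[OF Cons.prems]]
        Cons.IH[OF madd_ctr[OF Cons.prems], of x, symmetric])
qed simp

lemma lie_pair_minus:
  assumes "madd f"
  shows "- lie D N f xs = lie (\<lambda>m. - D m) (\<lambda>x. - N x) f xs"
  using assms
proof (induction xs arbitrary: f)
  case (Cons x xs)
  show ?case
    by (simp add: additive.minus[OF madd_head[OF Cons.prems]]
        Cons.IH[OF madd_ctr[OF Cons.prems], of x, symmetric])
qed simp

text \<open>Contracted with y, the claim reduces to [L_x, L_y] = L_[x,y], which is
  \<open>lie_lie\<close> with flatness of the action on the values and the Jacobi identity on the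
  arguments.\<close>

lemma lie_ce:
  assumes "madd f" and add: "\<And>x. additive (act x)"
    and act_br: "\<And>x y m. act (br x y) m = act x (act y m) - act y (act x m)"
    and jacobi: "\<And>x y z. br (br x y) z = br x (br y z) - br y (br x z)"
  shows "lie (act x) (br x) (ce br act f) xs = ce br act (lie (act x) (br x) f) xs"
  using assms(1)
proof (induction xs arbitrary: f)
  case Nil
  show ?case
    by (simp add: additive.zero[OF add])
next
  case (Cons y xs)
  let ?Lx = "lie (act x) (br x)" and ?Ly = "lie (act y) (br y)"
  have "lie (act (br x y)) (br (br x y)) f xs = ?Lx (?Ly f) xs - ?Ly (?Lx f) xs"
    unfolding lie_lie[OF Cons.prems add add] jacobi act_br ..
  with Cons.IH[OF madd_ctr[OF Cons.prems], of y] show ?case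
    by (simp add: lie_diff add ce_diff)
qed

text \<open>Contraction with x turns d d into L_x d - d L_x + d d \<iota>_x; the first two terms
  cancel by \<open>lie_ce\<close>, the last vanishes by induction.\<close>

lemma ce_ce:
  assumes "madd f" and add: "\<And>x. additive (act x)"
    and act_br: "\<And>x y m. act (br x y) m = act x (act y m) - act y (act x m)"
    and jacobi: "\<And>x y z. br (br x y) z = br x (br y z) - br y (br x z)"
  shows "ce br act (ce br act f) xs = 0"
  using assms(1)
proof (induction xs arbitrary: f)
  case (Cons x xs)
  show ?case
    using Cons.IH[OF madd_ctr[OF Cons.prems], of x] lie_ce[OF Cons.prems add act_br jacobi, of x xs]
    by (simp add: ce_diff add)
qed simp

section \<open>Shuffle products\<close>

definition supp :: "nat \<Rightarrow> ('x list \<Rightarrow> 'm::zero) \<Rightarrow> bool" where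
  "supp p f \<longleftrightarrow> (\<forall>xs. length xs \<noteq> p \<longrightarrow> f xs = 0)"

text \<open>The sign that a contraction picks up when it passes a form, taken from the length of the
  list. This keeps \<open>shuf\<close> free of a degree argument.\<close>

abbreviation parity :: "('x list \<Rightarrow> 'm::ab_group_add) \<Rightarrow> 'x list \<Rightarrow> 'm" where
  "parity f \<equiv> \<lambda>ys. sg (length ys) (f ys)"

primrec shuf :: "('a \<Rightarrow> 'm \<Rightarrow> 'n) \<Rightarrow> ('x list \<Rightarrow> 'a::ab_group_add) \<Rightarrow> ('x list \<Rightarrow> 'm) \<Rightarrow> 'x list \<Rightarrow> 'n::ab_group_add" where
  "shuf sc \<alpha> f [] = sc (\<alpha> []) (f [])"
| "shuf sc \<alpha> f (x # xs) = shuf sc (ctr x \<alpha>) f xs + shuf sc (parity \<alpha>) (ctr x f) xs"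

lemma suppD: "supp p f \<Longrightarrow> length xs \<noteq> p \<Longrightarrow> f xs = 0"
  by (simp add: supp_def)

lemma supp_ctr: "supp (Suc p) f \<Longrightarrow> supp p (ctr x f)"
  by (simp add: supp_def)

lemma supp_0_ctr: "supp 0 f \<Longrightarrow> ctr x f = (\<lambda>ys. 0)"
  by (simp add: supp_def)

lemma parity_supp:
  assumes "supp p f"
  shows "parity f = (\<lambda>ys. sg p (f ys))"
proof
  fix ys
  show "sg (length ys) (f ys) = sg p (f ys)"
    using suppD[OF assms, of ys] by (cases "length ys = p") auto
qed

lemma lie_parity: "additive D \<Longrightarrow> lie D N (parity f) xs = sg (length xs) (lie D N f xs)"
  by (simp add: lie_def sg_diff sg_sum additive_sg)

text \<open>The additional minus sign arises because the differential reads lists that are shorter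
  by one.\<close>

lemma ce_parity:
  assumes add: "\<And>x. additive (act x)"
  shows "ce br act (parity f) xs = - sg (length xs) (ce br act f xs)"
  by (induction xs arbitrary: f) (simp_all add: lie_parity add ce_minus sg_diff)

context unital_module
begin

lemma shuf_add_left: "shuf scale (\<lambda>ys. \<alpha> ys + \<beta> ys) f xs = shuf scale \<alpha> f xs + shuf scale \<beta> f xs"
  by (induction xs arbitrary: \<alpha> \<beta> f) (simp_all add: scale_add_left sg_add)

lemma shuf_add_right: "shuf scale \<alpha> (\<lambda>ys. f ys + g ys) xs = shuf scale \<alpha> f xs + shuf scale \<alpha> g xs"
  by (induction xs arbitrary: \<alpha> f g) (simp_all add: scale_add_right)

lemma shuf_minus_left: "shuf scale (\<lambda>ys. - \<alpha> ys) f xs = - shuf scale \<alpha> f xs"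
  by (induction xs arbitrary: \<alpha> f) (simp_all add: scale_minus_left sg_minus)

lemma shuf_minus_right: "shuf scale \<alpha> (\<lambda>ys. - f ys) xs = - shuf scale \<alpha> f xs"
  by (induction xs arbitrary: \<alpha> f) (simp_all add: scale_minus_right)

lemma shuf_diff_left: "shuf scale (\<lambda>ys. \<alpha> ys - \<beta> ys) f xs = shuf scale \<alpha> f xs - shuf scale \<beta> f xs"
  using shuf_add_left[of \<alpha> "\<lambda>ys. - \<beta> ys"] by (simp add: shuf_minus_left)

lemma shuf_diff_right: "shuf scale \<alpha> (\<lambda>ys. f ys - g ys) xs = shuf scale \<alpha> f xs - shuf scale \<alpha> g xs"
  using shuf_add_right[of \<alpha> f "\<lambda>ys. - g ys"] by (simp add: shuf_minus_right)

lemma shuf_zero_left [simp]: "shuf scale (\<lambda>ys. 0) f xs = 0"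
  using shuf_diff_left[of "\<lambda>ys. 0" "\<lambda>ys. 0"] by simp

lemma shuf_zero_right [simp]: "shuf scale \<alpha> (\<lambda>ys. 0) xs = 0"
  using shuf_diff_right[of \<alpha> "\<lambda>ys. 0" "\<lambda>ys. 0"] by simp

lemma shuf_sg_left: "shuf scale (\<lambda>ys. sg n (\<alpha> ys)) f xs = sg n (shuf scale \<alpha> f xs)"
  by (simp add: sg_def shuf_minus_left)

lemma shuf_sg_right: "shuf scale \<alpha> (\<lambda>ys. sg n (f ys)) xs = sg n (shuf scale \<alpha> f xs)"
  by (simp add: sg_def shuf_minus_right)

lemma shuf_scale_left: "shuf scale (\<lambda>ys. a * \<alpha> ys) f xs = scale a (shuf scale \<alpha> f xs)"
proof (induction xs arbitrary: \<alpha> f)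
  case (Cons x xs)
  have "parity (\<lambda>ys. a * \<alpha> ys) = (\<lambda>ys. a * parity \<alpha> ys)"
    by (simp add: sg_def fun_eq_iff)
  with Cons show ?case
    by (simp add: scale_add_right)
qed (simp add: scale_scale)

lemma shuf_scale_right: "shuf scale \<alpha> (\<lambda>ys. scale a (f ys)) xs = scale a (shuf scale \<alpha> f xs)"
  by (induction xs arbitrary: \<alpha> f) (simp_all add: scale_add_right scale_scale mult.commute)

text \<open>A shuffle distributes all arguments over the two factors, so their lengths add up to the
  length of the whole list.\<close>

lemma shuf_parity: "shuf scale (parity \<alpha>) (parity f) xs = sg (length xs) (shuf scale \<alpha> f xs)"
proof (induction xs arbitrary: \<alpha> f)
  case (Cons x xs)
  have "shuf scale (parity \<alpha>) (parity f) (x # xs)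
      = - shuf scale (parity (ctr x \<alpha>)) (parity f) xs - shuf scale (parity (parity \<alpha>)) (parity (ctr x f)) xs"
    by (simp add: shuf_minus_left shuf_minus_right)
  then show ?case
    unfolding Cons.IH by (simp add: sg_add)
qed simp

lemma shuf_assoc: "shuf scale (shuf (*) \<alpha> \<beta>) f xs = shuf scale \<alpha> (shuf scale \<beta> f) xs"
proof (induction xs arbitrary: \<alpha> \<beta> f)
  case (Cons x xs)
  have "parity (shuf (*) \<alpha> \<beta>) = shuf (*) (parity \<alpha>) (parity \<beta>)"
    by (simp add: fun_eq_iff unital_module.shuf_parity[OF unital_module_mult])
  with Cons show ?case
    by (simp add: shuf_add_left shuf_add_right)
qed (simp add: scale_scale)

text \<open>The hypothesis is the case of the empty list; for longer lists substitutions into an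
  argument reach whichever factor that argument was shuffled to.\<close>

lemma shuf_lie:
  assumes "additive D" "additive E" "\<And>a m. D (scale a m) = scale (E a) m + scale a (D m)"
  shows "lie D N (shuf scale \<alpha> f) xs = shuf scale (lie E N \<alpha>) f xs + shuf scale \<alpha> (lie D N f) xs"
proof (induction xs arbitrary: \<alpha> f)
  case (Cons x xs)
  then show ?case
    by (simp add: lie_add assms lie_parity[symmetric] shuf_diff_left shuf_diff_right)
qed (simp add: assms)

text \<open>After contraction with x this is \<open>shuf_lie\<close> for L_x together with the
  induction hypothesis; the sign in front of the second term comes from
  \<open>ce_parity\<close>.\<close>

lemma shuf_ce:
  assumes add: "\<And>x. additive (act x)" "\<And>x. additive (actA x)"
    and der: "\<And>x a m. act x (scale a m) = scale (actA x a) m + scale a (act x m)"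
  shows "ce br act (shuf scale \<alpha> f) xs
    = shuf scale (ce br actA \<alpha>) f xs + shuf scale (parity \<alpha>) (ce br act f) xs"
proof (induction xs arbitrary: \<alpha> f)
  case (Cons x xs)
  have 1: "parity (ce br actA \<alpha>) = (\<lambda>ys. - ce br actA (parity \<alpha>) ys)"
    by (simp add: fun_eq_iff ce_parity add)
  show ?case
    using Cons
    by (simp add: shuf_lie[OF add der] ce_add add 1 shuf_diff_left shuf_diff_right shuf_minus_left)
qed simp

lemma shuf_supp:
  fixes f :: "'x list \<Rightarrow> 'm"
  assumes "supp p \<alpha>" "supp q f"
  shows "supp (p + q) (shuf scale \<alpha> f)"
  unfolding supp_def
proof (intro allI impI)
  fix xs :: "'x list"
  assume "length xs \<noteq> p + q"
  with assms show "shuf scale \<alpha> f xs = 0"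
  proof (induction xs arbitrary: p q \<alpha> f)
    case Nil
    then show ?case
      by (auto simp: supp_def)
  next
    case (Cons x xs)
    have "shuf scale (ctr x \<alpha>) f xs = 0"
    proof (cases p)
      case 0
      with Cons.prems supp_0_ctr[of \<alpha> x] show ?thesis
        by simp
    next
      case (Suc n)
      with Cons.prems show ?thesis
        by (intro Cons.IH[of n _ q]) (auto intro: supp_ctr)
    qed
    moreover have "shuf scale \<alpha> (ctr x f) xs = 0"
    proof (cases q)
      case 0
      with Cons.prems supp_0_ctr[of f x] show ?thesis
        by simp
    next
      case (Suc n)
      with Cons.prems show ?thesis
        by (intro Cons.IH[of p _ n]) (auto intro: supp_ctr)
    qed
    ultimately show ?case
      by (simp add: parity_supp[OF Cons.prems(1)] shuf_sg_left)
  qed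
qed

lemma shuf_form0_left:
  fixes f :: "'x list \<Rightarrow> 'm"
  shows "shuf scale (form0 a) f xs = scale a (f xs)"
proof (induction xs arbitrary: f)
  case (Cons x xs)
  have "parity (form0 a) = (form0 a :: 'x list \<Rightarrow> 'a)" and "ctr x (form0 a) = (\<lambda>ys. 0)"
    by (auto simp: form0_def)
  with Cons show ?case
    by simp
qed (simp add: form0_def)

lemma shuf_form0_right: "shuf scale \<alpha> (form0 m) xs = scale (\<alpha> xs) m"
  by (induction xs arbitrary: \<alpha>) (simp_all add: form0_def)

lemma shuf_one:
  assumes "supp 1 \<alpha>"
  shows "shuf scale \<alpha> f xs = fan (\<lambda>x ys. scale (\<alpha> [x]) (f ys)) xs"
  using assms
proof (induction xs arbitrary: f)
  case Nil
  then show ?case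
    by (simp add: supp_def)
next
  case (Cons x xs)
  have "ctr x \<alpha> = form0 (\<alpha> [x])"
    using Cons.prems by (auto simp: supp_def form0_def)
  with Cons show ?case
    by (simp add: parity_supp[of 1] shuf_sg_left shuf_form0_left shuf_minus_left)
qed

lemma wedge_Nil: "wedge scale p \<alpha> f [] = (if p = 0 then scale (\<alpha> []) (f []) else 0)"
proof -
  have "{I::nat set. I \<subseteq> {..<0} \<and> card I = p} = (if p = 0 then {{}} else {})"
    by auto
  then show ?thesis
    by (simp add: wedge_def)
qed

text \<open>The sets of positions are divided by whether they contain 0. In either case the other
  positions are shifted down by one, which leaves a shuffle of the tail.\<close>

lemma wedge_Cons:
  "wedge scale p \<alpha> f (x # xs) =
    (if p = 0 then 0 else wedge scale (p - 1) (ctr x \<alpha>) f xs) + sg p (wedge scale p \<alpha> (ctr x f) xs)"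
proof -
  define n where "n = length xs"
  define sig where "sig l I = card {(i, j). i \<in> I \<and> j < l \<and> j \<notin> I \<and> j < i}" for l :: nat and I
  define h where "h I = sg (sig (Suc n) I) (scale (\<alpha> (nths (x # xs) I)) (f (nths (x # xs) (- I))))" for I
  let ?S = "\<lambda>n p. {I. I \<subseteq> {..<n} \<and> card I = p}"
  define A where "A = (if p = 0 then {} else (\<lambda>I. insert 0 (Suc ` I)) ` ?S n (p - 1))"
  define B where "B = (\<lambda>I. Suc ` I) ` ?S n p"
  have fin: "finite (?S m k)" for m k :: nat
    by (rule finite_subset[of _ "Pow {..<m}"]) auto
  have S: "?S (Suc n) p = A \<union> B"
  proof (intro equalityI subsetI)
    fix I assume I: "I \<in> ?S (Suc n) p"
    define J where "J = {i. Suc i \<in> I}"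
    have finI: "finite I"
      using I by (auto intro: finite_subset)
    have J: "J \<subseteq> {..<n}"
      using I by (auto simp: J_def)
    have IJ: "I = (if 0 \<in> I then insert 0 (Suc ` J) else Suc ` J)"
      by (auto simp: J_def image_iff) (metis not0_implies_Suc)+
    have "card (Suc ` J) = card J" "finite J" "0 \<notin> Suc ` J"
      using J by (auto simp: card_image intro: finite_subset)
    then have "card I = (if 0 \<in> I then Suc (card J) else card J)"
      by (subst IJ) auto
    with I J IJ show "I \<in> A \<union> B"
      by (cases "0 \<in> I") (auto simp: A_def B_def)
  next
    fix I assume "I \<in> A \<union> B"
    then show "I \<in> ?S (Suc n) p"
    proof
      assume "I \<in> A"
      then obtain J where J: "p \<noteq> 0" "J \<subseteq> {..<n}" "card J = p - 1" "I = insert 0 (Suc ` J)"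
        by (auto simp: A_def split: if_splits)
      moreover from J have "finite J"
        by (auto intro: finite_subset)
      ultimately show ?thesis
        by (auto simp: card_image card_insert_if)
    qed (auto simp: B_def card_image)
  qed
  \<comment> \<open>Position 0 is outside the shifted set and precedes each of its elements, which
    yields one new inversion per element.\<close>
  have sig_B: "sig (Suc n) (Suc ` I) = sig n I + card I" if "I \<subseteq> {..<n}" for I
  proof -
    have "finite I"
      using that by (auto intro: finite_subset)
    have "{(i, j). i \<in> Suc ` I \<and> j < Suc n \<and> j \<notin> Suc ` I \<and> j < i} =
        (\<lambda>(i, j). (Suc i, Suc j)) ` {(i, j). i \<in> I \<and> j < n \<and> j \<notin> I \<and> j < i} \<union> (\<lambda>i. (Suc i, 0)) ` I"
      (is "_ = ?f ` ?X \<union> ?g ` I")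
    proof (intro equalityI subsetI)
      fix z assume z: "z \<in> {(i, j). i \<in> Suc ` I \<and> j < Suc n \<and> j \<notin> Suc ` I \<and> j < i}"
      obtain i j where ij: "z = (i, j)"
        by (cases z)
      with z show "z \<in> ?f ` ?X \<union> ?g ` I"
        by (cases j) (auto simp: image_iff)
    qed auto
    moreover have "finite ?X"
      by (rule finite_subset[of _ "I \<times> {..<n}"]) (use \<open>finite I\<close> in auto)
    moreover have "card (?f ` ?X) = card ?X" "card (?g ` I) = card I"
      by (auto intro!: card_image inj_onI)
    moreover have "?f ` ?X \<inter> ?g ` I = {}"
      by auto
    ultimately show ?thesis
      using \<open>finite I\<close> by (simp add: sig_def card_Un_disjoint)
  qed
  \<comment> \<open>Here 0 belongs to the set; it precedes everything and takes part in no
    inversion.\<close>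
  have sig_A: "sig (Suc n) (insert 0 (Suc ` I)) = sig n I" for I
  proof -
    have "{(i, j). i \<in> insert 0 (Suc ` I) \<and> j < Suc n \<and> j \<notin> insert 0 (Suc ` I) \<and> j < i} =
        (\<lambda>(i, j). (Suc i, Suc j)) ` {(i, j). i \<in> I \<and> j < n \<and> j \<notin> I \<and> j < i}" (is "?Y = ?f ` ?X")
    proof (intro equalityI subsetI)
      fix z assume z: "z \<in> ?Y"
      obtain i j where ij: "z = (i, j)"
        by (cases z)
      with z show "z \<in> ?f ` ?X"
        by (cases j) (auto simp: image_iff)
    qed auto
    moreover have "card (?f ` ?X) = card ?X"
      by (auto intro!: card_image inj_onI)
    ultimately show ?thesis
      by (simp add: sig_def)
  qed
  have "A \<inter> B = {}"
    by (auto simp: A_def B_def split: if_splits)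
  have inj: "inj_on (\<lambda>I. insert 0 (Suc ` I)) X" "inj_on (\<lambda>I. Suc ` I) X" for X
    by (auto intro!: inj_onI)
  have nths_Suc: "nths (x # xs) (Suc ` I) = nths xs I" "nths (x # xs) (- Suc ` I) = x # nths xs (- I)"
    "nths (x # xs) (insert 0 (Suc ` I)) = x # nths xs I"
    "nths (x # xs) (- insert 0 (Suc ` I)) = nths xs (- I)" for I
  proof -
    have "{j. Suc j \<in> Suc ` I} = I" "{j. Suc j \<in> - Suc ` I} = - I"
      "{j. Suc j \<in> insert 0 (Suc ` I)} = I" "{j. Suc j \<in> - insert 0 (Suc ` I)} = - I"
      by auto
    then show "nths (x # xs) (Suc ` I) = nths xs I" "nths (x # xs) (- Suc ` I) = x # nths xs (- I)"
      "nths (x # xs) (insert 0 (Suc ` I)) = x # nths xs I"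
      "nths (x # xs) (- insert 0 (Suc ` I)) = nths xs (- I)"
      by (auto simp: nths_Cons)
  qed
  have "wedge scale p \<alpha> f (x # xs) = sum h (?S (Suc n) p)"
    by (simp add: wedge_def h_def sig_def n_def)
  also have "\<dots> = sum h A + sum h B"
    unfolding S by (rule sum.union_disjoint) (use fin \<open>A \<inter> B = {}\<close> in \<open>auto simp: A_def B_def\<close>)
  also have "sum h A = (if p = 0 then 0 else wedge scale (p - 1) (ctr x \<alpha>) f xs)"
    by (simp add: A_def sum.reindex inj h_def sig_A nths_Suc wedge_def sig_def[of n, symmetric] n_def[symmetric] comp_def)
  also have "sum h B = sg p (wedge scale p \<alpha> (ctr x f) xs)"
    unfolding B_def wedge_def sg_sum
    by (subst sum.reindex[OF inj(2)], rule sum.cong)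
      (auto simp: h_def sig_B nths_Suc sig_def[of n, symmetric] n_def[symmetric] sg_sg add.commute)
  finally show ?thesis .
qed

lemma wedge_eq_shuf: "supp p \<alpha> \<Longrightarrow> wedge scale p \<alpha> f xs = shuf scale \<alpha> f xs"
proof (induction xs arbitrary: p \<alpha> f)
  case Nil
  then show ?case
    by (auto simp: wedge_Nil supp_def)
next
  case (Cons x xs)
  then show ?case
    by (cases p) (auto simp: wedge_Cons parity_supp[OF Cons.prems] shuf_sg_left shuf_minus_left
        supp_0_ctr intro!: supp_ctr)
qed

end

text \<open>Both factors are contracted in turn with the first argument; the two summands of the
  recursion change places, and only the signs have to be compared.\<close>

lemma shuf_commute:
  fixes \<alpha> \<beta> :: "'x list \<Rightarrow> 'a::{comm_ring,comm_monoid_mult}"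
  assumes "supp p \<alpha>" "supp q \<beta>"
  shows "shuf (*) \<alpha> \<beta> xs = sg (p * q) (shuf (*) \<beta> \<alpha> xs)"
  using assms
proof (induction xs arbitrary: p q \<alpha> \<beta>)
  case Nil
  then show ?case
    by (cases "p = 0 \<and> q = 0") (auto simp: supp_def mult.commute)
next
  case (Cons x xs)
  interpret unital_module "(*) :: 'a \<Rightarrow> 'a \<Rightarrow> 'a"
    by (rule unital_module_mult)
  \<comment> \<open>Lowering p by one changes the exponent p * q to p * q - q, written with a plus
    to avoid truncated subtraction. For p = 0 the contraction is zero and both sides vanish.\<close>
  have 1: "shuf (*) (ctr x \<alpha>) \<beta> xs = sg (p * q + q) (shuf (*) \<beta> (ctr x \<alpha>) xs)"
  proof (cases p)
    case 0
    with Cons.prems show ?thesis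
      by (simp add: supp_0_ctr)
  next
    case (Suc n)
    with Cons.prems Cons.IH[of n "ctr x \<alpha>" q \<beta>] show ?thesis
      by (simp add: supp_ctr sg_def)
  qed
  have 2: "shuf (*) \<alpha> (ctr x \<beta>) xs = sg (p * q + p) (shuf (*) (ctr x \<beta>) \<alpha> xs)"
  proof (cases q)
    case 0
    with Cons.prems show ?thesis
      by (simp add: supp_0_ctr)
  next
    case (Suc n)
    with Cons.prems Cons.IH[of p \<alpha> n "ctr x \<beta>"] show ?thesis
      by (simp add: supp_ctr sg_def)
  qed
  show ?case
    by (simp add: 1 2 parity_supp[OF Cons.prems(1)] parity_supp[OF Cons.prems(2)] shuf_sg_left sg_add sg_sg)
      (simp add: sg_def)
qed

section \<open>Alternating multilinear forms\<close>

abbreviation alt :: "('a \<Rightarrow> 'x \<Rightarrow> 'x) \<Rightarrow> ('a \<Rightarrow> 'm \<Rightarrow> 'm) \<Rightarrow> nat \<Rightarrow> ('x::ab_group_add list \<Rightarrow> 'm::ab_group_add) set" where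
  "alt sX sM \<equiv> alt_forms UNIV sX UNIV sM UNIV"

lemma alt_iff:
  "f \<in> alt sX sM p \<longleftrightarrow> supp p f \<and>
     (\<forall>xs i. length xs = p \<longrightarrow> i < p \<longrightarrow> lin_on UNIV UNIV sX sM (\<lambda>x. f (xs[i := x]))) \<and>
     (\<forall>xs i j. length xs = p \<longrightarrow> i < j \<longrightarrow> j < p \<longrightarrow> xs ! i = xs ! j \<longrightarrow> f xs = 0)"
  by (auto simp: alt_forms_def supp_def)

lemma alt_0: "f \<in> alt sX sM 0 \<longleftrightarrow> supp 0 f"
  by (simp add: alt_iff)

lemma alt_supp: "f \<in> alt sX sM p \<Longrightarrow> supp p f"
  by (simp add: alt_iff)

lemma alt_ctr:
  assumes f: "f \<in> alt sX sM (Suc p)"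
  shows "ctr x f \<in> alt sX sM p"
  unfolding alt_iff
proof (intro conjI allI impI)
  show "supp p (ctr x f)"
    using f by (simp add: alt_iff supp_ctr)
next
  fix xs i assume "length (xs :: 'a list) = p" "i < p"
  with f[unfolded alt_iff, THEN conjunct2, THEN conjunct1, rule_format, of "x # xs" "Suc i"]
  show "lin_on UNIV UNIV sX sM (\<lambda>y. f (x # xs[i := y]))"
    by simp
next
  fix xs i j assume "length (xs :: 'a list) = p" "i < j" "j < p" "xs ! i = xs ! j"
  with f[unfolded alt_iff, THEN conjunct2, THEN conjunct2, rule_format, of "x # xs" "Suc i" "Suc j"]
  show "f (x # xs) = 0"
    by simp
qed

lemma alt_lin_head:
  assumes f: "f \<in> alt sX sM (Suc p)"
  shows "f ((x + y) # xs) = f (x # xs) + f (y # xs)" "length xs = p \<Longrightarrow> f (sX a x # xs) = sM a (f (x # xs))"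
proof -
  have "lin_on UNIV UNIV sX sM (\<lambda>x. f (x # xs))" if "length xs = p"
    using f[unfolded alt_iff, THEN conjunct2, THEN conjunct1, rule_format, of "x # xs" 0] that by simp
  moreover have "f (z # xs) = 0" if "length xs \<noteq> p" for z
    using alt_supp[OF f] that by (simp add: supp_def)
  ultimately show "f ((x + y) # xs) = f (x # xs) + f (y # xs)"
    "length xs = p \<Longrightarrow> f (sX a x # xs) = sM a (f (x # xs))"
    by (cases "length xs = p"; simp add: lin_on_def)+
qed

lemma alt_self_head:
  assumes f: "f \<in> alt sX sM p"
  shows "f (x # x # xs) = 0"
proof (cases "p = Suc (Suc (length xs))")
  case True
  with f[unfolded alt_iff, THEN conjunct2, THEN conjunct2, rule_format, of "x # x # xs" 0 1]
  show ?thesis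
    by simp
next
  case False
  with alt_supp[OF f] show ?thesis
    by (simp add: supp_def)
qed

text \<open>Polarisation at (x + y, x + y). The case distinctions cover forms of degree below 2,
  which vanish on such lists.\<close>

lemma alt_swap_head:
  assumes f: "f \<in> alt sX sM p"
  shows "f (x # y # xs) = - f (y # x # xs)"
proof (cases p)
  case 0
  with alt_supp[OF f] show ?thesis
    by (simp add: supp_def)
next
  case (Suc n)
  show ?thesis
  proof (cases n)
    case 0
    with Suc alt_supp[OF f] show ?thesis
      by (simp add: supp_def)
  next
    case (Suc m)
    have f1: "f \<in> alt sX sM (Suc n)"
      using f \<open>p = Suc n\<close> by simp
    have f2: "ctr z f \<in> alt sX sM (Suc m)" for z
      using alt_ctr[OF f1] Suc by simp
    have "f ((x + y) # (x + y) # xs) = f (x # x # xs) + f (x # y # xs) + (f (y # x # xs) + f (y # y # xs))"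
      by (simp only: alt_lin_head(1)[OF f1] alt_lin_head(1)[OF f2] ac_simps)
    then have "f ((x + y) # (x + y) # xs) = f (x # y # xs) + f (y # x # xs)"
      by (simp only: alt_self_head[OF f] add_0_left add_0_right)
    with alt_self_head[OF f, of "x + y" xs] have "f (x # y # xs) + f (y # x # xs) = 0"
      by metis
    then show ?thesis
      by (simp only: eq_neg_iff_add_eq_0)
  qed
qed

text \<open>Makes membership in \<open>alt\<close> provable by induction on the degree. Vanishing
  need only be asked when the first two arguments coincide: if the first equals a later one,
  exchanging the first two moves the coincidence into a contraction, which is already
  alternating.\<close>

lemma alt_Suc:
  "f \<in> alt sX sM (Suc p) \<longleftrightarrow> f [] = 0 \<and> (\<forall>x. ctr x f \<in> alt sX sM p) \<and>
     (\<forall>x y xs. f ((x + y) # xs) = f (x # xs) + f (y # xs)) \<and>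
     (\<forall>a x xs. length xs = p \<longrightarrow> f (sX a x # xs) = sM a (f (x # xs))) \<and>
     (\<forall>x xs. f (x # x # xs) = 0)" (is "?L \<longleftrightarrow> ?R")
proof
  assume ?L
  then show ?R
    using alt_supp[of f sX sM "Suc p"] alt_ctr[of f sX sM p] alt_lin_head[of f sX sM p]
      alt_self_head[of f sX sM "Suc p"]
    by (auto simp: supp_def)
next
  assume R: ?R
  \<comment> \<open>The polarisation is repeated from the clauses of the right-hand side alone,
    since \<open>f\<close> is not yet known to be alternating.\<close>
  have swap: "f (x # y # xs) = - f (y # x # xs)" for x y xs
  proof (cases p)
    case 0
    with R have "supp 0 (ctr x f)" for x
      by (simp add: alt_0)
    then show ?thesis
      by (simp add: supp_def)
  next
    case (Suc m)
    then have f2: "ctr z f \<in> alt sX sM (Suc m)" for z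
      using R by simp
    have add: "f ((x + y) # xs) = f (x # xs) + f (y # xs)" and same: "f (x # x # xs) = 0" for x y xs
      using R by blast+
    have "f ((x + y) # (x + y) # xs) = f (x # x # xs) + f (x # y # xs) + (f (y # x # xs) + f (y # y # xs))"
      by (simp only: add alt_lin_head(1)[OF f2] ac_simps)
    then have "f ((x + y) # (x + y) # xs) = f (x # y # xs) + f (y # x # xs)"
      by (simp only: same add_0_left add_0_right)
    moreover have "f ((x + y) # (x + y) # xs) = 0"
      using R by blast
    ultimately show ?thesis
      by (simp only: eq_neg_iff_add_eq_0)
  qed
  show ?L
    unfolding alt_iff
  proof (intro conjI allI impI)
    show "supp (Suc p) f"
      unfolding supp_def
    proof (intro allI impI)
      fix xs :: "'a list" assume "length xs \<noteq> Suc p"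
      with R show "f xs = 0"
        by (cases xs) (auto dest!: spec[of _ "hd xs"] alt_supp simp: supp_def)
    qed
  next
    fix xs :: "'a list" and i assume *: "length xs = Suc p" "i < Suc p"
    then obtain y ys where xs: "xs = y # ys"
      by (cases xs) auto
    have "lin_on UNIV UNIV sX sM (\<lambda>x. f (y # ys[n := x]))" if "n < p" for n
      using R[THEN conjunct2, THEN conjunct1, rule_format, of y, unfolded alt_iff] that * xs by simp
    with R * xs show "lin_on UNIV UNIV sX sM (\<lambda>x. f (xs[i := x]))"
      by (cases i) (auto simp: lin_on_def)
  next
    fix xs :: "'a list" and i j assume *: "length xs = Suc p" "i < j" "j < Suc p" "xs ! i = xs ! j"
    then obtain y ys where xs: "xs = y # ys"
      by (cases xs) auto
    have alt: "f (z # zs) = 0" if "length zs = p" "m < n" "n < p" "zs ! m = zs ! n" for z zs m n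
      using R[THEN conjunct2, THEN conjunct1, rule_format, of z, unfolded alt_iff] that by blast
    show "f xs = 0"
    proof (cases i)
      case (Suc m)
      with * xs show ?thesis
        using alt[of ys m "j - 1" y] by (cases j) auto
    next
      case 0
      from * xs obtain z zs where ys: "ys = z # zs"
        by (cases ys) auto
      show ?thesis
      proof (cases "j = 1")
        case True
        with 0 * xs ys R show ?thesis
          by simp
      next
        case False
        with * obtain n where n: "j = Suc (Suc n)"
          by (cases j; cases "j - 1") auto
        \<comment> \<open>With z in front, the equal entries y and \<open>xs ! j\<close> both lie
          inside the contraction with z.\<close>
        have "f (z # y # zs) = 0"
          using alt[of "y # zs" 0 "Suc n" z] 0 * xs ys n by simp
        then show ?thesis
          using swap[of y z zs] xs ys by simp
      qed
    qed
  qed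
qed

lemma alt_skew:
  assumes "f \<in> alt sX sM p"
  shows "skew f"
proof (rule skewI)
  fix us x y vs
  show "f (us @ x # y # vs) = - f (us @ y # x # vs)"
    using assms
  proof (induction us arbitrary: f p)
    case Nil
    then show ?case
      using alt_swap_head[of f sX sM p x y vs] by simp
  next
    case (Cons u us)
    show ?case
    proof (cases p)
      case 0
      with Cons.prems show ?thesis
        by (simp add: alt_0 supp_def)
    next
      case (Suc n)
      with Cons.IH[of "ctr u f" n] Cons.prems alt_ctr[of f sX sM n u] show ?thesis
        by simp
    qed
  qed
qed

lemma alt_madd:
  assumes "f \<in> alt sX sM p"
  shows "madd f"
  unfolding madd_def
proof (intro allI)
  fix us vs
  show "additive (\<lambda>x. f (us @ x # vs))"
    using assms
  proof (induction us arbitrary: f p)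
    case Nil
    then show ?case
      using alt_lin_head(1)[of f sX sM "p - 1"]
      by (cases p) (auto simp: additive_def alt_0 supp_def)
  next
    case (Cons u us)
    show ?case
    proof (cases p)
      case 0
      with Cons.prems show ?thesis
        by (simp add: alt_0 supp_def additive_def)
    next
      case (Suc n)
      with Cons.IH[of "ctr u f" n] Cons.prems alt_ctr[of f sX sM n u] show ?thesis
        by simp
    qed
  qed
qed

lemmas alt_head = madd_head[OF alt_madd]

lemma form0_alt [simp]: "form0 m \<in> alt sX sM 0"
  by (simp add: alt_0 supp_def form0_def)

lemma alt_0_form0: "f \<in> alt sX sM 0 \<longleftrightarrow> f = form0 (f [])"
  by (auto simp: alt_0 supp_def form0_def fun_eq_iff)

locale two_modules = X: unital_module sX + M: unital_module sM
  for sX :: "'a::{comm_ring,comm_monoid_mult} \<Rightarrow> 'x::ab_group_add \<Rightarrow> 'x"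
    and sM :: "'a \<Rightarrow> 'm::ab_group_add \<Rightarrow> 'm"
begin

lemma alt_scale_head:
  assumes f: "f \<in> alt sX sM p"
  shows "f (sX a x # xs) = sM a (f (x # xs))"
proof (cases "p = Suc (length xs)")
  case True
  with f alt_lin_head(2)[of f sX sM "length xs"] show ?thesis
    by auto
next
  case False
  with alt_supp[OF f] show ?thesis
    by (simp add: supp_def)
qed

lemma alt_zero [simp]: "(\<lambda>xs. 0) \<in> alt sX sM p"
  by (auto simp: alt_iff supp_def lin_on_def)

lemma alt_add: "f \<in> alt sX sM p \<Longrightarrow> g \<in> alt sX sM p \<Longrightarrow> (\<lambda>xs. f xs + g xs) \<in> alt sX sM p"
  by (simp add: alt_iff supp_def lin_on_def M.scale_add_right)

lemma alt_minus: "f \<in> alt sX sM p \<Longrightarrow> (\<lambda>xs. - f xs) \<in> alt sX sM p"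
  by (simp add: alt_iff supp_def lin_on_def M.scale_minus_right)

lemma alt_diff: "f \<in> alt sX sM p \<Longrightarrow> g \<in> alt sX sM p \<Longrightarrow> (\<lambda>xs. f xs - g xs) \<in> alt sX sM p"
  by (simp add: alt_iff supp_def lin_on_def M.scale_diff_right)

lemma alt_sg: "f \<in> alt sX sM p \<Longrightarrow> (\<lambda>xs. sg n (f xs)) \<in> alt sX sM p"
  by (cases "even n") (simp_all add: sg_def alt_minus)

lemma alt_sum: "(\<And>i. i \<in> I \<Longrightarrow> f i \<in> alt sX sM p) \<Longrightarrow> (\<lambda>xs. \<Sum>i\<in>I. f i xs) \<in> alt sX sM p"
  by (induction I rule: infinite_finite_induct) (auto intro: alt_add)

lemma alt_scale: "f \<in> alt sX sM p \<Longrightarrow> (\<lambda>xs. sM a (f xs)) \<in> alt sX sM p"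
  by (simp add: alt_iff supp_def lin_on_def M.scale_add_right M.scale_scale mult.commute)

text \<open>\<open>D\<close> and \<open>N\<close> are derivations over the same derivation
  \<open>E\<close> of the scalars. This makes the two terms with \<open>E a\<close> cancel when a
  scalar is pulled out of an argument.\<close>

lemma lie_alt:
  assumes "f \<in> alt sX sM p" and D: "additive D" and N: "additive N"
    and der: "\<And>a m. D (sM a m) = sM (E a) m + sM a (D m)" "\<And>a x. N (sX a x) = sX (E a) x + sX a (N x)"
  shows "lie D N f \<in> alt sX sM p"
  using assms(1)
proof (induction p arbitrary: f)
  case 0
  then show ?case
    by (simp add: alt_0 supp_def lie_def additive.zero[OF D])
next
  case (Suc p)
  have lie_scale: "lie D N (\<lambda>ys. sM a (g ys)) ys = sM (E a) (g ys) + sM a (lie D N g ys)" for a g ys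
    by (simp add: lie_def der M.scale_diff_right M.scale_sum_right)
  have add: "f ((x + y) # xs) = f (x # xs) + f (y # xs)" for x y xs
    by (rule alt_lin_head(1)[OF Suc.prems])
  have scale: "f (sX a x # xs) = sM a (f (x # xs))" for a x xs
    by (rule alt_scale_head[OF Suc.prems])
  \<comment> \<open>Only the substitutions into one of the two copies of x survive, and these cancel
    by skew-symmetry.\<close>
  have "lie D N f (x # x # xs) = 0" for x xs
    using alt_swap_head[OF Suc.prems, of x "N x"]
    by (simp add: alt_self_head[OF Suc.prems] lie_zero D)
  moreover have "ctr x (lie D N f) \<in> alt sX sM p" for x
    using alt_ctr[OF Suc.prems] Suc.IH by (simp add: alt_diff)
  moreover have "lie D N f [] = 0"
    using alt_supp[OF Suc.prems] by (simp add: supp_def additive.zero[OF D])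
  ultimately show ?case
    unfolding alt_Suc
    by (auto simp: add scale lie_add D additive.add[OF N] lie_scale der(2) M.scale_diff_right)
qed

text \<open>The induction runs over the total degree, because each contraction lowers the degree of
  one factor or the other.\<close>

lemma shuf_alt:
  assumes "\<alpha> \<in> alt sX (*) p" "f \<in> alt sX sM q"
  shows "shuf sM \<alpha> f \<in> alt sX sM (p + q)"
  using assms
proof (induction "p + q" arbitrary: p q \<alpha> f)
  case 0
  then show ?case
    using M.shuf_supp[of 0 \<alpha> 0 f] by (simp add: alt_0)
next
  case (Suc n)
  interpret A: two_modules sX "(*) :: 'a \<Rightarrow> 'a \<Rightarrow> 'a"
    by (intro two_modules.intro X.unital_module_axioms unital_module_mult)
  note par = parity_supp[OF alt_supp[OF Suc.prems(1)]]
  have L: "shuf sM (ctr x \<alpha>) f \<in> alt sX sM n" for x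
  proof (cases p)
    case 0
    with Suc.prems show ?thesis
      by (simp add: supp_0_ctr alt_0 M.shuf_zero_left[abs_def] M.shuf_zero_right[abs_def])
  next
    case (Suc m)
    with Suc.hyps(1)[of m q "ctr x \<alpha>" f] Suc.hyps(2) Suc.prems alt_ctr[of \<alpha> sX "(*)" m x] show ?thesis
      by simp
  qed
  have R: "shuf sM (parity \<alpha>) (ctr x f) \<in> alt sX sM n" for x
  proof (cases q)
    case 0
    with Suc.prems show ?thesis
      by (simp add: supp_0_ctr alt_0 M.shuf_zero_left[abs_def] M.shuf_zero_right[abs_def])
  next
    case (Suc m)
    with Suc.hyps(1)[of p m "parity \<alpha>" "ctr x f"] Suc.hyps(2) Suc.prems alt_ctr[of f sX sM m x] show ?thesis
      by (simp add: par A.alt_sg)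
  qed
  have "supp (Suc n) (shuf sM \<alpha> f)"
    using M.shuf_supp[OF alt_supp[OF Suc.prems(1)] alt_supp[OF Suc.prems(2)]] Suc.hyps(2) by simp
  then have "shuf sM \<alpha> f [] = 0"
    by (rule suppD) simp
  \<comment> \<open>Contracting twice with x gives four terms; this sign makes the two mixed ones
    cancel, and the other two contain a double contraction of one factor.\<close>
  moreover have "parity (ctr x \<alpha>) = (\<lambda>ys. - ctr x (parity \<alpha>) ys)" for x
    by simp
  then have "shuf sM \<alpha> f (x # x # xs) = 0" for x xs
    by (simp add: alt_self_head[OF Suc.prems(1)] alt_self_head[OF Suc.prems(2)] M.shuf_minus_left)
  moreover have "ctr (x + y) \<alpha> = (\<lambda>ys. ctr x \<alpha> ys + ctr y \<alpha> ys)"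
    "ctr (x + y) f = (\<lambda>ys. ctr x f ys + ctr y f ys)" for x y
    by (simp_all add: additive.add[OF alt_head[OF Suc.prems(1)]]
        additive.add[OF alt_head[OF Suc.prems(2)]])
  then have "shuf sM \<alpha> f ((x + y) # xs) = shuf sM \<alpha> f (x # xs) + shuf sM \<alpha> f (y # xs)" for x y xs
    by (simp add: M.shuf_add_left M.shuf_add_right)
  moreover have "shuf sM \<alpha> f (sX a x # xs) = sM a (shuf sM \<alpha> f (x # xs))" for a x xs
    by (simp add: A.alt_scale_head[OF Suc.prems(1)] alt_scale_head[OF Suc.prems(2)]
        M.shuf_scale_left M.shuf_scale_right M.scale_add_right)
  moreover have "ctr x (shuf sM \<alpha> f) \<in> alt sX sM n" for x
    using alt_add[OF L R] by simp
  ultimately show ?case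
    unfolding Suc.hyps(2)[symmetric] alt_Suc by blast
qed

end

text \<open>The data that make the differential preserve alternating forms: a bracket with anchor
  and a connection on the coefficients. Neither the Jacobi identity nor flatness is assumed. The
  coefficient modules will be A and Q.\<close>

locale connection = two_modules sX sM
  for sX :: "'a::{comm_ring,comm_monoid_mult} \<Rightarrow> 'x::ab_group_add \<Rightarrow> 'x"
    and sM :: "'a \<Rightarrow> 'm::ab_group_add \<Rightarrow> 'm" +
  fixes br :: "'x \<Rightarrow> 'x \<Rightarrow> 'x" and actA :: "'x \<Rightarrow> 'a \<Rightarrow> 'a" and act :: "'x \<Rightarrow> 'm \<Rightarrow> 'm"
  assumes br_add: "additive (br x)" "additive (\<lambda>x. br x y)"
    and br_same: "br x x = 0"
    and br_der: "br x (sX a y) = sX (actA x a) y + sX a (br x y)"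
    and act_add: "additive (act x)" "additive (\<lambda>x. act x m)"
    and act_der: "act x (sM a m) = sM (actA x a) m + sM a (act x m)"
    and act_lin: "act (sX a x) m = sM a (act x m)"
begin

lemma br_swap: "br x y = - br y x"
proof -
  have "br (x + y) (x + y) = br x x + br y x + (br x y + br y y)"
    by (simp only: additive.add[OF br_add(1)] additive.add[OF br_add(2)])
  then have "br (x + y) (x + y) = br x y + br y x"
    by (simp only: br_same add_0_left add_0_right add.commute)
  then show ?thesis
    by (simp only: br_same eq_neg_iff_add_eq_0)
qed

lemma br_der_left: "br (sX a x) y = sX a (br x y) - sX (actA y a) x"
  using br_swap[of "sX a x" y] br_swap[of x y] by (simp add: br_der X.scale_minus_right)

text \<open>The classical L_(ax) = a L_x + da \<iota>_x. The fan is the product of the 1-form da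
  with the contraction; it comes from the derivative of a in \<open>br (sX a x) y\<close>.\<close>

lemma lie_scale_left:
  assumes f: "f \<in> alt sX sM p"
  shows "lie (act (sX a x)) (br (sX a x)) f xs
    = sM a (lie (act x) (br x) f xs) + fan (\<lambda>y ys. sM (actA y a) (f (x # ys))) xs"
  using f
proof (induction xs arbitrary: f p)
  case (Cons y xs)
  have 1: "lie (act (sX a x)) (br (sX a x)) (ctr y f) xs
    = sM a (lie (act x) (br x) (ctr y f) xs) + fan (\<lambda>z zs. sM (actA z a) (f (y # x # zs))) xs"
  proof (cases p)
    case 0
    with Cons.prems show ?thesis
      by (simp add: alt_0 supp_def lie_zero act_add)
  next
    case (Suc n)
    with Cons.prems alt_ctr[of f sX sM n y] show ?thesis
      by (intro Cons.IH[of _ n]) simp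
  qed
  have "(\<lambda>z zs. sM (actA z a) (f (y # x # zs))) = (\<lambda>z zs. - sM (actA z a) (f (x # y # zs)))"
    by (simp add: alt_swap_head[OF Cons.prems, of y x] M.scale_minus_right)
  moreover have "f (br (sX a x) y # xs) = sM a (f (br x y # xs)) - sM (actA y a) (f (x # xs))"
    by (simp add: br_der_left additive.diff[OF alt_head[OF Cons.prems]]
        alt_scale_head[OF Cons.prems])
  ultimately show ?case
    using 1 by (simp add: fan_minus M.scale_diff_right)
qed (simp add: act_lin)

lemma ce_scale: "ce br act (\<lambda>ys. sM a (g ys)) xs
  = sM a (ce br act g xs) + fan (\<lambda>y ys. sM (actA y a) (g ys)) xs"
proof (induction xs arbitrary: g)
  case (Cons x xs)
  have "lie (act x) (br x) (\<lambda>ys. sM a (g ys)) xs = sM (actA x a) (g xs) + sM a (lie (act x) (br x) g xs)"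
    by (simp add: lie_def act_der M.scale_diff_right M.scale_sum_right)
  with Cons show ?case
    by (simp add: M.scale_diff_right)
qed simp

lemma lie_act_alt: "f \<in> alt sX sM p \<Longrightarrow> lie (act x) (br x) f \<in> alt sX sM p"
  by (rule lie_alt[where E = "actA x"]) (simp_all add: br_add act_add br_der act_der)

text \<open>Linearity in the first argument holds because the fan of da in
  \<open>lie_scale_left\<close> cancels against the one in \<open>ce_scale\<close>. On two equal
  arguments x the two copies of L_x cancel, leaving \<open>f\<close> at the bracket of x with itself
  and the differential of a double contraction.\<close>

lemma ce_alt:
  assumes "f \<in> alt sX sM p"
  shows "ce br act f \<in> alt sX sM (Suc p)"
  using assms
proof (induction p arbitrary: f)
  have add: "ce br act f ((x + y) # xs) = ce br act f (x # xs) + ce br act f (y # xs)"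
    if f: "f \<in> alt sX sM p" for f p x y xs
  proof -
    have "act (x + y) = (\<lambda>m. act x m + act y m)" "br (x + y) = (\<lambda>z. br x z + br y z)"
      by (simp_all add: fun_eq_iff additive.add[OF act_add(2)] additive.add[OF br_add(2)])
    then have "lie (act (x + y)) (br (x + y)) f xs = lie (act x) (br x) f xs + lie (act y) (br y) f xs"
      by (simp add: lie_pair_add[OF alt_madd[OF f]])
    then show ?thesis
      by (simp add: additive.add[OF alt_head[OF f]] ce_add act_add)
  qed
  have scale: "ce br act f (sX a x # xs) = sM a (ce br act f (x # xs))"
    if f: "f \<in> alt sX sM p" for f p a x xs
    by (simp add: lie_scale_left[OF f] alt_scale_head[OF f] ce_scale M.scale_diff_right)
  have same: "ce br act f (x # x # xs) = 0" if f: "f \<in> alt sX sM p" for f p x xs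
  proof -
    have "f (br x x # xs) = 0"
      by (simp add: br_same additive.zero[OF alt_head[OF f]])
    then show ?thesis
      by (simp add: alt_self_head[OF f] ce_zero act_add)
  qed
  {
    case 0
    then have "ctr x f = (\<lambda>ys. 0)" for x
      by (simp add: alt_0 supp_0_ctr)
    moreover from 0 have "lie (act x) (br x) f \<in> alt sX sM 0" for x
      by (rule lie_act_alt)
    ultimately have "ctr x (ce br act f) \<in> alt sX sM 0" for x
      by (simp add: ce_zero act_add)
    with add[OF 0] scale[OF 0] same[OF 0] ce.simps(1) show ?case
      unfolding alt_Suc by blast
  next
    case (Suc p)
    have "ctr x (ce br act f) \<in> alt sX sM (Suc p)" for x
      using lie_act_alt[OF Suc.prems] Suc.IH[OF alt_ctr[OF Suc.prems]] by (simp add: alt_diff)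
    with add[OF Suc.prems] scale[OF Suc.prems] same[OF Suc.prems] ce.simps(1) show ?case
      unfolding alt_Suc[of _ _ _ "Suc p"] by blast
  }
qed

lemma alt_diff_eq:
  assumes "f \<in> alt sX sM q"
  shows "alt_diff br act q f = (\<lambda>xs. sg (q + 1) (ce br act f xs))"
proof
  fix xs
  show "alt_diff br act q f xs = sg (q + 1) (ce br act f xs)"
    using ce_eq[OF alt_skew[OF assms], of act xs br] suppD[OF alt_supp[OF ce_alt[OF assms]], of xs]
    by (auto simp: alt_diff_def fan_def fan2_def)
qed

end

section \<open>Tensor products\<close>

text \<open>Vanishing at 0 is listed separately because the target is only a commutative monoid,
  where it does not follow from additivity.\<close>

definition balanced ::
  "'s set \<Rightarrow> ('s \<Rightarrow> 'm \<Rightarrow> 'm) \<Rightarrow> 'm::ab_group_add set \<Rightarrow> ('s \<Rightarrow> 'n \<Rightarrow> 'n) \<Rightarrow> 'n::ab_group_add set \<Rightarrow>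
   ('m \<Rightarrow> 'n \<Rightarrow> 'z::comm_monoid_add) \<Rightarrow> bool" where
  "balanced S sm M sn N F \<longleftrightarrow>
     (\<forall>m\<in>M. \<forall>m'\<in>M. \<forall>n\<in>N. F (m + m') n = F m n + F m' n) \<and>
     (\<forall>m\<in>M. \<forall>n\<in>N. \<forall>n'\<in>N. F m (n + n') = F m n + F m n') \<and>
     (\<forall>n\<in>N. F 0 n = 0) \<and>
     (\<forall>s\<in>S. \<forall>m\<in>M. \<forall>n\<in>N. F (sm s m) n = F m (sn s n))"

abbreviation tensor_sum :: "('m \<Rightarrow> 'n \<Rightarrow> 'z::comm_monoid_add) \<Rightarrow> ('m \<times> 'n) multiset \<Rightarrow> 'z" where
  "tensor_sum F z \<equiv> \<Sum>(m, n)\<in>#z. F m n"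

lemma tensor_rel_sum:
  assumes "tensor_rel S sm M sn N z w" "balanced S sm M sn N F"
  shows "tensor_sum F z = tensor_sum F w"
proof -
  have F: "F (sm s m) n = F m (sn s n)" if "m \<in> M" "n \<in> N" "s \<in> S" for m n s
    using assms(2) that unfolding balanced_def by blast
  have F_add: "F (m + m') n = F m n + F m' n" "F m (n + n') = F m n + F m n'"
    if "m \<in> M" "m' \<in> M" "n \<in> N" "n' \<in> N" for m m' n n'
    using assms(2) that unfolding balanced_def by blast+
  have F0: "F 0 n = 0" if "n \<in> N" for n
    using assms(2) that unfolding balanced_def by blast
  show ?thesis
    using assms(1)
  proof (induction rule: tensor_rel.induct)
    case (balance s m n)
    then show ?case
      by (simp add: F)
  qed (simp_all add: F_add F0)
qed

text \<open>Justifies \<open>the_elem\<close> in \<open>tensor_map\<close>: all representatives of a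
  class have the same sum.\<close>

lemma tensor_map_class:
  assumes "balanced S sm M sn N F" "set_mset z \<subseteq> M \<times> N"
  shows "tensor_map F ({(z, w). tensor_rel S sm M sn N z w} `` {z}) = tensor_sum F z"
proof -
  have "(\<lambda>z. tensor_sum F z) ` ({(z, w). tensor_rel S sm M sn N z w} `` {z}) = {tensor_sum F z}"
  proof -
    have "tensor_sum F w = tensor_sum F z" if "tensor_rel S sm M sn N z w" for w
      using tensor_rel_sum[OF that assms(1)] by simp
    moreover have "tensor_rel S sm M sn N z z"
      using assms(2) by (rule tensor_rel.refl)
    ultimately show ?thesis
      by blast
  qed
  then show ?thesis
    by (simp add: tensor_map_def)
qed

text \<open>Treats at once the two tensor products that occur: the one over the type of scalars in
  the hypothesis on the triple, and the one over the carrier \<open>A 0\<close> in the definition of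
  a quasi-Lie-Rinehart algebra.\<close>

locale tensor_iso =
  fixes S :: "'s set" and sm and M :: "'m::ab_group_add set" and sn and N :: "'n::ab_group_add set"
    and t :: "'m \<Rightarrow> 'n \<Rightarrow> 'u::ab_group_add" and U
  assumes balanced: "balanced S sm M sn N t"
    and bij: "bij_betw (tensor_map t) (tensor S sm M sn N) U"
begin

abbreviation cls where "cls z \<equiv> {(z, w). tensor_rel S sm M sn N z w} `` {z}"

lemma cls_in: "set_mset z \<subseteq> M \<times> N \<Longrightarrow> cls z \<in> tensor S sm M sn N"
  unfolding tensor_def by (rule quotientI) simp

text \<open>The inverse isomorphism sends the sum of the simple tensors in z back to the class of z,
  so any representation of an element may be used to compute the induced map.\<close>

lemma along_iso_sum:
  assumes "balanced S sm M sn N F" "set_mset z \<subseteq> M \<times> N"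
  shows "along_iso (tensor S sm M sn N) t F (tensor_sum t z) = tensor_sum F z"
proof -
  have "the_inv_into (tensor S sm M sn N) (tensor_map t) (tensor_sum t z) = cls z"
    using the_inv_into_f_f[OF bij_betw_imp_inj_on[OF bij] cls_in[OF assms(2)]]
    by (simp only: tensor_map_class[OF balanced assms(2)])
  then show ?thesis
    by (simp only: along_iso_def tensor_map_class[OF assms])
qed

lemma sum_in: "set_mset z \<subseteq> M \<times> N \<Longrightarrow> tensor_sum t z \<in> U"
  using bij_betwE[OF bij] cls_in[of z] tensor_map_class[OF balanced, of z] by metis

lemma sum_exists:
  assumes "u \<in> U"
  obtains z where "set_mset z \<subseteq> M \<times> N" "u = tensor_sum t z"
proof -
  from assms bij obtain C where "C \<in> tensor S sm M sn N" "u = tensor_map t C"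
    by (auto simp: bij_betw_def)
  then show ?thesis
    using that tensor_map_class[OF balanced] by (auto simp: tensor_def quotient_def)
qed

lemma sum_eqD:
  assumes "set_mset z \<subseteq> M \<times> N" "set_mset w \<subseteq> M \<times> N" "tensor_sum t z = tensor_sum t w"
  shows "tensor_rel S sm M sn N z w"
proof -
  have "cls z = cls w"
    by (rule inj_onD[OF bij_betw_imp_inj_on[OF bij] _ cls_in[OF assms(1)] cls_in[OF assms(2)]])
      (simp only: tensor_map_class[OF balanced] assms)
  then show ?thesis
    using tensor_rel.refl[OF assms(2), of S sm sn] by blast
qed

lemma along_iso_simple:
  assumes "balanced S sm M sn N F" "m \<in> M" "n \<in> N"
  shows "along_iso (tensor S sm M sn N) t F (t m n) = F m n"
  using along_iso_sum[of F "{#(m, n)#}"] assms by simp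

lemma along_iso_add:
  assumes F: "balanced S sm M sn N F" and uv: "u \<in> U" "v \<in> U"
  shows "along_iso (tensor S sm M sn N) t F (u + v)
    = along_iso (tensor S sm M sn N) t F u + along_iso (tensor S sm M sn N) t F v"
proof -
  from uv(1) obtain z where z: "set_mset z \<subseteq> M \<times> N" "u = tensor_sum t z"
    by (rule sum_exists)
  from uv(2) obtain w where w: "set_mset w \<subseteq> M \<times> N" "v = tensor_sum t w"
    by (rule sum_exists)
  from z w show ?thesis
    using along_iso_sum[OF F, of z] along_iso_sum[OF F, of w] along_iso_sum[OF F, of "z + w"] by simp
qed

text \<open>Additivity in the function instead of the element. The bracket is a nested
  \<open>along_iso\<close>, and there the first variable occurs in the function applied to the
  second.\<close>

lemma along_iso_fun_add:
  assumes "balanced S sm M sn N F" "balanced S sm M sn N G" "balanced S sm M sn N H" "u \<in> U"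
    and "\<And>m n. m \<in> M \<Longrightarrow> n \<in> N \<Longrightarrow> H m n = F m n + G m n"
  shows "along_iso (tensor S sm M sn N) t H u
    = along_iso (tensor S sm M sn N) t F u + along_iso (tensor S sm M sn N) t G u"
proof -
  from assms(4) obtain z where z: "set_mset z \<subseteq> M \<times> N" "u = tensor_sum t z"
    by (rule sum_exists)
  then have "tensor_sum H z = tensor_sum (\<lambda>m n. F m n + G m n) z"
    by (auto intro!: arg_cong[of _ _ sum_mset] image_mset_cong simp: assms(5))
  also have "\<dots> = tensor_sum F z + tensor_sum G z"
    by (simp add: case_prod_unfold sum_mset.distrib)
  finally show ?thesis
    using z by (simp add: along_iso_sum assms)
qed

lemma along_iso_fun_cong:
  assumes "balanced S sm M sn N F" "balanced S sm M sn N G" "u \<in> U"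
    and "\<And>m n. m \<in> M \<Longrightarrow> n \<in> N \<Longrightarrow> F m n = G m n"
  shows "along_iso (tensor S sm M sn N) t F u = along_iso (tensor S sm M sn N) t G u"
proof -
  from assms(3) obtain z where z: "set_mset z \<subseteq> M \<times> N" "u = tensor_sum t z"
    by (rule sum_exists)
  then have "tensor_sum F z = tensor_sum G z"
    by (auto intro!: arg_cong[of _ _ sum_mset] image_mset_cong simp: assms(4))
  then show ?thesis
    using z by (simp add: along_iso_sum assms)
qed

lemma induct [consumes 1, case_names zero simple add]:
  assumes "u \<in> U" and "P 0"
    and simple: "\<And>m n. m \<in> M \<Longrightarrow> n \<in> N \<Longrightarrow> P (t m n)"
    and add: "\<And>u v. u \<in> U \<Longrightarrow> v \<in> U \<Longrightarrow> P u \<Longrightarrow> P v \<Longrightarrow> P (u + v)"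
  shows "P u"
proof -
  have "P (tensor_sum t z)" if "set_mset z \<subseteq> M \<times> N" for z
    using that
  proof (induction z)
    case (add p z)
    then have "P (tensor_sum t {#p#} + tensor_sum t z)"
      by (intro assms(4) sum_in) (auto simp: simple)
    then show ?case
      by simp
  qed (simp add: \<open>P 0\<close>)
  with \<open>u \<in> U\<close> show ?thesis
    by (metis sum_exists)
qed

end

text \<open>Functoriality of the tensor relation under a change of scalars \<open>k\<close>; it is
  applied with \<open>form0\<close>, from elements of A and Q to forms of degree 0.\<close>

lemma tensor_rel_image:
  assumes "tensor_rel S sm M sn N z w"
    and g: "\<And>m. m \<in> M \<Longrightarrow> g m \<in> M'" "\<And>m m'. g (m + m') = g m + g m'" "g 0 = 0"
    and h: "\<And>n. n \<in> N \<Longrightarrow> h n \<in> N'" "\<And>n n'. h (n + n') = h n + h n'"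
    and k: "\<And>s. s \<in> S \<Longrightarrow> k s \<in> S'" "\<And>s m. s \<in> S \<Longrightarrow> m \<in> M \<Longrightarrow> g (sm s m) = sm' (k s) (g m)"
      "\<And>s n. s \<in> S \<Longrightarrow> n \<in> N \<Longrightarrow> h (sn s n) = sn' (k s) (h n)"
  shows "tensor_rel S' sm' M' sn' N' (image_mset (map_prod g h) z) (image_mset (map_prod g h) w)"
  using assms(1)
proof (induction rule: tensor_rel.induct)
  case (refl z)
  then show ?case
    by (intro tensor_rel.refl) (auto intro: g h)
next
  case (sym z w)
  from sym.IH show ?case
    by (rule tensor_rel.sym)
next
  case (trans z w v)
  then show ?case
    by (blast intro: tensor_rel.trans)
next
  case (cong z w v)
  then show ?case
    by (auto intro!: tensor_rel.cong g h)
next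
  case (add_left m m' n)
  then show ?case
    using tensor_rel.add_left[of "g m" M' "g m'" "h n" N' S' sm' sn'] by (simp add: g h)
next
  case (add_right m n n')
  then show ?case
    using tensor_rel.add_right[of "g m" M' "h n" N' "h n'" S' sm' sn'] by (simp add: g h)
next
  case (zero n)
  then show ?case
    using tensor_rel.zero[of "h n" N' S' sm' M' sn'] by (simp add: g h)
next
  case (balance s m n)
  then show ?case
    using tensor_rel.balance[of "k s" S' "g m" M' "h n" N' sm' sn'] by (simp add: g h k)
qed


section \<open>The pair of a pre-Lie-Rinehart triple\<close>

lemma bilin_additive:
  assumes "bilinear_map sx sy sz b"
  shows "additive (b x)" "additive (\<lambda>x. b x y)"
  using assms by (auto simp: bilin_on_def lin_on_def additive_def)

lemma sg_fun: "sg n f = (\<lambda>x. sg n (f x))"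
  by (simp add: fun_eq_iff sg_apply)

text \<open>Sums of forms occur both as sums of functions and as abstractions of pointwise sums;
  these rules lead from the first to the second.\<close>

lemmas fun_ops = plus_fun_def zero_fun_def fun_Compl_def fun_diff_def sg_fun

lemma ce_sg:
  assumes "\<And>x. additive (act x)"
  shows "ce br act (\<lambda>ys. sg n (f ys)) xs = sg n (ce br act f xs)"
  by (simp add: sg_def ce_minus assms)

lemma lie_sg:
  assumes "additive D"
  shows "lie D N (\<lambda>ys. sg n (f ys)) xs = sg n (lie D N f xs)"
  by (simp add: sg_def lie_minus assms)

locale triple_pair = pre_lie_rinehart_triple T
  for T :: "('r::{comm_ring,comm_monoid_mult}, 'a::{comm_ring,comm_monoid_mult},
      'h::ab_group_add, 'q::ab_group_add) triple" +
  assumes iso: "canonical_map_iso T"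
begin

lemmas brH_add = bilin_additive[OF brH_bilinear]
  and brQ_add = bilin_additive[OF brQ_bilinear]
  and actH_add = bilin_additive[OF actH_bilinear]
  and actQ_add = bilin_additive[OF actQ_bilinear]
  and HQ_add = bilin_additive[OF HQ_bilinear]
  and QH_add = bilin_additive[OF QH_bilinear]
  and dlt_add = bilin_additive[OF dlt_bilinear]

lemmas additives = brH_add brQ_add actH_add actQ_add HQ_add QH_add dlt_add
lemmas zeros = additives[THEN additive.zero]
  and adds = additives[THEN additive.add]
  and minuses = additives[THEN additive.minus]

sublocale R: comm_algebra "rsc T"
  by (rule algebra_A)

sublocale A: unital_module "(*) :: 'a \<Rightarrow> 'a \<Rightarrow> 'a"
  by (rule unital_module_mult)

lemma actH_mult: "actH T x (a * b) = actH T x a * b + a * actH T x b"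
  and actQ_mult: "actQ T \<xi> (a * b) = actQ T \<xi> a * b + a * actQ T \<xi> b"
  using actH_derivation actQ_derivation by (auto simp: derivation_def)

sublocale CA: connection "sH T" "(*)" "brH T" "actH T" "actH T"
  by (intro connection.intro two_modules.intro module_H unital_module_mult connection_axioms.intro)
    (simp_all add: additives brH_self brH_scale actH_scale actH_mult)

sublocale CQ: connection "sH T" "sQ T" "brH T" "actH T" "HQ T"
  by (intro connection.intro two_modules.intro module_H module_Q connection_axioms.intro)
    (simp_all add: additives brH_self brH_scale HQ_scale_left HQ_scale_right)

sublocale QA: two_modules "sQ T" "(*) :: 'a \<Rightarrow> 'a \<Rightarrow> 'a"
  by (intro two_modules.intro module_Q unital_module_mult)

lemma jacobi_H: "brH T (brH T x y) z = brH T x (brH T y z) - brH T y (brH T x z)"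
proof -
  have "brH T x (brH T y z) + brH T y (brH T z x) + brH T z (brH T x y) = 0"
    using lie_rinehart.jacobi[OF lie_rinehart_H] .
  moreover have "brH T y (brH T z x) = - brH T y (brH T x z)"
    using CA.br_swap[of z x] by (simp add: minuses)
  moreover have "brH T z (brH T x y) = - brH T (brH T x y) z"
    by (rule CA.br_swap)
  ultimately show ?thesis
    by (simp add: algebra_simps)
qed

lemma actH_br: "actH T (brH T x y) a = actH T x (actH T y a) - actH T y (actH T x a)"
  using lie_rinehart.act_br[OF lie_rinehart_H] .

lemma brQ_swap: "brQ T \<xi> \<eta> = - brQ T \<eta> \<xi>"
proof -
  have "brQ T (\<xi> + \<eta>) (\<xi> + \<eta>) = brQ T \<xi> \<xi> + brQ T \<eta> \<xi> + (brQ T \<xi> \<eta> + brQ T \<eta> \<eta>)"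
    by (simp only: additive.add[OF brQ_add(1)] additive.add[OF brQ_add(2)])
  then have "brQ T (\<xi> + \<eta>) (\<xi> + \<eta>) = brQ T \<xi> \<eta> + brQ T \<eta> \<xi>"
    by (simp only: brQ_self add_0_left add_0_right add.commute)
  then show ?thesis
    by (simp only: brQ_self eq_neg_iff_add_eq_0)
qed

lemma dlt_swap: "dlt T \<xi> \<eta> = - dlt T \<eta> \<xi>"
proof -
  have "dlt T (\<xi> + \<eta>) (\<xi> + \<eta>) = dlt T \<xi> \<xi> + dlt T \<eta> \<xi> + (dlt T \<xi> \<eta> + dlt T \<eta> \<eta>)"
    by (simp only: additive.add[OF dlt_add(1)] additive.add[OF dlt_add(2)])
  then have "dlt T (\<xi> + \<eta>) (\<xi> + \<eta>) = dlt T \<xi> \<eta> + dlt T \<eta> \<xi>"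
    by (simp only: dlt_self add_0_left add_0_right add.commute)
  then show ?thesis
    by (simp only: dlt_self eq_neg_iff_add_eq_0)
qed

lemma brQ_scale_left: "brQ T (sQ T a \<xi>) \<eta> = sQ T a (brQ T \<xi> \<eta>) - sQ T (actQ T \<eta> a) \<xi>"
  using brQ_swap[of "sQ T a \<xi>" \<eta>] brQ_swap[of \<xi> \<eta>] by (simp add: brQ_scale CQ.M.scale_minus_right)

lemma dlt_scale: "dlt T (sQ T a \<xi>) \<eta> = sH T a (dlt T \<xi> \<eta>)" "dlt T \<xi> (sQ T a \<eta>) = sH T a (dlt T \<xi> \<eta>)"
  using dlt_bilinear by (auto simp: bilin_on_def lin_on_def)

abbreviation Qact where "Qact \<equiv> Q_action T"

lemma Qact_eq: "Qact \<xi> = lie (actQ T \<xi>) (QH T \<xi>)"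
  by (simp add: fun_eq_iff Q_action_def lie_def)

lemma Qact_alt: "\<alpha> \<in> AltHA T q \<Longrightarrow> Qact \<xi> \<alpha> \<in> AltHA T q"
  unfolding AltHA_def Qact_eq
  by (rule CA.lie_alt[where E = "actQ T \<xi>"]) (simp_all add: additives QH_scale_right actQ_mult)

lemma Qact_add_right: "Qact \<xi> (\<lambda>ys. \<alpha> ys + \<beta> ys) xs = Qact \<xi> \<alpha> xs + Qact \<xi> \<beta> xs"
  by (simp add: Qact_eq lie_add additives)

lemma Qact_zero_right [simp]: "Qact \<xi> (\<lambda>ys. 0) xs = 0"
  by (simp add: Qact_eq lie_zero additives)

lemma Qact_sg: "Qact \<xi> (\<lambda>ys. sg n (\<alpha> ys)) xs = sg n (Qact \<xi> \<alpha> xs)"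
  by (simp add: Qact_eq lie_sg additives)

lemma Qact_scale_right: "Qact \<xi> (\<lambda>ys. a * \<alpha> ys) xs = actQ T \<xi> a * \<alpha> xs + a * Qact \<xi> \<alpha> xs"
  by (simp add: Qact_eq lie_def actQ_mult A.scale_diff_right sum_distrib_left A.scale_sum_right)

lemma Qact_add_left:
  assumes "\<alpha> \<in> AltHA T q"
  shows "Qact (\<xi> + \<eta>) \<alpha> = (\<lambda>xs. Qact \<xi> \<alpha> xs + Qact \<eta> \<alpha> xs)"
proof -
  have "actQ T (\<xi> + \<eta>) = (\<lambda>m. actQ T \<xi> m + actQ T \<eta> m)" "QH T (\<xi> + \<eta>) = (\<lambda>z. QH T \<xi> z + QH T \<eta> z)"
    by (simp_all add: fun_eq_iff adds)
  then show ?thesis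
    using lie_pair_add[OF alt_madd[OF assms[unfolded AltHA_def]]] by (simp add: Qact_eq)
qed

text \<open>In contrast to \<open>lie_scale_left\<close> there is no term with derivatives of a,
  since the operation of Q on H is A-linear in its first argument. The pairing is well defined on
  the tensor product for this reason.\<close>

lemma Qact_scale_left:
  assumes "\<alpha> \<in> AltHA T q"
  shows "Qact (sQ T a \<xi>) \<alpha> = (\<lambda>xs. a * Qact \<xi> \<alpha> xs)"
proof
  fix xs
  show "Qact (sQ T a \<xi>) \<alpha> xs = a * Qact \<xi> \<alpha> xs"
    using assms
  proof (induction xs arbitrary: q \<alpha>)
    case (Cons x xs)
    show ?case
    proof (cases q)
      case 0
      with Cons.prems show ?thesis
        by (simp add: AltHA_def alt_0 supp_def Qact_eq lie_zero additives)
    next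
      case (Suc n)
      with Cons.IH[of "ctr x \<alpha>" n] Cons.prems alt_ctr[of \<alpha> "sH T" "(*)" n x]
        CA.alt_scale_head[of \<alpha> q a "QH T \<xi> x" xs] show ?thesis
        by (simp add: AltHA_def Qact_eq QH_scale_left A.scale_diff_right)
    qed
  qed (simp add: Qact_eq actQ_scale)
qed

lemma Qact_shuf: "Qact \<xi> (shuf (*) \<alpha> \<beta>) xs = shuf (*) (Qact \<xi> \<alpha>) \<beta> xs + shuf (*) \<alpha> (Qact \<xi> \<beta>) xs"
  unfolding Qact_eq by (rule A.shuf_lie) (simp_all add: additives actQ_mult)

lemma actQ_rsc: "actQ T \<xi> (rsc T r a) = rsc T r (actQ T \<xi> a)"
  and actH_rsc: "actH T x (rsc T r a) = rsc T r (actH T x a)"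
  using actQ_derivation actH_derivation by (auto simp: derivation_def lin_on_def)

lemma rsc_eq: "rsc T r a = rsc T r 1 * a"
  using R.rsc_mult[of r 1 a] by simp

lemma act_one [simp]: "actQ T \<xi> 1 = 0" "actH T x 1 = 0"
  using actQ_mult[of \<xi> 1 1] actH_mult[of x 1 1] by simp_all

lemma act_rsc_one [simp]: "actQ T \<xi> (rsc T r 1) = 0" "actH T x (rsc T r 1) = 0"
  by (simp_all add: actQ_rsc actH_rsc)

section \<open>Products and differentials of scalar and Q-valued forms\<close>

lemma pair_mul_eq:
  assumes "\<alpha> \<in> AltHA T p"
  shows "pair_mul p q \<alpha> \<beta> = (\<lambda>xs. sg (p * q) (shuf (*) \<alpha> \<beta> xs))"
  using A.wedge_eq_shuf[OF alt_supp[OF assms[unfolded AltHA_def]]]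
  by (simp add: pair_mul_def fun_ops)

lemma pair_scale_eq:
  assumes "\<alpha> \<in> AltHA T p"
  shows "pair_scale T p q \<alpha> f = (\<lambda>xs. sg (p * q) (shuf (sQ T) \<alpha> f xs))"
  using CQ.M.wedge_eq_shuf[OF alt_supp[OF assms[unfolded AltHA_def]]]
  by (simp add: pair_scale_def fun_ops)

lemma mul_closed: "\<alpha> \<in> AltHA T p \<Longrightarrow> \<beta> \<in> AltHA T q \<Longrightarrow> pair_mul p q \<alpha> \<beta> \<in> AltHA T (p + q)"
  by (simp add: pair_mul_eq) (simp add: AltHA_def CA.alt_sg CA.shuf_alt)

lemma scale_closed: "\<alpha> \<in> AltHA T p \<Longrightarrow> f \<in> AltHQ T q \<Longrightarrow> pair_scale T p q \<alpha> f \<in> AltHQ T (p + q)"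
  by (simp add: pair_scale_eq) (simp add: AltHA_def AltHQ_def CQ.alt_sg CQ.shuf_alt)

abbreviation dA where "dA \<equiv> alt_diff (brH T) (actH T)"
abbreviation dM where "dM \<equiv> alt_diff (brH T) (HQ T)"

lemma dA_eq: "\<alpha> \<in> AltHA T q \<Longrightarrow> dA q \<alpha> = (\<lambda>xs. sg (q + 1) (ce (brH T) (actH T) \<alpha> xs))"
  unfolding AltHA_def by (rule CA.alt_diff_eq)

lemma dM_eq: "f \<in> AltHQ T q \<Longrightarrow> dM q f = (\<lambda>xs. sg (q + 1) (ce (brH T) (HQ T) f xs))"
  unfolding AltHQ_def by (rule CQ.alt_diff_eq)

lemma dA_closed: "\<alpha> \<in> AltHA T q \<Longrightarrow> dA q \<alpha> \<in> AltHA T (q + 1)"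
  by (simp only: dA_eq) (simp add: AltHA_def CA.alt_minus CA.alt_sg CA.ce_alt)

lemma dM_closed: "f \<in> AltHQ T q \<Longrightarrow> dM q f \<in> AltHQ T (q + 1)"
  by (simp only: dM_eq) (simp add: AltHQ_def CQ.alt_minus CQ.alt_sg CQ.ce_alt)

lemmas AltHA_supp = alt_supp[of _ "sH T" "(*)", folded AltHA_def]
  and AltHA_madd = alt_madd[of _ "sH T" "(*)", folded AltHA_def]
  and AltHA_skew = alt_skew[of _ "sH T" "(*)", folded AltHA_def]
  and AltHA_head = alt_head[of _ "sH T" "(*)", folded AltHA_def]
  and AltHQ_supp = alt_supp[of _ "sH T" "sQ T", folded AltHQ_def]
  and AltHQ_madd = alt_madd[of _ "sH T" "sQ T", folded AltHQ_def]

lemma rscale_eq: "pair_rscale T r \<alpha> = (\<lambda>xs. rsc T r 1 * \<alpha> xs)"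
  by (simp add: pair_rscale_def fun_eq_iff rsc_eq[of r "\<alpha> _"])

lemma AltHA_ops:
  "0 \<in> AltHA T q" "\<alpha> \<in> AltHA T q \<Longrightarrow> \<beta> \<in> AltHA T q \<Longrightarrow> \<alpha> + \<beta> \<in> AltHA T q"
  "\<alpha> \<in> AltHA T q \<Longrightarrow> - \<alpha> \<in> AltHA T q" "\<alpha> \<in> AltHA T q \<Longrightarrow> pair_rscale T r \<alpha> \<in> AltHA T q"
  "\<alpha> \<in> AltHA T q \<Longrightarrow> (\<lambda>xs. a * \<alpha> xs) \<in> AltHA T q"
  "\<alpha> \<in> AltHA T q \<Longrightarrow> sg n \<alpha> \<in> AltHA T q" "form0 a \<in> AltHA T 0"
  "\<alpha> \<in> AltHA T q \<Longrightarrow> \<beta> \<in> AltHA T q \<Longrightarrow> \<alpha> - \<beta> \<in> AltHA T q"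
  by (auto simp: AltHA_def fun_ops rscale_eq CA.alt_scale intro: CA.alt_add CA.alt_minus CA.alt_sg CA.alt_diff)

lemma AltHQ_ops:
  "0 \<in> AltHQ T q" "f \<in> AltHQ T q \<Longrightarrow> g \<in> AltHQ T q \<Longrightarrow> f + g \<in> AltHQ T q"
  "f \<in> AltHQ T q \<Longrightarrow> - f \<in> AltHQ T q" "f \<in> AltHQ T q \<Longrightarrow> sg n f \<in> AltHQ T q" "form0 \<xi> \<in> AltHQ T 0"
  "f \<in> AltHQ T q \<Longrightarrow> g \<in> AltHQ T q \<Longrightarrow> f - g \<in> AltHQ T q"
  by (auto simp: AltHQ_def fun_ops intro: CQ.alt_add CQ.alt_minus CQ.alt_sg CQ.alt_diff)

text \<open>The shuffle and Cartan identities supply the content; what is left are the sign twists p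
  * q in the product and q + 1 in the differential.\<close>

lemma dg_comm_algebra_pair: "dg_comm_algebra (pair_rscale T) (AltHA T) pair_mul (form0 1) dA"
proof
  show "add_subgroup (AltHA T q)" for q
    by (simp add: add_subgroup_def AltHA_ops)
  show "bilin_on UNIV (AltHA T p) (AltHA T q) (pair_rscale T) (pair_rscale T) (pair_rscale T) (pair_mul p q)"
    for p q
    by (auto simp: bilin_on_def lin_on_def pair_mul_eq AltHA_ops rscale_eq)
      (simp_all add: fun_ops sg_add A.shuf_add_left A.shuf_add_right A.shuf_scale_left
        A.shuf_scale_right A.scale_sg_right)
next
  fix \<alpha> \<beta> \<gamma> p q n
  assume *: "\<alpha> \<in> AltHA T p" "\<beta> \<in> AltHA T q" "\<gamma> \<in> AltHA T n"
  show "pair_mul (p + q) n (pair_mul p q \<alpha> \<beta>) \<gamma> = pair_mul p (q + n) \<alpha> (pair_mul q n \<beta> \<gamma>)"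
    using mul_closed[OF *(1,2)] *
    by (simp add: pair_mul_eq A.shuf_sg_left A.shuf_sg_right A.shuf_assoc sg_sg algebra_simps)
next
  fix \<alpha> \<beta> p q
  assume *: "\<alpha> \<in> AltHA T p" "\<beta> \<in> AltHA T q"
  show "pair_mul p q \<alpha> \<beta> = sg (p * q) (pair_mul q p \<beta> \<alpha>)"
    using shuf_commute[OF AltHA_supp[OF *(1)] AltHA_supp[OF *(2)]] *
    by (simp add: pair_mul_eq fun_ops mult.commute)
  show "dA (p + q) (pair_mul p q \<alpha> \<beta>)
      = pair_mul (p + 1) q (dA p \<alpha>) \<beta> + sg p (pair_mul p (q + 1) \<alpha> (dA q \<beta>))"
  proof -
    let ?d = "ce (brH T) (actH T)"
    have "dA (p + q) (pair_mul p q \<alpha> \<beta>) = (\<lambda>xs. sg (p + q + 1) (sg (p * q) (?d (shuf (*) \<alpha> \<beta>) xs)))"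
      unfolding dA_eq[OF mul_closed[OF *]] by (simp only: pair_mul_eq[OF *(1)] ce_sg[OF actH_add(1)])
    moreover have "pair_mul (p + 1) q (dA p \<alpha>) \<beta>
        = (\<lambda>xs. sg ((p + 1) * q) (sg (p + 1) (shuf (*) (?d \<alpha>) \<beta> xs)))"
      unfolding pair_mul_eq[OF dA_closed[OF *(1)]] by (simp only: dA_eq[OF *(1)] A.shuf_sg_left)
    moreover have "pair_mul p (q + 1) \<alpha> (dA q \<beta>)
        = (\<lambda>xs. sg (p * (q + 1)) (sg (q + 1) (shuf (*) \<alpha> (?d \<beta>) xs)))"
      by (simp only: pair_mul_eq[OF *(1)] dA_eq[OF *(2)] A.shuf_sg_right)
    moreover have "?d (shuf (*) \<alpha> \<beta>) xs = shuf (*) (?d \<alpha>) \<beta> xs + sg p (shuf (*) \<alpha> (?d \<beta>) xs)" for xs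
      using A.shuf_ce[of "actH T" "actH T" "brH T" \<alpha> \<beta> xs]
      by (simp add: additives actH_mult parity_supp[OF AltHA_supp[OF *(1)]] A.shuf_sg_left)
    \<comment> \<open>Modulo 2 the exponents on both sides are pq + p + q + 1 for the term with the
      differential of \<alpha> and pq + q + 1 for the other.\<close>
    ultimately show ?thesis
      by (simp add: fun_eq_iff fun_ops sg_add sg_sg) (simp add: sg_def)
  qed
next
  fix \<alpha> q
  assume *: "\<alpha> \<in> AltHA T q"
  show "dA (q + 1) (dA q \<alpha>) = 0"
    using ce_ce[OF AltHA_madd[OF *] actH_add(1) actH_br jacobi_H]
    by (simp only: dA_eq[OF dA_closed[OF *]]) (simp add: dA_eq[OF *] ce_sg ce_minus additives fun_ops)
next
  show "lin_on UNIV (AltHA T q) (pair_rscale T) (pair_rscale T) (dA q)" for q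
    by (auto simp: lin_on_def dA_eq AltHA_ops)
     (simp_all add: fun_ops rscale_eq sg_add ce_add CA.ce_scale additives A.scale_sg_right)
qed (simp_all only: AltHA_ops mul_closed dA_closed,
     simp_all add: AltHA_ops pair_mul_eq A.shuf_form0_left,
     simp_all add: pair_rscale_def fun_ops R.scale_add_left R.scale_add_right R.scale_scale R.scale_one)

end

text \<open>As simplification rules these would also rewrite an unapplied sum \<open>f + g\<close> to its
  \<open>\<eta>\<close>-expansion, after which additivity in \<open>f\<close> no longer applies.\<close>

declare plus_fun_apply [simp del] zero_fun_apply [simp del] minus_apply [simp del] uminus_apply [simp del]

context triple_pair
begin

sublocale DG: dg_comm_algebra "pair_rscale T" "AltHA T" pair_mul "form0 1" dA
  by (rule dg_comm_algebra_pair)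

lemma rscale_form0: "pair_rscale T r (form0 1) = form0 (rsc T r 1)"
  by (auto simp: rscale_eq form0_def fun_eq_iff)

lemma scale_form0: "pair_scale T 0 q (form0 a) f = (\<lambda>xs. sQ T a (f xs))"
  by (simp add: pair_scale_eq AltHA_ops CQ.M.shuf_form0_left)

text \<open>That the differential squares to zero uses the flatness \<open>HQ_br\<close> of the
  action of H on Q.\<close>

lemma dg_module_pair:
  "dg_module (pair_rscale T) (AltHA T) pair_mul (form0 1) dA (AltHQ T) (pair_scale T) dM"
proof
  show "add_subgroup (AltHQ T q)" for q
    by (simp add: add_subgroup_def AltHQ_ops)
next
  fix \<alpha> \<beta> f p q n
  assume *: "\<alpha> \<in> AltHA T p" "\<beta> \<in> AltHA T q" "f \<in> AltHQ T n"
  show "pair_scale T (p + q) n (pair_mul p q \<alpha> \<beta>) f = pair_scale T p (q + n) \<alpha> (pair_scale T q n \<beta> f)"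
    using mul_closed[OF *(1,2)] *
    by (simp add: pair_mul_eq pair_scale_eq CQ.M.shuf_sg_left CQ.M.shuf_sg_right CQ.M.shuf_assoc
        sg_sg algebra_simps)
next
  fix \<alpha> f p q
  assume *: "\<alpha> \<in> AltHA T p" "f \<in> AltHQ T q"
  show "dM (p + q) (pair_scale T p q \<alpha> f)
      = pair_scale T (p + 1) q (dA p \<alpha>) f + sg p (pair_scale T p (q + 1) \<alpha> (dM q f))"
  proof -
    let ?d = "ce (brH T) (actH T)" and ?d' = "ce (brH T) (HQ T)"
    have "dM (p + q) (pair_scale T p q \<alpha> f) = (\<lambda>xs. sg (p + q + 1) (sg (p * q) (?d' (shuf (sQ T) \<alpha> f) xs)))"
      unfolding dM_eq[OF scale_closed[OF *]] by (simp only: pair_scale_eq[OF *(1)] ce_sg[OF HQ_add(1)])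
    moreover have "pair_scale T (p + 1) q (dA p \<alpha>) f
        = (\<lambda>xs. sg ((p + 1) * q) (sg (p + 1) (shuf (sQ T) (?d \<alpha>) f xs)))"
      unfolding pair_scale_eq[OF dA_closed[OF *(1)]] by (simp only: dA_eq[OF *(1)] CQ.M.shuf_sg_left)
    moreover have "pair_scale T p (q + 1) \<alpha> (dM q f)
        = (\<lambda>xs. sg (p * (q + 1)) (sg (q + 1) (shuf (sQ T) \<alpha> (?d' f) xs)))"
      by (simp only: pair_scale_eq[OF *(1)] dM_eq[OF *(2)] CQ.M.shuf_sg_right)
    moreover have "?d' (shuf (sQ T) \<alpha> f) xs = shuf (sQ T) (?d \<alpha>) f xs + sg p (shuf (sQ T) \<alpha> (?d' f) xs)" for xs
      using CQ.M.shuf_ce[of "HQ T" "actH T" "brH T" \<alpha> f xs]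
      by (simp add: additives HQ_scale_right parity_supp[OF AltHA_supp[OF *(1)]] CQ.M.shuf_sg_left)
    ultimately show ?thesis
      by (simp add: fun_eq_iff fun_ops sg_add sg_sg) (simp add: sg_def)
  qed
next
  fix f q
  assume *: "f \<in> AltHQ T q"
  show "dM (q + 1) (dM q f) = 0"
    using ce_ce[OF AltHQ_madd[OF *] HQ_add(1) HQ_br jacobi_H]
    by (simp only: dM_eq[OF dM_closed[OF *]]) (simp add: dM_eq[OF *] ce_sg ce_minus additives fun_ops)
next
  show "lin_on UNIV (AltHQ T q) (\<lambda>r. pair_scale T 0 q (pair_rscale T r (form0 1)))
     (\<lambda>r. pair_scale T 0 (q + 1) (pair_rscale T r (form0 1))) (dM q)" for q
  proof -
    have "dM q (\<lambda>xs. sQ T (rsc T r 1) (f xs)) = (\<lambda>xs. sQ T (rsc T r 1) (dM q f xs))" if "f \<in> AltHQ T q" for r f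
    proof -
      have "(\<lambda>xs. sQ T (rsc T r 1) (f xs)) \<in> AltHQ T q"
        using that unfolding AltHQ_def by (rule CQ.alt_scale)
      with that show ?thesis
        by (simp add: dM_eq CQ.ce_scale CQ.M.scale_sg_right CQ.M.scale_minus_right)
    qed
    moreover have "dM q (f + g) = dM q f + dM q g" if "f \<in> AltHQ T q" "g \<in> AltHQ T q" for f g
      using that AltHQ_ops(2)[OF that] by (simp add: dM_eq) (simp add: fun_ops sg_add ce_add additives)
    ultimately show ?thesis
      by (simp add: lin_on_def rscale_form0 scale_form0)
  qed
qed (simp_all only: AltHQ_ops scale_closed dM_closed,
     simp_all add: AltHA_ops pair_scale_eq CQ.M.shuf_form0_left CQ.M.scale_one,
     simp_all add: fun_ops sg_add CQ.M.shuf_add_left CQ.M.shuf_add_right)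

sublocale DM: dg_module "pair_rscale T" "AltHA T" pair_mul "form0 1" dA "AltHQ T" "pair_scale T" dM
  by (rule dg_module_pair)

section \<open>Pairing and bracket through the canonical isomorphism\<close>

abbreviation simp_tensor (infixl "\<odot>" 75) where "\<alpha> \<odot> \<xi> \<equiv> simple_tensor T \<alpha> \<xi>"

lemma simple_tensor_eq: "\<alpha> \<in> AltHA T p \<Longrightarrow> \<alpha> \<odot> \<xi> = pair_scale T p 0 \<alpha> (form0 \<xi>)"
  by (simp add: simple_tensor_def pair_scale_eq CQ.M.shuf_form0_right)

lemma simple_tensor_closed: "\<alpha> \<in> AltHA T p \<Longrightarrow> \<alpha> \<odot> \<xi> \<in> AltHQ T p"
  using scale_closed[of \<alpha> p "form0 \<xi>" 0] by (simp add: simple_tensor_eq AltHQ_ops)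

lemma AltHQ_0: "u \<in> AltHQ T 0 \<longleftrightarrow> u = form0 (u [])"
  unfolding AltHQ_def by (rule alt_0_form0)

lemma AltHA_0: "\<alpha> \<in> AltHA T 0 \<longleftrightarrow> \<alpha> = form0 (\<alpha> [])"
  unfolding AltHA_def by (rule alt_0_form0)

lemma form0_simple: "form0 \<xi> = form0 1 \<odot> \<xi>"
  by (auto simp: simple_tensor_def form0_def CQ.M.scale_one)

abbreviation bal where
  "bal q \<equiv> balanced UNIV (\<lambda>a \<alpha> xs. a * \<alpha> xs) (AltHA T q) (sQ T) UNIV"

lemma tensor_iso_pair:
  "tensor_iso UNIV (\<lambda>a \<alpha> xs. a * \<alpha> xs) (AltHA T q) (sQ T) UNIV (simple_tensor T) (AltHQ T q)"
proof
  show "bal q (simple_tensor T)"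
    unfolding balanced_def
    by (simp add: simple_tensor_def fun_eq_iff CQ.M.scale_add_left CQ.M.scale_add_right
        CQ.M.scale_scale mult.commute plus_fun_apply zero_fun_apply)
  show "bij_betw (tensor_map (simple_tensor T)) (tensor UNIV (\<lambda>a \<alpha> xs. a * \<alpha> xs) (AltHA T q) (sQ T) UNIV)
     (AltHQ T q)"
    using iso by (simp add: canonical_map_iso_def AltHA_tensor_Q_def)
qed

abbreviation ext where "ext q \<equiv> along_iso (AltHA_tensor_Q T q) (simple_tensor T)"

lemmas ext_simple = tensor_iso.along_iso_simple[OF tensor_iso_pair, folded AltHA_tensor_Q_def]
  and ext_add = tensor_iso.along_iso_add[OF tensor_iso_pair, folded AltHA_tensor_Q_def]
  and ext_fun_add = tensor_iso.along_iso_fun_add[OF tensor_iso_pair, folded AltHA_tensor_Q_def]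
  and ext_fun_cong = tensor_iso.along_iso_fun_cong[OF tensor_iso_pair, folded AltHA_tensor_Q_def]

text \<open>The zero case of the general induction is absorbed, because 0 is itself a simple
  tensor.\<close>

lemma AltHQ_induct [consumes 1, case_names simple add]:
  assumes "u \<in> AltHQ T q"
    and simple: "\<And>\<alpha> \<xi>. \<alpha> \<in> AltHA T q \<Longrightarrow> P (\<alpha> \<odot> \<xi>)"
    and "\<And>u v. u \<in> AltHQ T q \<Longrightarrow> v \<in> AltHQ T q \<Longrightarrow> P u \<Longrightarrow> P v \<Longrightarrow> P (u + v)"
  shows "P u"
  using assms(1)
proof (induction rule: tensor_iso.induct[OF tensor_iso_pair, consumes 1, case_names zero simple add])
  case zero
  show ?case
    using simple[OF AltHA_ops(1), of 0] by (simp add: simple_tensor_def fun_ops)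
qed (use assms in auto)

abbreviation "pairing \<equiv> pair_pairing T"
abbreviation "bracket \<equiv> pair_bracket T"

lemma pairing_balanced:
  assumes "\<beta> \<in> AltHA T q"
  shows "bal p (\<lambda>\<alpha> \<xi>. pair_mul p q \<alpha> (Qact \<xi> \<beta>))"
  using assms unfolding balanced_def
  by (simp add: pair_mul_eq AltHA_ops Qact_add_left Qact_scale_left)
    (simp add: fun_ops sg_add A.shuf_add_left A.shuf_add_right A.shuf_scale_left A.shuf_scale_right)

lemma pairing_simple:
  assumes "\<alpha> \<in> AltHA T p" "\<beta> \<in> AltHA T q"
  shows "pairing p q (\<alpha> \<odot> \<xi>) \<beta> = pair_mul p q \<alpha> (Qact \<xi> \<beta>)"
  unfolding pair_pairing_def using ext_simple[OF pairing_balanced[OF assms(2)] assms(1)] by simp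

lemma pairing_add_left:
  assumes "u \<in> AltHQ T p" "v \<in> AltHQ T p" "\<beta> \<in> AltHA T q"
  shows "pairing p q (u + v) \<beta> = pairing p q u \<beta> + pairing p q v \<beta>"
  unfolding pair_pairing_def using ext_add[OF pairing_balanced[OF assms(3)] assms(1,2)] .

lemma pairing_closed:
  assumes "u \<in> AltHQ T p" "\<beta> \<in> AltHA T q"
  shows "pairing p q u \<beta> \<in> AltHA T (p + q)"
  using assms
  by (induction u rule: AltHQ_induct)
    (simp_all add: pairing_simple mul_closed Qact_alt pairing_add_left AltHA_ops)

lemma pairing_add_right:
  assumes "u \<in> AltHQ T p" "\<beta> \<in> AltHA T q" "\<gamma> \<in> AltHA T q"
  shows "pairing p q u (\<beta> + \<gamma>) = pairing p q u \<beta> + pairing p q u \<gamma>"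
  using assms(1)
proof (induction u rule: AltHQ_induct)
  case (simple \<alpha> \<xi>)
  then show ?case
    using assms
    by (simp add: pairing_simple AltHA_ops pair_mul_eq)
      (simp add: fun_ops Qact_add_right[abs_def] A.shuf_add_right sg_add)
qed (simp add: pairing_add_left AltHA_ops assms)

lemma pairing_form0: "\<beta> \<in> AltHA T q \<Longrightarrow> pairing 0 q (form0 \<xi>) \<beta> = Qact \<xi> \<beta>"
  unfolding form0_simple[of \<xi>]
  by (simp add: pairing_simple AltHA_ops pair_mul_eq A.shuf_form0_left)

definition Br where
  "Br p q \<alpha> \<xi> \<beta> \<eta> = pair_mul p q \<alpha> (Qact \<xi> \<beta>) \<odot> \<eta>
     - sg (p * q) (pair_mul q p \<beta> (Qact \<eta> \<alpha>) \<odot> \<xi>) + pair_mul p q \<alpha> \<beta> \<odot> brQ T \<xi> \<eta>"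

lemma Br_eq:
  assumes "\<alpha> \<in> AltHA T p" "\<beta> \<in> AltHA T q"
  shows "Br p q \<alpha> \<xi> \<beta> \<eta> = (\<lambda>xs. sg (p * q) (sQ T (shuf (*) \<alpha> (Qact \<xi> \<beta>) xs) \<eta>)
     - sQ T (shuf (*) \<beta> (Qact \<eta> \<alpha>) xs) \<xi> + sg (p * q) (sQ T (shuf (*) \<alpha> \<beta> xs) (brQ T \<xi> \<eta>)))"
  using assms
  by (simp add: Br_def pair_mul_eq fun_ops simple_tensor_def CQ.M.scale_sg_left mult.commute[of q p])

lemma Br_closed:
  assumes "\<alpha> \<in> AltHA T p" "\<beta> \<in> AltHA T q"
  shows "Br p q \<alpha> \<xi> \<beta> \<eta> \<in> AltHQ T (p + q)"
proof -
  have "pair_mul q p \<beta> (Qact \<eta> \<alpha>) \<in> AltHA T (p + q)"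
    using mul_closed[OF assms(2) Qact_alt[OF assms(1)], of \<eta>] by (simp add: add.commute)
  then show ?thesis
    unfolding Br_def by (intro AltHQ_ops simple_tensor_closed mul_closed Qact_alt assms)
qed

lemma Br_skew:
  assumes "\<alpha> \<in> AltHA T p" "\<beta> \<in> AltHA T q"
  shows "Br p q \<alpha> \<xi> \<beta> \<eta> = - sg (p * q) (Br q p \<beta> \<eta> \<alpha> \<xi>)"
  unfolding Br_eq[OF assms] Br_eq[OF assms(2,1)] brQ_swap[of \<eta> \<xi>]
    shuf_commute[OF AltHA_supp[OF assms(2)] AltHA_supp[OF assms(1)]]
  by (simp add: fun_ops CQ.M.scale_sg_left CQ.M.scale_minus_right sg_add sg_diff sg_minus
      mult.commute[of q p] algebra_simps)

text \<open>Although the bracket is not A-bilinear, it is balanced: moving a from \<beta> to \<eta>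
  trades the derivative of a in \<xi>(a\<beta>) for the same derivative in [\<xi>, a\<eta>].\<close>

lemma Br_balanced:
  assumes "\<alpha> \<in> AltHA T p"
  shows "bal q (Br p q \<alpha> \<xi>)"
  unfolding balanced_def
proof (intro conjI ballI)
  fix \<beta> \<beta>' :: "'h list \<Rightarrow> 'a" and \<eta> \<eta>' a
  assume b: "\<beta> \<in> AltHA T q"
  show "Br p q \<alpha> \<xi> \<beta> (\<eta> + \<eta>') = Br p q \<alpha> \<xi> \<beta> \<eta> + Br p q \<alpha> \<xi> \<beta> \<eta>'"
    using assms b
    by (simp add: Br_eq Qact_add_left[OF assms])
      (simp add: fun_ops CQ.M.scale_add_left CQ.M.scale_add_right sg_add A.shuf_add_right
        adds algebra_simps)
  show "Br p q \<alpha> \<xi> (\<lambda>xs. a * \<beta> xs) \<eta> = Br p q \<alpha> \<xi> \<beta> (sQ T a \<eta>)"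
    using assms b
    by (simp add: Br_eq AltHA_ops Qact_scale_left[OF assms] Qact_scale_right[abs_def])
      (simp add: fun_eq_iff CQ.M.scale_add_left CQ.M.scale_add_right sg_add A.shuf_add_right
        A.shuf_scale_right A.shuf_scale_left CQ.M.scale_scale brQ_scale, simp add: mult.commute)
  show "Br p q \<alpha> \<xi> (\<beta> + \<beta>') \<eta> = Br p q \<alpha> \<xi> \<beta> \<eta> + Br p q \<alpha> \<xi> \<beta>' \<eta>" if "\<beta>' \<in> AltHA T q"
    using assms b that
    by (simp add: Br_eq AltHA_ops)
      (simp add: fun_ops CQ.M.scale_add_left sg_add A.shuf_add_right A.shuf_add_left
        Qact_add_right[abs_def] algebra_simps)
next
  show "Br p q \<alpha> \<xi> 0 \<eta> = 0" for \<eta>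
    using assms by (simp add: Br_eq AltHA_ops) (simp add: fun_ops Qact_zero_right[abs_def])
qed

text \<open>Skew-symmetry of \<open>Br\<close> turns balance in the first tensor into
  \<open>Br_balanced\<close> in the second. The identities are then carried through the inner
  \<open>ext\<close> as identities between functions.\<close>

lemma bracket_balanced:
  assumes "v \<in> AltHQ T q"
  shows "bal p (\<lambda>\<alpha> \<xi>. ext q (Br p q \<alpha> \<xi>) v)"
proof -
  have skew: "Br p q \<alpha> \<xi> \<beta> \<eta> = - sg (p * q) (Br q p \<beta> \<eta> \<alpha> \<xi>)"
    if "\<alpha> \<in> AltHA T p" "\<beta> \<in> AltHA T q" for \<alpha> \<beta> \<xi> \<eta>
    by (rule Br_skew[OF that])
  have bal: "Br q p \<beta> \<eta> (\<alpha> + \<alpha>') \<xi> = Br q p \<beta> \<eta> \<alpha> \<xi> + Br q p \<beta> \<eta> \<alpha>' \<xi>"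
    "Br q p \<beta> \<eta> \<alpha> (\<xi> + \<xi>') = Br q p \<beta> \<eta> \<alpha> \<xi> + Br q p \<beta> \<eta> \<alpha> \<xi>'"
    "Br q p \<beta> \<eta> (\<lambda>xs. a * \<alpha> xs) \<xi> = Br q p \<beta> \<eta> \<alpha> (sQ T a \<xi>)"
    "Br q p \<beta> \<eta> 0 \<xi> = 0"
    if "\<alpha> \<in> AltHA T p" "\<alpha>' \<in> AltHA T p" "\<beta> \<in> AltHA T q" for \<alpha> \<alpha>' \<beta> \<xi> \<xi>' \<eta> a
    using Br_balanced[OF that(3), of p \<eta>] that unfolding balanced_def by blast+
  show ?thesis
    unfolding balanced_def
  proof (intro conjI ballI)
    fix \<alpha> \<alpha>' \<xi> \<xi>' a
    assume a: "\<alpha> \<in> AltHA T p"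
    show "ext q (Br p q \<alpha> (\<xi> + \<xi>')) v = ext q (Br p q \<alpha> \<xi>) v + ext q (Br p q \<alpha> \<xi>') v"
      by (rule ext_fun_add[OF _ _ _ assms]) (simp_all add: Br_balanced a skew bal(2)[OF a a] sg_add)
    show "ext q (Br p q (\<lambda>xs. a * \<alpha> xs) \<xi>) v = ext q (Br p q \<alpha> (sQ T a \<xi>)) v"
      by (rule ext_fun_cong[OF _ _ assms]) (simp_all add: Br_balanced a skew bal(3)[OF a a] AltHA_ops)
    show "ext q (Br p q (\<alpha> + \<alpha>') \<xi>) v = ext q (Br p q \<alpha> \<xi>) v + ext q (Br p q \<alpha>' \<xi>) v"
      if "\<alpha>' \<in> AltHA T p"
      using that
      by (intro ext_fun_add[OF _ _ _ assms]) (simp_all add: Br_balanced a skew bal(1)[OF a that] sg_add AltHA_ops)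
  next
    fix \<xi>
    \<comment> \<open>The value at 0 equals twice itself.\<close>
    have "ext q (Br p q 0 \<xi>) v = ext q (Br p q 0 \<xi>) v + ext q (Br p q 0 \<xi>) v"
      by (rule ext_fun_add[OF _ _ _ assms]) (simp_all add: Br_balanced skew bal(4)[OF AltHA_ops(1) AltHA_ops(1)] AltHA_ops)
    then show "ext q (Br p q 0 \<xi>) v = 0"
      by simp
  qed
qed

lemma bracket_eq: "bracket p q u v = ext p (\<lambda>\<alpha> \<xi>. ext q (Br p q \<alpha> \<xi>) v) u"
  by (simp add: pair_bracket_def Br_def[abs_def])

lemma bracket_simple:
  assumes "\<alpha> \<in> AltHA T p" "\<beta> \<in> AltHA T q"
  shows "bracket p q (\<alpha> \<odot> \<xi>) (\<beta> \<odot> \<eta>) = Br p q \<alpha> \<xi> \<beta> \<eta>"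
  unfolding bracket_eq
  using ext_simple[OF bracket_balanced[OF simple_tensor_closed[OF assms(2)]] assms(1)]
    ext_simple[OF Br_balanced[OF assms(1)] assms(2)] by simp

lemma bracket_add_left:
  assumes "u \<in> AltHQ T p" "u' \<in> AltHQ T p" "v \<in> AltHQ T q"
  shows "bracket p q (u + u') v = bracket p q u v + bracket p q u' v"
  unfolding bracket_eq using ext_add[OF bracket_balanced[OF assms(3)] assms(1,2)] .

lemma bracket_add_right:
  assumes "u \<in> AltHQ T p" "v \<in> AltHQ T q" "v' \<in> AltHQ T q"
  shows "bracket p q u (v + v') = bracket p q u v + bracket p q u v'"
  unfolding bracket_eq
  by (rule ext_fun_add[OF bracket_balanced[OF assms(2)] bracket_balanced[OF assms(3)]
        bracket_balanced[OF AltHQ_ops(2)[OF assms(2,3)]] assms(1)])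
    (rule ext_add[OF Br_balanced assms(2,3)])

lemma bracket_induct [consumes 2, case_names simple add_left add_right]:
  assumes "u \<in> AltHQ T p" "v \<in> AltHQ T q"
    and simple: "\<And>\<alpha> \<xi> \<beta> \<eta>. \<alpha> \<in> AltHA T p \<Longrightarrow> \<beta> \<in> AltHA T q \<Longrightarrow> P (\<alpha> \<odot> \<xi>) (\<beta> \<odot> \<eta>)"
    and add_left: "\<And>u u' v. u \<in> AltHQ T p \<Longrightarrow> u' \<in> AltHQ T p \<Longrightarrow> v \<in> AltHQ T q \<Longrightarrow> P u v \<Longrightarrow> P u' v
      \<Longrightarrow> P (u + u') v"
    and add_right: "\<And>u v v'. u \<in> AltHQ T p \<Longrightarrow> v \<in> AltHQ T q \<Longrightarrow> v' \<in> AltHQ T q \<Longrightarrow> P u v \<Longrightarrow> P u v'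
      \<Longrightarrow> P u (v + v')"
  shows "P u v"
  using assms(1)
proof (induction u rule: AltHQ_induct)
  case (simple \<alpha> \<xi>)
  then have "\<alpha> \<odot> \<xi> \<in> AltHQ T p"
    by (rule simple_tensor_closed)
  from assms(2) show ?case
    by (induction v rule: AltHQ_induct) (use assms(3) simple add_right \<open>\<alpha> \<odot> \<xi> \<in> AltHQ T p\<close> in blast)+
qed (use add_left assms(2) in blast)

lemma bracket_closed:
  assumes "u \<in> AltHQ T p" "v \<in> AltHQ T q"
  shows "bracket p q u v \<in> AltHQ T (p + q)"
  using assms
  by (induction rule: bracket_induct)
    (simp_all add: bracket_simple Br_closed bracket_add_left bracket_add_right AltHQ_ops)

lemma bracket_skew:
  assumes "u \<in> AltHQ T p" "v \<in> AltHQ T q"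
  shows "bracket p q u v = - sg (p * q) (bracket q p v u)"
  using assms
proof (induction rule: bracket_induct)
  case (simple \<alpha> \<xi> \<beta> \<eta>)
  then show ?case
    using Br_skew[of \<alpha> p \<beta> q \<xi> \<eta>] by (simp add: bracket_simple)
qed (simp_all add: bracket_add_left bracket_add_right sg_add)

lemma bracket_form0: "bracket 0 0 (form0 \<xi>) (form0 \<eta>) = form0 (brQ T \<xi> \<eta>)"
proof -
  \<comment> \<open>Derivations annihilate 1, so only the term with the bracket of Q survives in
    degree 0.\<close>
  have "Qact \<theta> (form0 1) = (\<lambda>xs. 0)" for \<theta>
    using Qact_alt[OF AltHA_ops(7)[of 1], of \<theta>] unfolding AltHA_0[of "Qact \<theta> (form0 1)"]
    by (simp add: Qact_eq form0_def)
  then show ?thesis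
    unfolding form0_simple[of \<xi>] form0_simple[of \<eta>] form0_simple[of "brQ T \<xi> \<eta>"]
    by (simp add: bracket_simple AltHA_ops Br_eq A.shuf_form0_left)
      (simp add: simple_tensor_def fun_ops A.shuf_form0_left)
qed

lemma scale_simple: "\<alpha> \<in> AltHA T p \<Longrightarrow> \<beta> \<in> AltHA T q \<Longrightarrow>
    pair_scale T p q \<alpha> (\<beta> \<odot> \<xi>) = pair_mul p q \<alpha> \<beta> \<odot> \<xi>"
  using DM.sm_sm[of \<alpha> p \<beta> q "form0 \<xi>" 0]
  by (simp add: simple_tensor_eq[of \<beta> q] simple_tensor_eq[OF mul_closed] AltHQ_ops)

text \<open>The action of \<xi> on the product \<gamma>\<beta> has two parts: \<xi>(\<gamma>) yields
  the anchor term, and \<xi>(\<beta>) combines with the rest to the bracket multiplied by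
  \<gamma>.\<close>

lemma Br_scale:
  assumes "\<alpha> \<in> AltHA T p" "\<gamma> \<in> AltHA T r" "\<beta> \<in> AltHA T q"
  shows "Br p (r + q) \<alpha> \<xi> (pair_mul r q \<gamma> \<beta>) \<eta>
    = pair_mul (p + r) q (pair_mul p r \<alpha> (Qact \<xi> \<gamma>)) \<beta> \<odot> \<eta> + sg (p * r) (pair_scale T r (p + q) \<gamma> (Br p q \<alpha> \<xi> \<beta> \<eta>))"
proof -
  have 1: "pair_mul (p + r) q (pair_mul p r \<alpha> (Qact \<xi> \<gamma>)) \<beta> \<odot> \<eta>
      = (\<lambda>xs. sg (p * r + (p + r) * q) (sQ T (shuf (*) \<alpha> (shuf (*) (Qact \<xi> \<gamma>) \<beta>) xs) \<eta>))"
    using assms mul_closed[OF assms(1) Qact_alt[OF assms(2)], of \<xi>]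
    by (simp add: pair_mul_eq simple_tensor_def A.shuf_sg_left CQ.M.scale_sg_left sg_sg A.shuf_assoc add.commute)
  \<comment> \<open>The factor \<gamma> has to be moved past \<alpha>, which accounts for the sign
    \<open>sg (p * r)\<close> in the claim.\<close>
  have comm: "shuf (*) \<gamma> (shuf (*) \<alpha> \<delta>) xs = sg (p * r) (shuf (*) \<alpha> (shuf (*) \<gamma> \<delta>) xs)" for \<delta> xs
  proof -
    have "shuf (*) \<gamma> \<alpha> = (\<lambda>xs. sg (p * r) (shuf (*) \<alpha> \<gamma> xs))"
      using shuf_commute[OF AltHA_supp[OF assms(2)] AltHA_supp[OF assms(1)]] by (simp add: fun_eq_iff mult.commute)
    then show ?thesis
      by (simp add: A.shuf_assoc[symmetric] A.shuf_sg_left)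
  qed
  have sQ_shuf: "shuf (sQ T) \<gamma> (\<lambda>xs. sQ T (\<delta> xs) \<theta>) xs = sQ T (shuf (*) \<gamma> \<delta> xs) \<theta>" for \<delta> \<theta> xs
    using CQ.M.shuf_assoc[of \<gamma> \<delta> "form0 \<theta>" xs] by (simp add: CQ.M.shuf_form0_right[abs_def])
  show ?thesis
    unfolding 1 Br_eq[OF assms(1) mul_closed[OF assms(2,3)]] Br_eq[OF assms(1,3)] pair_scale_eq[OF assms(2)]
    by (simp add: pair_mul_eq[OF assms(2)] Qact_sg[abs_def] Qact_shuf[abs_def] A.shuf_sg_right A.shuf_sg_left
        A.shuf_add_right CQ.M.scale_add_left CQ.M.shuf_add_right CQ.M.shuf_diff_right CQ.M.shuf_sg_right
        sQ_shuf comm CQ.M.scale_sg_left A.shuf_assoc)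
      (simp add: fun_ops fun_eq_iff, simp add: sg_def)
qed

lemma pairing_scale:
  assumes "\<gamma> \<in> AltHA T r" "u \<in> AltHQ T p" "\<beta> \<in> AltHA T q"
  shows "pairing (r + p) q (pair_scale T r p \<gamma> u) \<beta> = pair_mul r (p + q) \<gamma> (pairing p q u \<beta>)"
  using assms(2)
proof (induction u rule: AltHQ_induct)
  case (simple \<alpha> \<xi>)
  with assms show ?case
    by (simp add: scale_simple pairing_simple mul_closed DG.mul_assoc Qact_alt)
next
  case (add u v)
  with assms show ?case
    using DG.mul_bilinear[of r "p + q"]
    by (simp add: DM.sm_add_right pairing_add_left scale_closed pairing_closed bilin_on_def lin_on_def)
qed

lemma bracket_scale:
  assumes "u \<in> AltHQ T p" "\<gamma> \<in> AltHA T r" "v \<in> AltHQ T q"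
  shows "bracket p (r + q) u (pair_scale T r q \<gamma> v) =
    pair_scale T (p + r) q (pairing p r u \<gamma>) v + sg (p * r) (pair_scale T r (p + q) \<gamma> (bracket p q u v))"
  using assms(1,3)
proof (induction rule: bracket_induct)
  case (simple \<alpha> \<xi> \<beta> \<eta>)
  with assms show ?case
    by (simp add: scale_simple bracket_simple mul_closed Br_scale pairing_simple Qact_alt)
next
  case (add_left u u' v)
  with assms show ?case
    by (simp add: bracket_add_left scale_closed pairing_add_left DM.sm_add_left DM.sm_add_right pairing_closed
        bracket_closed sg_add)
next
  case (add_right u v v')
  with assms show ?case
    by (simp add: bracket_add_right scale_closed DM.sm_add_right pairing_closed bracket_closed sg_add)
qed


section \<open>The induced module and the derivation rules of the pair\<close>

lemma mul_0:
  assumes "s \<in> AltHA T 0"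
  shows "pair_mul 0 n s \<alpha> = (\<lambda>xs. s [] * \<alpha> xs)"
proof -
  obtain c where s: "s = form0 c"
    using assms AltHA_0 by blast
  have "s [] = c"
    by (simp add: s form0_def)
  then show ?thesis
    unfolding pair_mul_eq[OF assms] by (simp add: s A.shuf_form0_left)
qed

lemma form0_add: "form0 (\<xi> + \<eta>) = form0 \<xi> + (form0 \<eta> :: 'h list \<Rightarrow> 'q)"
  by (auto simp: form0_def plus_fun_def)

lemma form0_scale: "form0 (sQ T a \<xi>) = pair_scale T 0 0 (form0 a) (form0 \<xi>)"
  unfolding scale_form0 by (auto simp: form0_def)

text \<open>The hypothesis concerns the tensor product with \<open>'q\<close> over
  \<open>'a\<close>, the goal the one with \<open>AltHQ T 0\<close> over \<open>AltHA T 0\<close>.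
  The maps \<phi> (evaluation at \<open>[]\<close>) and \<psi> (\<open>form0\<close>) between
  representatives are mutually inverse. Injectivity is obtained by passing to the first tensor
  product with \<phi> and transporting the resulting relation back along \<psi>.\<close>

lemma induced_pair: "bij_betw (tensor_map (pair_scale T q 0)) (DM.tensor_Q q) (AltHQ T q)"
proof -
  interpret I: tensor_iso UNIV "\<lambda>a \<alpha> xs. a * \<alpha> xs" "AltHA T q" "sQ T" UNIV "simple_tensor T" "AltHQ T q"
    by (rule tensor_iso_pair)
  let ?M = "AltHA T q" and ?t = "pair_scale T q 0"
  let ?rel = "tensor_rel (AltHA T 0) (pair_mul 0 q) ?M (pair_scale T 0 0) (AltHQ T 0)"
  let ?cls = "\<lambda>z. {(z, w). ?rel z w} `` {z}"
  let ?\<phi> = "image_mset (map_prod id (\<lambda>u. u [])) :: (('h list \<Rightarrow> 'a) \<times> ('h list \<Rightarrow> 'q)) multiset \<Rightarrow> _"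
  let ?\<psi> = "image_mset (map_prod id form0) :: (('h list \<Rightarrow> 'a) \<times> 'q) multiset \<Rightarrow> _"
  have bal: "balanced (AltHA T 0) (pair_mul 0 q) ?M (pair_scale T 0 0) (AltHQ T 0) ?t"
    unfolding balanced_def
  proof (intro conjI ballI)
    fix s m n
    assume *: "s \<in> AltHA T 0" "m \<in> ?M" "n \<in> AltHQ T 0"
    show "?t (pair_mul 0 q s m) n = ?t m (pair_scale T 0 0 s n)"
      using DG.mul_commute[OF *(1,2)] DM.sm_sm[OF *(2,1,3)] by simp
  next
    fix n assume "n \<in> AltHQ T 0"
    then show "?t 0 n = 0"
      using DM.sm_add_left[of 0 q 0 n 0] by (simp add: AltHA_ops)
  qed (simp_all add: DM.sm_add_left DM.sm_add_right)
  have t: "?t \<alpha> u = \<alpha> \<odot> u []" if "\<alpha> \<in> ?M" "u \<in> AltHQ T 0" for \<alpha> u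
    unfolding simple_tensor_eq[OF that(1)] using that(2)[unfolded AltHQ_0] by (rule arg_cong)
  have \<phi>: "set_mset (?\<phi> z) \<subseteq> ?M \<times> UNIV" "tensor_sum ?t z = tensor_sum (simple_tensor T) (?\<phi> z)" "?\<psi> (?\<phi> z) = z"
    if "set_mset z \<subseteq> ?M \<times> AltHQ T 0" for z
  proof -
    show "set_mset (?\<phi> z) \<subseteq> ?M \<times> UNIV"
      using that by auto
    show "tensor_sum ?t z = tensor_sum (simple_tensor T) (?\<phi> z)"
      using that
      by (auto simp: image_mset.compositionality comp_def t case_prod_unfold
          intro!: arg_cong[of _ _ sum_mset] image_mset_cong)
    have "image_mset (\<lambda>p. map_prod id form0 (map_prod id (\<lambda>u. u []) p)) z = image_mset (\<lambda>p. p) z"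
      using that AltHQ_0 by (intro image_mset_cong) (auto simp: map_prod_def case_prod_unfold prod_eq_iff)
    then show "?\<psi> (?\<phi> z) = z"
      by (simp add: image_mset.compositionality comp_def)
  qed
  have \<psi>: "set_mset (?\<psi> z) \<subseteq> ?M \<times> AltHQ T 0" if "set_mset z \<subseteq> ?M \<times> UNIV" for z
    using that by (auto simp: AltHQ_ops)
  have \<phi>\<psi>: "?\<phi> (?\<psi> z) = z" for z
    by (simp add: image_mset.compositionality comp_def map_prod_def case_prod_unfold form0_def)
  have tensor: "DM.tensor_Q q = ?cls ` {z. set_mset z \<subseteq> ?M \<times> AltHQ T 0}"
    by (auto simp: DM.tensor_Q_def tensor_def quotient_def)
  have map_cls: "tensor_map ?t (?cls z) = tensor_sum (simple_tensor T) (?\<phi> z)"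
    if "set_mset z \<subseteq> ?M \<times> AltHQ T 0" for z
    using tensor_map_class[OF bal that] \<phi>(2)[OF that] by simp
  show ?thesis
    unfolding bij_betw_def
  proof
    show "inj_on (tensor_map ?t) (DM.tensor_Q q)"
      unfolding tensor
    proof (rule inj_onI, elim imageE)
      fix C D z w
      assume CD: "C = ?cls z" "D = ?cls w" "tensor_map ?t C = tensor_map ?t D"
        and zw: "z \<in> {z. set_mset z \<subseteq> ?M \<times> AltHQ T 0}" "w \<in> {z. set_mset z \<subseteq> ?M \<times> AltHQ T 0}"
      then have "tensor_sum (simple_tensor T) (?\<phi> z) = tensor_sum (simple_tensor T) (?\<phi> w)"
        using map_cls by simp
      then have "tensor_rel UNIV (\<lambda>a \<alpha> xs. a * \<alpha> xs) ?M (sQ T) UNIV (?\<phi> z) (?\<phi> w)"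
        using I.sum_eqD[OF \<phi>(1) \<phi>(1)] zw by blast
      then have "?rel (?\<psi> (?\<phi> z)) (?\<psi> (?\<phi> w))"
      proof (rule tensor_rel_image[where k = form0])
        show "form0 (\<xi> + \<eta>) = form0 \<xi> + (form0 \<eta> :: 'h list \<Rightarrow> 'q)" for \<xi> \<eta>
          by (rule form0_add)
        show "form0 (sQ T s \<xi>) = pair_scale T 0 0 (form0 s) (form0 \<xi>)" for s \<xi>
          by (rule form0_scale)
        show "id (\<lambda>xs. s * \<alpha> xs) = pair_mul 0 q (form0 s) (id \<alpha>)" for s and \<alpha> :: "'h list \<Rightarrow> 'a"
          by (simp add: pair_mul_eq AltHA_ops A.shuf_form0_left)
      qed (simp_all add: AltHA_ops AltHQ_ops)
      then have rel: "?rel z w"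
        using \<phi>(3) zw by simp
      then have "?rel w z"
        by (rule tensor_rel.sym)
      with rel have "?cls z = ?cls w"
        by (auto intro: tensor_rel.trans)
      with CD show "C = D"
        by simp
    qed
    show "tensor_map ?t ` DM.tensor_Q q = AltHQ T q"
    proof (intro equalityI subsetI)
      fix u assume "u \<in> tensor_map ?t ` DM.tensor_Q q"
      then obtain z where "set_mset z \<subseteq> ?M \<times> AltHQ T 0" "u = tensor_map ?t (?cls z)"
        unfolding tensor by blast
      then show "u \<in> AltHQ T q"
        using I.sum_in[OF \<phi>(1)] map_cls by metis
    next
      fix u assume "u \<in> AltHQ T q"
      then obtain z where z: "set_mset z \<subseteq> ?M \<times> UNIV" "u = tensor_sum (simple_tensor T) z"
        by (rule I.sum_exists)
      then have "u = tensor_map ?t (?cls (?\<psi> z))"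
        using map_cls[OF \<psi>[OF z(1)]] by (simp add: \<phi>\<psi>)
      moreover have "?cls (?\<psi> z) \<in> DM.tensor_Q q"
        unfolding tensor using \<psi>[OF z(1)] by blast
      ultimately show "u \<in> tensor_map ?t ` DM.tensor_Q q"
        by blast
    qed
  qed
qed

lemma mul_add_left: "\<alpha> \<in> AltHA T p \<Longrightarrow> \<alpha>' \<in> AltHA T p \<Longrightarrow> \<beta> \<in> AltHA T q \<Longrightarrow>
    pair_mul p q (\<alpha> + \<alpha>') \<beta> = pair_mul p q \<alpha> \<beta> + pair_mul p q \<alpha>' \<beta>"
  and mul_add_right: "\<alpha> \<in> AltHA T p \<Longrightarrow> \<beta> \<in> AltHA T q \<Longrightarrow> \<beta>' \<in> AltHA T q \<Longrightarrow>
    pair_mul p q \<alpha> (\<beta> + \<beta>') = pair_mul p q \<alpha> \<beta> + pair_mul p q \<alpha> \<beta>'"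
  using DG.mul_bilinear[of p q] by (auto simp: bilin_on_def lin_on_def)

lemma Qact_mul:
  assumes "\<alpha> \<in> AltHA T p"
  shows "Qact \<xi> (pair_mul p q \<alpha> \<beta>) = pair_mul p q (Qact \<xi> \<alpha>) \<beta> + pair_mul p q \<alpha> (Qact \<xi> \<beta>)"
  using assms by (simp add: pair_mul_eq Qact_alt fun_ops Qact_sg[abs_def] Qact_shuf[abs_def] sg_add)

lemma mul_left_commute:
  assumes "\<alpha> \<in> AltHA T p" "\<beta> \<in> AltHA T q" "\<gamma> \<in> AltHA T r"
  shows "pair_mul p (q + r) \<alpha> (pair_mul q r \<beta> \<gamma>) = sg (p * q) (pair_mul q (p + r) \<beta> (pair_mul p r \<alpha> \<gamma>))"
proof -
  have "pair_mul p (q + r) \<alpha> (pair_mul q r \<beta> \<gamma>) = pair_mul (p + q) r (sg (p * q) (pair_mul q p \<beta> \<alpha>)) \<gamma>"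
    using assms by (simp add: DG.mul_assoc[symmetric] DG.mul_commute[of \<alpha> p \<beta> q])
  also have "\<dots> = sg (p * q) (pair_mul (q + p) r (pair_mul q p \<beta> \<alpha>) \<gamma>)"
  proof -
    have "pair_mul q p \<beta> \<alpha> \<in> AltHA T (p + q)"
      using mul_closed[OF assms(2,1)] by (simp add: add.commute)
    then show ?thesis
      by (simp add: pair_mul_eq AltHA_ops add.commute[of q p]) (simp add: fun_ops A.shuf_sg_left sg_sg add.commute)
  qed
  also have "\<dots> = sg (p * q) (pair_mul q (p + r) \<beta> (pair_mul p r \<alpha> \<gamma>))"
    using assms by (simp add: DG.mul_assoc)
  finally show ?thesis .
qed

lemma pairing_mul:
  assumes "u \<in> AltHQ T p" "\<beta> \<in> AltHA T q" "\<gamma> \<in> AltHA T r"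
  shows "pairing p (q + r) u (pair_mul q r \<beta> \<gamma>) = pair_mul (p + q) r (pairing p q u \<beta>) \<gamma>
    + sg (p * q) (pair_mul q (p + r) \<beta> (pairing p r u \<gamma>))"
  using assms(1)
proof (induction u rule: AltHQ_induct)
  case (simple \<alpha> \<xi>)
  with assms show ?case
    using mul_left_commute[OF simple assms(2) Qact_alt[OF assms(3), of \<xi>]]
    by (simp add: pairing_simple mul_closed Qact_mul mul_add_right Qact_alt DG.mul_assoc)
next
  case (add u v)
  with assms show ?case
    by (simp add: pairing_add_left mul_closed pairing_closed mul_add_left mul_add_right sg_add)
qed

lemma ctr_closed: "\<alpha> \<in> AltHA T q \<Longrightarrow> ctr x \<alpha> \<in> AltHA T (q - 1)"
  by (cases q) (auto simp: AltHA_def alt_ctr alt_0 supp_0_ctr supp_def)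

text \<open>The twist p * q in the product moves the sign of an antiderivation from the second
  summand to the first. In degree 0 contractions are zero, so the truncated p - 1 and q - 1 do no
  harm.\<close>

lemma ctr_mul:
  assumes "\<beta> \<in> AltHA T p" "\<alpha> \<in> AltHA T q"
  shows "ctr x (pair_mul p q \<beta> \<alpha>) = sg q (pair_mul (p - 1) q (ctr x \<beta>) \<alpha>) + pair_mul p (q - 1) \<beta> (ctr x \<alpha>)"
proof -
  have "ctr x (pair_mul p q \<beta> \<alpha>)
      = (\<lambda>xs. sg (p * q) (shuf (*) (ctr x \<beta>) \<alpha> xs) + sg (p * q + p) (shuf (*) \<beta> (ctr x \<alpha>) xs))"
    by (simp add: pair_mul_eq[OF assms(1)] parity_supp[OF AltHA_supp[OF assms(1)]] A.shuf_sg_left sg_add sg_sg)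
  also have "(\<lambda>xs. sg (p * q) (shuf (*) (ctr x \<beta>) \<alpha> xs)) = sg q (pair_mul (p - 1) q (ctr x \<beta>) \<alpha>)"
  proof (cases p)
    case 0
    with AltHA_supp[OF assms(1)] have "ctr x \<beta> = (\<lambda>ys. 0)"
      by (simp add: supp_0_ctr)
    moreover from this have "(\<lambda>ys. 0) \<in> AltHA T (p - 1)"
      using ctr_closed[OF assms(1), of x] by simp
    ultimately show ?thesis
      by (simp add: pair_mul_eq fun_ops)
  next
    case (Suc n)
    with ctr_closed[OF assms(1), of x] show ?thesis
      by (simp add: pair_mul_eq fun_ops sg_sg sg_minus)
  qed
  also have "(\<lambda>xs. sg (p * q + p) (shuf (*) \<beta> (ctr x \<alpha>) xs)) = pair_mul p (q - 1) \<beta> (ctr x \<alpha>)"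
  proof (cases q)
    case 0
    with AltHA_supp[OF assms(2)] have "ctr x \<alpha> = (\<lambda>ys. 0)"
      by (simp add: supp_0_ctr)
    then show ?thesis
      by (simp add: pair_mul_eq[OF assms(1)])
  next
    case (Suc n)
    then show ?thesis
      by (simp add: pair_mul_eq[OF assms(1)]) (auto simp: sg_def)
  qed
  finally show ?thesis
    by (simp add: fun_ops)
qed

text \<open>After the preceding lemmas mainly the R-bilinearity of bracket and pairing and the
  linearity of the triple operation remain.\<close>

lemma pre_quasi: "pre_quasi_lie_rinehart (pair_rscale T) (AltHA T) pair_mul (form0 1) dA
    (AltHQ T) (pair_scale T) dM (bracket) (pairing) (pair_tri T)"
proof
  show "bij_betw (tensor_map (pair_scale T q 0)) (DM.tensor_Q q) (AltHQ T q)" for q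
    by (rule induced_pair)
next
  fix p q
  \<comment> \<open>Elements of Q annihilate the image of R in A, so the anchor term of
    \<open>bracket_scale\<close> disappears for such scalars.\<close>
  have R: "bracket p q u (pair_scale T 0 q (form0 (rsc T r 1)) v)
      = pair_scale T 0 (p + q) (form0 (rsc T r 1)) (bracket p q u v)"
    if "u \<in> AltHQ T p" "v \<in> AltHQ T q" for u v r p q
  proof -
    have 1: "Qact \<xi> (form0 (rsc T r 1)) = (\<lambda>xs. 0)" for \<xi>
      using Qact_alt[OF AltHA_ops(7)[of "rsc T r 1"], of \<xi>] unfolding AltHA_0[of "Qact _ _"]
      by (simp add: Qact_eq form0_def)
    have "pairing p 0 u (form0 (rsc T r 1)) = 0"
      using that(1)
    proof (induction u rule: AltHQ_induct)
      case (simple \<alpha> \<xi>)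
      then show ?case
        by (simp add: pairing_simple AltHA_ops pair_mul_eq 1) (simp add: fun_ops)
    qed (simp add: pairing_add_left AltHA_ops)
    moreover have "pair_scale T p q 0 v = 0"
      using DM.sm_add_left[of 0 p 0 v q] that AltHA_ops(1) by simp
    ultimately show ?thesis
      using bracket_scale[OF that(1) AltHA_ops(7) that(2), of "rsc T r 1"] by simp
  qed
  \<comment> \<open>The first variable follows from the second by skew-symmetry.\<close>
  have L: "bracket p q (pair_scale T 0 p (form0 (rsc T r 1)) u) v
      = pair_scale T 0 (p + q) (form0 (rsc T r 1)) (bracket p q u v)"
    if "u \<in> AltHQ T p" "v \<in> AltHQ T q" for u v r
  proof -
    have "pair_scale T 0 p (form0 (rsc T r 1)) u \<in> AltHQ T p"
      using scale_closed[OF AltHA_ops(7) that(1)] by simp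
    then show ?thesis
      using R[OF that(2,1)] bracket_skew[OF that] bracket_skew[of "pair_scale T 0 p (form0 (rsc T r 1)) u" p v q] that(2)
      by (simp add: scale_form0 fun_ops CQ.M.scale_sg_right CQ.M.scale_minus_right)
  qed
  show "bilin_on UNIV (AltHQ T p) (AltHQ T q) (DM.rQ_mod p) (DM.rQ_mod q) (DM.rQ_mod (p + q)) (bracket p q)"
    unfolding bilin_on_def lin_on_def rscale_form0
    using L R by (simp add: bracket_add_left bracket_add_right)
next
  fix p q
  have R: "pairing p q u (pair_rscale T r \<beta>) = pair_rscale T r (pairing p q u \<beta>)"
    if "u \<in> AltHQ T p" "\<beta> \<in> AltHA T q" for u \<beta> r
    using that(1)
  proof (induction u rule: AltHQ_induct)
    case (simple \<alpha> \<xi>)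
    with that show ?case
      by (simp add: pairing_simple AltHA_ops pair_mul_eq)
        (simp add: rscale_eq Qact_scale_right[abs_def] A.shuf_scale_right A.scale_sg_right)
  next
    case (add u v)
    with that show ?case
      by (simp add: pairing_add_left AltHA_ops) (simp add: rscale_eq plus_fun_def A.scale_add_right)
  qed
  have L: "pairing p q (pair_scale T 0 p (form0 (rsc T r 1)) u) \<beta> = pair_rscale T r (pairing p q u \<beta>)"
    if "u \<in> AltHQ T p" "\<beta> \<in> AltHA T q" for u \<beta> r
    using pairing_scale[OF AltHA_ops(7) that, of "rsc T r 1"]
    by (simp add: pair_mul_eq AltHA_ops A.shuf_form0_left rscale_eq)
  show "bilin_on UNIV (AltHQ T p) (AltHA T q) (DM.rQ_mod p) (pair_rscale T) (pair_rscale T) (pairing p q)"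
    unfolding bilin_on_def lin_on_def rscale_form0
    using L R by (simp add: pairing_add_left pairing_add_right)
next
  fix \<xi> \<eta> a q
  assume *: "\<xi> \<in> AltHQ T 0" "\<eta> \<in> AltHQ T 0" "a \<in> AltHA T q"
  show "pair_tri T q \<xi> \<eta> a \<in> AltHA T (q - 1)"
    using ctr_closed[OF *(3)] by (simp add: pair_tri_def)
next
  fix \<xi> \<eta> a
  assume "a \<in> AltHA T 0"
  then show "pair_tri T 0 \<xi> \<eta> a = 0"
    by (simp add: pair_tri_def AltHA_def alt_0 supp_0_ctr zero_fun_def)
next
  fix \<eta> a q
  assume *: "a \<in> AltHA T q"
  have s: "(pair_scale T 0 0 s u) [] = sQ T (s []) (u [])" if "s \<in> AltHA T 0" for s u
    using that by (simp add: pair_scale_eq)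
  have add: "a ((x + y) # xs) = a (x # xs) + a (y # xs)" and scale: "a (sH T c x # xs) = c * a (x # xs)" for x y xs c
    using * additive.add[OF AltHA_head[of a q]] CA.alt_scale_head[of a q]
    by (simp_all add: AltHA_def)
  show "lin_on (AltHA T 0) (AltHQ T 0) (pair_scale T 0 0) (pair_mul 0 (q - 1)) (\<lambda>\<xi>. pair_tri T q \<xi> \<eta> a)"
    unfolding lin_on_def
    by (simp add: s mul_0 pair_tri_def plus_fun_def dlt_scale scale adds add)
  show "lin_on (AltHA T 0) (AltHQ T 0) (pair_scale T 0 0) (pair_mul 0 (q - 1)) (\<lambda>\<xi>. pair_tri T q \<eta> \<xi> a)"
    unfolding lin_on_def
    by (simp add: s mul_0 pair_tri_def plus_fun_def dlt_scale scale adds add)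
next
  fix \<xi> \<eta> q
  show "lin_on (AltHA T 0) (AltHA T q) (pair_mul 0 q) (pair_mul 0 (q - 1)) (pair_tri T q \<xi> \<eta>)"
    unfolding lin_on_def by (simp add: mul_0 pair_tri_def plus_fun_def)
next
  fix \<xi> a q
  assume "a \<in> AltHA T q"
  then show "pair_tri T q \<xi> \<xi> a = 0"
    using additive.zero[OF AltHA_head[of a q]]
    by (simp add: pair_tri_def dlt_self AltHA_def fun_ops)
next
  fix \<xi> \<eta> b a p q
  assume *: "b \<in> AltHA T p" "a \<in> AltHA T q"
  show "pair_tri T (p + q) \<xi> \<eta> (pair_mul p q b a)
      = sg q (pair_mul (p - 1) q (pair_tri T p \<xi> \<eta> b) a) + pair_mul p (q - 1) b (pair_tri T q \<xi> \<eta> a)"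
    unfolding pair_tri_def by (rule ctr_mul[OF *])
qed (rule bracket_closed pairing_closed pairing_scale bracket_scale pairing_mul bracket_skew; assumption)+

end

section \<open>Reduction to generators\<close>

lemma add_subgroupD:
  assumes "add_subgroup X"
  shows "0 \<in> X" "x \<in> X \<Longrightarrow> y \<in> X \<Longrightarrow> x + y \<in> X" "x \<in> X \<Longrightarrow> - x \<in> X" "x \<in> X \<Longrightarrow> sg n x \<in> X"
  using assms by (auto simp: add_subgroup_def sg_def)

lemma lin_on_subgroup:
  fixes f :: "'x::ab_group_add \<Rightarrow> 'y::ab_group_add"
  assumes "add_subgroup X" "lin_on S X sx sy f"
  shows "f 0 = 0" "x \<in> X \<Longrightarrow> y \<in> X \<Longrightarrow> f (x + y) = f x + f y" "x \<in> X \<Longrightarrow> f (- x) = - f x"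
    "x \<in> X \<Longrightarrow> f (sg n x) = sg n (f x)"
proof -
  show add: "x \<in> X \<Longrightarrow> y \<in> X \<Longrightarrow> f (x + y) = f x + f y" for x y
    using assms by (simp add: lin_on_def)
  show 0: "f 0 = 0"
    using add[of 0 0] assms by (simp add: add_subgroup_def)
  show "x \<in> X \<Longrightarrow> f (- x) = - f x" for x
    using add[of x "- x"] 0 assms by (simp add: add_subgroup_def eq_neg_iff_add_eq_0 add.commute)
  then show "x \<in> X \<Longrightarrow> f (sg n x) = sg n (f x)"
    by (simp add: sg_def)
qed

context pre_quasi_lie_rinehart
begin

lemmas A_ops = add_subgroupD[OF A_subgroup]
  and Q_ops = add_subgroupD[OF Q_subgroup]

lemma mul_lin: "b \<in> A q \<Longrightarrow> lin_on UNIV (A p) rsc rsc (\<lambda>a. mul p q a b)"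
  "a \<in> A p \<Longrightarrow> lin_on UNIV (A q) rsc rsc (mul p q a)"
  using mul_bilinear[of p q] by (auto simp: bilin_on_def)

lemma pair_lin: "b \<in> A q \<Longrightarrow> lin_on UNIV (Q p) (rQ_mod p) rsc (\<lambda>u. pair p q u b)"
  "u \<in> Q p \<Longrightarrow> lin_on UNIV (A q) rsc rsc (pair p q u)"
  using pair_bilinear[of p q] by (auto simp: bilin_on_def)

lemma br_lin: "v \<in> Q q \<Longrightarrow> lin_on UNIV (Q p) (rQ_mod p) (rQ_mod (p + q)) (\<lambda>u. br p q u v)"
  "u \<in> Q p \<Longrightarrow> lin_on UNIV (Q q) (rQ_mod q) (rQ_mod (p + q)) (br p q u)"
  using br_bilinear[of p q] by (auto simp: bilin_on_def)

lemma sm_lin: "u \<in> Q q \<Longrightarrow> lin_on {} (A p) (\<lambda>_. id) (\<lambda>_. id) (\<lambda>a. sm p q a u)"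
  "a \<in> A p \<Longrightarrow> lin_on {} (Q q) (\<lambda>_. id) (\<lambda>_. id) (sm p q a)"
  by (auto simp: lin_on_def sm_add_left sm_add_right)

lemmas mul_ops = lin_on_subgroup[OF A_subgroup mul_lin(1)] lin_on_subgroup[OF A_subgroup mul_lin(2)]
  and pair_ops = lin_on_subgroup[OF Q_subgroup pair_lin(1)] lin_on_subgroup[OF A_subgroup pair_lin(2)]
  and br_ops = lin_on_subgroup[OF Q_subgroup br_lin(1)] lin_on_subgroup[OF Q_subgroup br_lin(2)]
  and sm_ops = lin_on_subgroup[OF A_subgroup sm_lin(1)] lin_on_subgroup[OF Q_subgroup sm_lin(2)]
  and d_ops = lin_on_subgroup[OF A_subgroup d_linear]
  and dQ_ops = lin_on_subgroup[OF Q_subgroup dQ_linear]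

lemma tensor_iso_Q: "tensor_iso (A 0) (mul 0 q) (A q) (sm 0 0) (Q 0) (sm q 0) (Q q)"
proof
  show "bij_betw (tensor_map (sm q 0)) (tensor (A 0) (mul 0 q) (A q) (sm 0 0) (Q 0)) (Q q)"
    using induced by (simp add: tensor_Q_def)
  show "balanced (A 0) (mul 0 q) (A q) (sm 0 0) (Q 0) (sm q 0)"
    unfolding balanced_def
  proof (intro conjI ballI)
    fix s m n
    assume *: "s \<in> A 0" "m \<in> A q" "n \<in> Q 0"
    show "sm q 0 (mul 0 q s m) n = sm q 0 m (sm 0 0 s n)"
      using mul_commute[OF *(1,2)] sm_sm[OF *(2,1,3)] by simp
  qed (simp_all add: sm_add_left sm_add_right sm_ops)
qed

lemmas Q_induct [consumes 1, case_names zero simple add] = tensor_iso.induct[OF tensor_iso_Q]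
  and extended_simple = tensor_iso.along_iso_simple[OF tensor_iso_Q, folded tensor_Q_def]
  and extended_add = tensor_iso.along_iso_add[OF tensor_iso_Q, folded tensor_Q_def]

text \<open>For a product b \<xi> both the pairing and its differential are governed by Leibniz
  rules, and the terms containing d b agree on the two sides. What remains is b times the identity
  for \<xi>.\<close>

lemma d_pair_generators:
  assumes gen: "\<And>\<xi> a q. \<xi> \<in> Q 0 \<Longrightarrow> a \<in> A q \<Longrightarrow>
      d q (pair 0 q \<xi> a) = pair 1 q (dQ 0 \<xi>) a + pair 0 (q + 1) \<xi> (d q a)"
    and u: "u \<in> Q p" and a: "a \<in> A q"
  shows "d (p + q) (pair p q u a) = pair (p + 1) q (dQ p u) a + sg p (pair p (q + 1) u (d q a))"
  using u
proof (induction u rule: Q_induct)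
  case zero
  show ?case
    using a d_closed[OF a] by (simp add: dQ_ops pair_ops d_ops)
next
  case (add u v)
  then show ?case
    using a d_closed[OF a] pair_closed[OF add(1) a] pair_closed[OF add(2) a]
      dQ_closed[OF add(1)] dQ_closed[OF add(2)]
    by (simp add: dQ_ops pair_ops d_ops sg_add)
next
  case (simple b \<xi>)
  have dx: "dQ 0 \<xi> \<in> Q 1"
    using dQ_closed[OF simple(2)] by simp
  have p: "pair 0 q \<xi> a \<in> A q" "pair 1 q (dQ 0 \<xi>) a \<in> A (q + 1)" "pair 0 (q + 1) \<xi> (d q a) \<in> A (q + 1)"
    using pair_closed[OF simple(2) a] pair_closed[OF dx a] pair_closed[OF simple(2) d_closed[OF a]] by simp_all
  have "d (p + q) (pair p q (sm p 0 b \<xi>) a) = d (p + q) (mul p q b (pair 0 q \<xi> a))"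
    using pair_sm[OF simple a] by simp
  also have "\<dots> = mul (p + 1) q (d p b) (pair 0 q \<xi> a) + sg p (mul p (q + 1) b (d q (pair 0 q \<xi> a)))"
    using d_mul[OF simple(1) p(1)] .
  also have "mul p (q + 1) b (d q (pair 0 q \<xi> a))
      = mul p (q + 1) b (pair 1 q (dQ 0 \<xi>) a) + mul p (q + 1) b (pair 0 (q + 1) \<xi> (d q a))"
    unfolding gen[OF simple(2) a] using mul_ops(6)[OF simple(1) p(2,3)] .
  also have "mul (p + 1) q (d p b) (pair 0 q \<xi> a) = pair (p + 1) q (sm (p + 1) 0 (d p b) \<xi>) a"
    using pair_sm[OF d_closed[OF simple(1)] simple(2) a] by simp
  also have "mul p (q + 1) b (pair 1 q (dQ 0 \<xi>) a) = pair (p + 1) q (sm p 1 b (dQ 0 \<xi>)) a"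
    using pair_sm[OF simple(1) dx a] by simp
  also have "mul p (q + 1) b (pair 0 (q + 1) \<xi> (d q a)) = pair p (q + 1) (sm p 0 b \<xi>) (d q a)"
    using pair_sm[OF simple d_closed[OF a]] by simp
  finally have *: "d (p + q) (pair p q (sm p 0 b \<xi>) a) = pair (p + 1) q (sm (p + 1) 0 (d p b) \<xi>) a
      + sg p (pair (p + 1) q (sm p 1 b (dQ 0 \<xi>)) a + pair p (q + 1) (sm p 0 b \<xi>) (d q a))" .
  have sm: "sm (p + 1) 0 (d p b) \<xi> \<in> Q (p + 1)" "sm p 1 b (dQ 0 \<xi>) \<in> Q (p + 1)"
    using sm_closed[OF d_closed[OF simple(1)] simple(2)] sm_closed[OF simple(1) dx] by simp_all
  have "dQ p (sm p 0 b \<xi>) = sm (p + 1) 0 (d p b) \<xi> + sg p (sm p 1 b (dQ 0 \<xi>))"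
    using dQ_sm[OF simple] by simp
  then have "pair (p + 1) q (dQ p (sm p 0 b \<xi>)) a
      = pair (p + 1) q (sm (p + 1) 0 (d p b) \<xi>) a + sg p (pair (p + 1) q (sm p 1 b (dQ 0 \<xi>)) a)"
    using pair_ops(2)[OF a sm(1) Q_ops(4)[OF sm(2)]] pair_ops(4)[OF a sm(2)] by simp
  with * show ?case
    by (simp only: sg_add add.assoc)
qed

text \<open>The element \<open>u\<close> stays fixed while \<open>v\<close> is reduced to
  generators. Since the bracket of u with a \<eta> contains u(a) \<eta>, compatibility of the
  pairing with the differentials is needed for this \<open>u\<close>.\<close>

lemma dQ_br_right:
  assumes d_pair: "\<And>a q. a \<in> A q \<Longrightarrow>
      d (p + q) (pair p q u a) = pair (p + 1) q (dQ p u) a + sg p (pair p (q + 1) u (d q a))"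
    and gen: "\<And>\<eta>. \<eta> \<in> Q 0 \<Longrightarrow> dQ p (br p 0 u \<eta>) = br (p + 1) 0 (dQ p u) \<eta> + sg p (br p 1 u (dQ 0 \<eta>))"
    and u: "u \<in> Q p" and v: "v \<in> Q q"
  shows "dQ (p + q) (br p q u v) = br (p + 1) q (dQ p u) v + sg p (br p (q + 1) u (dQ q v))"
  using v
proof (induction v rule: Q_induct)
  case zero
  show ?case
    using u dQ_closed[OF u] by (simp add: dQ_ops br_ops)
next
  case (add v w)
  then show ?case
    using u dQ_closed[OF u] br_closed[OF u add(1)] br_closed[OF u add(2)]
      dQ_closed[OF add(1)] dQ_closed[OF add(2)]
    by (simp add: dQ_ops br_ops sg_add)
next
  case (simple a \<eta>)
  note du = dQ_closed[OF u]
  have dn: "dQ 0 \<eta> \<in> Q 1"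
    using dQ_closed[OF simple(2)] by simp
  have ua: "pair p q u a \<in> A (p + q)"
    by (rule pair_closed[OF u simple(1)])
  have un: "br p 0 u \<eta> \<in> Q p"
    using br_closed[OF u simple(2)] by simp
  have dun: "br (p + 1) 0 (dQ p u) \<eta> \<in> Q (p + 1)" "br p 1 u (dQ 0 \<eta>) \<in> Q (p + 1)"
    using br_closed[OF du simple(2)] br_closed[OF u dn] by simp_all
  have dua: "pair (p + 1) q (dQ p u) a \<in> A (p + q + 1)" "pair p (q + 1) u (d q a) \<in> A (p + q + 1)"
    using pair_closed[OF du simple(1)] pair_closed[OF u d_closed[OF simple(1)]] by simp_all
  \<comment> \<open>Every expansion below is a signed combination of these six terms: each of the
    two summands of the bracket with a \<eta> is differentiated by the Leibniz rule and the
    assumption on generators, giving three terms apiece.\<close>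
  define X1 where "X1 = sm (p + q + 1) 0 (pair (p + 1) q (dQ p u) a) \<eta>"
  define X2 where "X2 = sm (p + q + 1) 0 (pair p (q + 1) u (d q a)) \<eta>"
  define X3 where "X3 = sm (p + q) 1 (pair p q u a) (dQ 0 \<eta>)"
  define X4 where "X4 = sm (q + 1) p (d q a) (br p 0 u \<eta>)"
  define X5 where "X5 = sm q (p + 1) a (br (p + 1) 0 (dQ p u) \<eta>)"
  define X6 where "X6 = sm q (p + 1) a (br p 1 u (dQ 0 \<eta>))"
  have br_sm': "br p q u (sm q 0 a \<eta>) = sm (p + q) 0 (pair p q u a) \<eta> + sg (p * q) (sm q p a (br p 0 u \<eta>))"
    using br_sm[OF u simple] by simp
  have 1: "dQ (p + q) (sm (p + q) 0 (pair p q u a) \<eta>) = X1 + sg p X2 + sg (p + q) X3"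
  proof -
    have "dQ (p + q) (sm (p + q) 0 (pair p q u a) \<eta>)
        = sm (p + q + 1) 0 (d (p + q) (pair p q u a)) \<eta> + sg (p + q) X3"
      using dQ_sm[OF ua simple(2)] by (simp add: X3_def)
    also have "sm (p + q + 1) 0 (d (p + q) (pair p q u a)) \<eta> = X1 + sg p X2"
      unfolding d_pair[OF simple(1)]
      using sm_ops(2)[OF simple(2) dua(1) A_ops(4)[OF dua(2)]] sm_ops(4)[OF simple(2) dua(2)]
      by (simp add: X1_def X2_def)
    finally show ?thesis .
  qed
  have 2: "dQ (p + q) (sm q p a (br p 0 u \<eta>)) = X4 + sg q (X5 + sg p X6)"
  proof -
    have "dQ (p + q) (sm q p a (br p 0 u \<eta>)) = X4 + sg q (sm q (p + 1) a (dQ p (br p 0 u \<eta>)))"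
      using dQ_sm[OF simple(1) un] by (simp add: X4_def add.commute)
    also have "sm q (p + 1) a (dQ p (br p 0 u \<eta>)) = X5 + sg p X6"
      unfolding gen[OF simple(2)]
      using sm_ops(6)[OF simple(1) dun(1) Q_ops(4)[OF dun(2)]] sm_ops(8)[OF simple(1) dun(2)]
      by (simp add: X5_def X6_def)
    finally show ?thesis .
  qed
  have 3: "br (p + 1) q (dQ p u) (sm q 0 a \<eta>) = X1 + sg ((p + 1) * q) X5"
    using br_sm[OF du simple] by (simp add: X1_def X5_def)
  have 4: "br p (q + 1) u (sm (q + 1) 0 (d q a) \<eta>) = X2 + sg (p * (q + 1)) X4"
    using br_sm[OF u d_closed[OF simple(1)] simple(2)] by (simp add: X2_def X4_def)
  have 5: "br p (q + 1) u (sm q 1 a (dQ 0 \<eta>)) = X3 + sg (p * q) X6"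
    using br_sm[OF u simple(1) dn] by (simp add: X3_def X6_def)
  have 6: "br p (q + 1) u (dQ q (sm q 0 a \<eta>)) = X2 + sg (p * (q + 1)) X4 + sg q (X3 + sg (p * q) X6)"
  proof -
    have sm: "sm (q + 1) 0 (d q a) \<eta> \<in> Q (q + 1)" "sm q 1 a (dQ 0 \<eta>) \<in> Q (q + 1)"
      using sm_closed[OF d_closed[OF simple(1)] simple(2)] sm_closed[OF simple(1) dn] by simp_all
    have "dQ q (sm q 0 a \<eta>) = sm (q + 1) 0 (d q a) \<eta> + sg q (sm q 1 a (dQ 0 \<eta>))"
      using dQ_sm[OF simple] by simp
    then show ?thesis
      using br_ops(6)[OF u sm(1) Q_ops(4)[OF sm(2)]] br_ops(8)[OF u sm(2)] 4 5 by simp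
  qed
  have "sm (p + q) 0 (pair p q u a) \<eta> \<in> Q (p + q)" "sm q p a (br p 0 u \<eta>) \<in> Q (p + q)"
    using sm_closed[OF ua simple(2)] sm_closed[OF simple(1) un] by (simp_all add: add.commute)
  then have "dQ (p + q) (br p q u (sm q 0 a \<eta>)) = X1 + sg p X2 + sg (p + q) X3 + sg (p * q) (X4 + sg q (X5 + sg p X6))"
    unfolding br_sm' 1[symmetric] 2[symmetric] by (simp add: dQ_ops Q_ops)
  then show ?case
    unfolding 3 6 by (simp add: sg_add sg_sg) (auto simp: sg_def algebra_simps)
qed

text \<open>\<open>dQ_br_right\<close> is used twice. To bring \<open>u\<close> down to generators,
  the variables are exchanged by skew-symmetry, so that a generator \<eta> becomes the fixed first
  variable.\<close>

lemma dQ_br_generators: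
  assumes d_pair: "\<And>p q u a. u \<in> Q p \<Longrightarrow> a \<in> A q \<Longrightarrow>
      d (p + q) (pair p q u a) = pair (p + 1) q (dQ p u) a + sg p (pair p (q + 1) u (d q a))"
    and gen: "\<And>\<xi> \<eta>. \<xi> \<in> Q 0 \<Longrightarrow> \<eta> \<in> Q 0 \<Longrightarrow>
      dQ 0 (br 0 0 \<xi> \<eta>) = br 1 0 (dQ 0 \<xi>) \<eta> + br 0 1 \<xi> (dQ 0 \<eta>)"
    and u: "u \<in> Q p" and v: "v \<in> Q q"
  shows "dQ (p + q) (br p q u v) = br (p + 1) q (dQ p u) v + sg p (br p (q + 1) u (dQ q v))"
proof (rule dQ_br_right[OF d_pair[OF u] _ u v])
  fix \<eta> assume n: "\<eta> \<in> Q 0"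
  have dn: "dQ 0 \<eta> \<in> Q 1"
    using dQ_closed[OF n] by simp
  have "dQ p (br 0 p \<eta> u) = br 1 p (dQ 0 \<eta>) u + br 0 (p + 1) \<eta> (dQ p u)"
    using dQ_br_right[OF d_pair[OF n] _ n u] gen[OF n] by simp
  moreover have "br p 0 u \<eta> = - br 0 p \<eta> u"
    using br_skew[OF u n] by simp
  moreover have "br (p + 1) 0 (dQ p u) \<eta> = - br 0 (p + 1) \<eta> (dQ p u)"
    using br_skew[OF dQ_closed[OF u] n] by simp
  moreover have "br p 1 u (dQ 0 \<eta>) = - sg p (br 1 p (dQ 0 \<eta>) u)"
    using br_skew[OF u dn] by simp
  moreover have "dQ p (- br 0 p \<eta> u) = - dQ p (br 0 p \<eta> u)"
    using dQ_ops(3) br_closed[OF n u] by simp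
  ultimately show "dQ p (br p 0 u \<eta>) = br (p + 1) 0 (dQ p u) \<eta> + sg p (br p 1 u (dQ 0 \<eta>))"
    by (simp add: sg_minus)
qed

end


section \<open>Compatibility conditions\<close>

context triple_pair
begin

sublocale PQ: pre_quasi_lie_rinehart "pair_rscale T" "AltHA T" pair_mul "form0 1" dA
    "AltHQ T" "pair_scale T" dM "bracket" "pairing" "pair_tri T"
  by (rule pre_quasi)

section \<open>Compatibility of pairing and bracket with the differentials on generators\<close>

lemma dM_form0: "dM 0 (form0 \<xi>) [x] = - HQ T x \<xi>"
  by (simp add: dM_eq AltHQ_ops) (simp add: form0_def)

lemma pairing_one:
  assumes "u \<in> AltHQ T 1" "\<beta> \<in> AltHA T q"
  shows "pairing 1 q u \<beta> xs = sg q (fan (\<lambda>x. Qact (u [x]) \<beta>) xs)"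
  using assms(1)
proof (induction u rule: AltHQ_induct)
  case (simple \<alpha> \<xi>)
  show ?case
    unfolding pairing_simple[OF simple assms(2)] pair_mul_eq[OF simple]
    by (simp only: A.shuf_one[OF AltHA_supp[OF simple]])
      (simp add: simple_tensor_def Qact_scale_left[OF assms(2)])
next
  case (add u v)
  have "pairing 1 q (u + v) \<beta> xs = pairing 1 q u \<beta> xs + pairing 1 q v \<beta> xs"
    by (rule HOL.trans[OF fun_cong[OF pairing_add_left[OF add(1,2) assms(2)]] plus_fun_apply])
  moreover have "Qact ((u + v) [x]) \<beta> = (\<lambda>ys. Qact (u [x]) \<beta> ys + Qact (v [x]) \<beta> ys)" for x
    by (simp add: plus_fun_apply Qact_add_left[OF assms(2)])
  ultimately show ?case
    by (simp only: add(3,4) fan_add sg_add)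
qed

lemma bracket_one:
  assumes "u \<in> AltHQ T 1"
  shows "bracket 1 0 u (form0 \<eta>) [x] = brQ T (u [x]) \<eta> + u [QH T \<eta> x]"
  using assms
proof (induction u rule: AltHQ_induct)
  case (simple \<alpha> \<xi>)
  have 1: "Qact \<xi> (form0 1) = (\<lambda>xs. 0)"
    using Qact_alt[OF AltHA_ops(7)[of 1], of \<xi>] unfolding AltHA_0[of "Qact _ _"]
    by (simp add: Qact_eq form0_def)
  have "\<alpha> [] = 0"
    using AltHA_supp[OF simple] by (simp add: supp_def)
  moreover have "bracket 1 0 (\<alpha> \<odot> \<xi>) (form0 \<eta>) = Br 1 0 \<alpha> \<xi> (form0 1) \<eta>"
    unfolding form0_simple[of \<eta>] using bracket_simple[OF simple AltHA_ops(7)] .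
  moreover have "form0 (1 :: 'a) ([] :: 'h list) = 1" "form0 (1 :: 'a) (y # ys) = 0" for y :: 'h and ys
    by (simp_all add: form0_def)
  ultimately show ?case
    by (simp only: Br_eq[OF simple AltHA_ops(7)])
      (simp add: 1 zeros fun_ops A.shuf_form0_left A.shuf_form0_right Qact_eq
        simple_tensor_def brQ_scale_left CQ.M.scale_diff_left algebra_simps)
next
  case (add u v)
  have "bracket 1 0 (u + v) (form0 \<eta>) [x]
      = bracket 1 0 u (form0 \<eta>) [x] + bracket 1 0 v (form0 \<eta>) [x]"
    by (rule HOL.trans[OF fun_cong[OF bracket_add_left[OF add(1,2) AltHQ_ops(5)]] plus_fun_apply])
  moreover have "(u + v) [z] = u [z] + v [z]" for z
    by (rule plus_fun_apply)
  ultimately show ?case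
    by (simp only: add(3,4) additive.add[OF brQ_add(2)] ac_simps)
qed

text \<open>The element x\<cdot>\<xi> - \<xi>\<cdot>x, which is the bracket of x and \<xi> in the
  direct sum, acts on A as the commutator of the two actions.\<close>

definition compat_A where
  "compat_A \<longleftrightarrow> (\<forall>x \<xi> a. actH T x (actQ T \<xi> a) - actQ T \<xi> (actH T x a) + actH T (QH T \<xi> x) a
     = actQ T (HQ T x \<xi>) a)"

text \<open>The H-component of the Jacobi identity for x, \<xi>, y; \<open>compat_Q\<close> is the
  Q-component for x, \<xi>, \<eta>.\<close>

definition compat_H where
  "compat_H \<longleftrightarrow> (\<forall>x \<xi> y. brH T x (QH T \<xi> y) - QH T \<xi> (brH T x y) + brH T (QH T \<xi> x) y + QH T (HQ T y \<xi>) x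
     = QH T (HQ T x \<xi>) y)"

definition compat_Q where
  "compat_Q \<longleftrightarrow> (\<forall>x \<xi> \<eta>. HQ T x (brQ T \<xi> \<eta>)
     = brQ T (HQ T x \<xi>) \<eta> + brQ T \<xi> (HQ T x \<eta>) + HQ T (QH T \<eta> x) \<xi> - HQ T (QH T \<xi> x) \<eta>)"

abbreviation dH where "dH \<equiv> ce (brH T) (actH T)"

text \<open>The commutator of d with the action of \<xi> is the pairing with d \<xi>. Contraction
  with x leaves a commutator of two Lie derivatives, on whose values \<open>compat_A\<close> applies
  and on whose arguments \<open>compat_H\<close> applies.\<close>

lemma dH_Qact:
  assumes compat_A compat_H "\<alpha> \<in> AltHA T q"
  shows "dH (Qact \<xi> \<alpha>) xs - Qact \<xi> (dH \<alpha>) xs = fan (\<lambda>x. Qact (HQ T x \<xi>) \<alpha>) xs"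
  using assms(3)
proof (induction xs arbitrary: \<alpha> q)
  case Nil
  show ?case
    by (simp add: Qact_eq zeros)
next
  case (Cons x xs)
  have madd: "madd \<alpha>" and skew: "skew \<alpha>"
    by (rule AltHA_madd[OF Cons.prems], rule AltHA_skew[OF Cons.prems])
  let ?L = "\<lambda>x. lie (actH T x) (brH T x)" and ?N = "\<lambda>y. QH T (HQ T y \<xi>) x"
  \<comment> \<open>\<open>?N\<close> is the term of \<open>compat_H\<close> in which y acts on
    \<xi> before the result acts on x. It is not part of any Lie derivative here; the fan on the
    right-hand side supplies it through e3.\<close>
  have e1: "?L x (Qact \<xi> \<alpha>) xs - Qact \<xi> (?L x \<alpha>) xs + ?L (QH T \<xi> x) \<alpha> xs + lie (\<lambda>a. 0) ?N \<alpha> xs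
      = Qact (HQ T x \<xi>) \<alpha> xs"
    unfolding Qact_eq lie_lie[OF madd actH_add(1) actQ_add(1)] lie_pair_add[OF madd]
    using assms(1,2) by (simp add: compat_A_def compat_H_def)
  have e2: "dH (Qact \<xi> (ctr x \<alpha>)) xs - Qact \<xi> (dH (ctr x \<alpha>)) xs = fan (\<lambda>y. Qact (HQ T y \<xi>) (ctr x \<alpha>)) xs"
    using Cons.IH[OF ctr_closed[OF Cons.prems]] .
  have e3: "fan (\<lambda>y ys. \<alpha> (?N y # ys)) xs = - lie (\<lambda>a. 0) ?N \<alpha> xs"
    by (rule fan_skew[OF skew])
  have e4: "dH (Qact \<xi> \<alpha>) (x # xs)
      = ?L x (Qact \<xi> \<alpha>) xs - (dH (Qact \<xi> (ctr x \<alpha>)) xs - dH (ctr (QH T \<xi> x) \<alpha>) xs)"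
    by (simp add: Qact_eq ce_diff additives)
  have e5: "Qact \<xi> (dH \<alpha>) (x # xs)
      = Qact \<xi> (?L x \<alpha>) xs - Qact \<xi> (dH (ctr x \<alpha>)) xs - (?L (QH T \<xi> x) \<alpha> xs - dH (ctr (QH T \<xi> x) \<alpha>) xs)"
    by (simp add: Qact_eq lie_diff additives)
  have e6: "fan (\<lambda>y. Qact (HQ T y \<xi>) \<alpha>) (x # xs)
      = Qact (HQ T x \<xi>) \<alpha> xs - (fan (\<lambda>y. Qact (HQ T y \<xi>) (ctr x \<alpha>)) xs - fan (\<lambda>y ys. \<alpha> (?N y # ys)) xs)"
    by (simp add: Qact_eq fan_diff)
  show ?case
    unfolding e4 e5 e6 e1[symmetric] e2[symmetric] e3 by simp
qed

lemma d_pair_form0_iff: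
  assumes "\<alpha> \<in> AltHA T q"
  shows "dA q (pairing 0 q (form0 \<xi>) \<alpha>)
      = pairing 1 q (dM 0 (form0 \<xi>)) \<alpha> + pairing 0 (q + 1) (form0 \<xi>) (dA q \<alpha>)
    \<longleftrightarrow> (\<forall>xs. dH (Qact \<xi> \<alpha>) xs - Qact \<xi> (dH \<alpha>) xs = fan (\<lambda>x. Qact (HQ T x \<xi>) \<alpha>) xs)"
proof -
  have "dM 0 (form0 \<xi>) \<in> AltHQ T 1"
    using dM_closed[OF AltHQ_ops(5)] by simp
  then have "pairing 1 q (dM 0 (form0 \<xi>)) \<alpha> xs = sg q (fan (\<lambda>x. Qact (- HQ T x \<xi>) \<alpha>) xs)" for xs
    by (simp only: pairing_one[OF _ assms] dM_form0)
  moreover have "Qact (- \<eta>) \<alpha> = (\<lambda>xs. - Qact \<eta> \<alpha> xs)" for \<eta>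
    using Qact_scale_left[OF assms, of "- 1" \<eta>] by (simp add: CQ.M.scale_minus_left CQ.M.scale_one)
  ultimately have 1: "pairing 1 q (dM 0 (form0 \<xi>)) \<alpha> xs = sg q (- fan (\<lambda>x. Qact (HQ T x \<xi>) \<alpha>) xs)" for xs
    by (simp add: fan_minus)
  have 2: "dA q (pairing 0 q (form0 \<xi>) \<alpha>) xs = sg (q + 1) (dH (Qact \<xi> \<alpha>) xs)" for xs
    by (simp only: pairing_form0[OF assms] dA_eq[OF Qact_alt[OF assms]])
  have 3: "pairing 0 (q + 1) (form0 \<xi>) (dA q \<alpha>) xs = sg (q + 1) (Qact \<xi> (dH \<alpha>) xs)" for xs
    unfolding pairing_form0[OF dA_closed[OF assms]] by (simp only: dA_eq[OF assms] Qact_sg)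
  show ?thesis
    unfolding fun_eq_iff plus_fun_apply 1 2 3
    by (cases "even q") (auto simp: sg_def algebra_simps)
qed

text \<open>A linear form on H as a function of lists, which is the shape of test form needed for
  property P.\<close>

definition form1 :: "('h \<Rightarrow> 'a) \<Rightarrow> 'h list \<Rightarrow> 'a" where
  "form1 \<phi> = (\<lambda>xs. case xs of [x] \<Rightarrow> \<phi> x | _ \<Rightarrow> 0)"

lemma form1_closed:
  assumes "linear_map (sH T) (*) \<phi>"
  shows "form1 \<phi> \<in> AltHA T 1"
  using assms
  by (auto simp: AltHA_def alt_iff supp_def lin_on_def form1_def length_Suc_conv split: list.splits)

lemma property_PD:
  assumes "property_P (sH T)" "\<And>\<phi>. linear_map (sH T) (*) \<phi> \<Longrightarrow> \<phi> x = \<phi> y"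
  shows "x = y"
proof -
  have "\<phi> (x - y) = 0" if "linear_map (sH T) (*) \<phi>" for \<phi>
  proof -
    have "additive \<phi>"
      using that by (auto simp: lin_on_def additive_def)
    then show ?thesis
      using assms(2)[OF that] by (simp add: additive.diff)
  qed
  then have "x - y = 0"
    using assms(1) unfolding property_P_def by blast
  then show ?thesis
    by simp
qed

text \<open>A 0-form evaluated at one argument gives \<open>compat_A\<close>. A 1-form evaluated at
  two arguments gives the image of \<open>compat_H\<close> under that linear form.\<close>

lemma compat_AH_of_dH_Qact:
  assumes P: "property_P (sH T)"
    and eq: "\<And>\<xi> \<alpha> q xs. \<alpha> \<in> AltHA T q \<Longrightarrow>
      dH (Qact \<xi> \<alpha>) xs - Qact \<xi> (dH \<alpha>) xs = fan (\<lambda>x. Qact (HQ T x \<xi>) \<alpha>) xs"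
  shows compat_A compat_H
proof -
  show A: compat_A
    unfolding compat_A_def
  proof (intro allI)
    fix x \<xi> and a :: 'a
    have f: "form0 a (x # ys) = 0" "form0 a [] = a" for x :: 'h and ys
      by (simp_all add: form0_def)
    show "actH T x (actQ T \<xi> a) - actQ T \<xi> (actH T x a) + actH T (QH T \<xi> x) a = actQ T (HQ T x \<xi>) a"
      using eq[OF AltHA_ops(7)[of a], of \<xi> "[x]"]
      by (simp add: Qact_eq f zeros algebra_simps)
  qed
  show compat_H
    unfolding compat_H_def
  proof (intro allI, rule property_PD[OF P])
    fix x \<xi> y and \<phi> :: "'h \<Rightarrow> 'a"
    assume phi: "linear_map (sH T) (*) \<phi>"
    then have add: "additive \<phi>"
      by (auto simp: lin_on_def additive_def)
    have f: "form1 \<phi> [] = 0" "form1 \<phi> [z] = \<phi> z" "form1 \<phi> (z # w # ws) = 0" for z w ws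
      by (simp_all add: form1_def)
    \<comment> \<open>With this the terms that differentiate values of the linear form drop out, and
      only values at vectors of H remain.\<close>
    have A': "actQ T (HQ T x \<xi>) a = actH T x (actQ T \<xi> a) - actQ T \<xi> (actH T x a) + actH T (QH T \<xi> x) a" for x a
      using A by (simp add: compat_A_def)
    show "\<phi> (brH T x (QH T \<xi> y) - QH T \<xi> (brH T x y) + brH T (QH T \<xi> x) y + QH T (HQ T y \<xi>) x)
        = \<phi> (QH T (HQ T x \<xi>) y)"
      using eq[OF form1_closed[OF phi], of \<xi> "[x, y]"]
      by (simp add: Qact_eq f A' zeros
          additive.add[OF add] additive.diff[OF add] adds additive.diff[OF actH_add(1)]
          additive.diff[OF actQ_add(1)] algebra_simps)
  qed
qed

text \<open>Both sides are Q-valued 1-forms, so it suffices to compare their values at each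
  x.\<close>

lemma dM_bracket_iff:
  "dM 0 (bracket 0 0 (form0 \<xi>) (form0 \<eta>))
     = bracket 1 0 (dM 0 (form0 \<xi>)) (form0 \<eta>) + bracket 0 1 (form0 \<xi>) (dM 0 (form0 \<eta>))
   \<longleftrightarrow> (\<forall>x. HQ T x (brQ T \<xi> \<eta>)
     = brQ T (HQ T x \<xi>) \<eta> + brQ T \<xi> (HQ T x \<eta>) + HQ T (QH T \<eta> x) \<xi> - HQ T (QH T \<xi> x) \<eta>)"
    (is "?l = ?r1 + ?r2 \<longleftrightarrow> ?P")
proof -
  have c: "dM 0 (form0 \<theta>) \<in> AltHQ T 1" for \<theta>
    using dM_closed[OF AltHQ_ops(5)] by simp
  have l: "?l \<in> AltHQ T 1" "?r1 \<in> AltHQ T 1" "?r2 \<in> AltHQ T 1"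
    using bracket_closed[OF c AltHQ_ops(5)] bracket_closed[OF AltHQ_ops(5) c] c by (simp_all add: bracket_form0)
  have "?l = ?r1 + ?r2 \<longleftrightarrow> (\<forall>x. ?l [x] = (?r1 + ?r2) [x])"
  proof
    assume *: "\<forall>x. ?l [x] = (?r1 + ?r2) [x]"
    show "?l = ?r1 + ?r2"
    proof
      fix xs
      show "?l xs = (?r1 + ?r2) xs"
      proof (cases "length xs = 1")
        case True
        then obtain x where "xs = [x]"
          by (cases xs) auto
        with * show ?thesis
          by simp
      next
        case False
        then show ?thesis
          using AltHQ_supp[OF l(1)] AltHQ_supp[OF AltHQ_ops(2)[OF l(2,3)]] by (simp add: supp_def)
      qed
    qed
  qed simp
  moreover have "?l [x] = - HQ T x (brQ T \<xi> \<eta>)" for x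
    by (simp add: bracket_form0 dM_form0)
  moreover have "?r1 [x] = - brQ T (HQ T x \<xi>) \<eta> - HQ T (QH T \<eta> x) \<xi>" for x
    by (simp only: bracket_one[OF c] dM_form0) (simp add: minuses)
  moreover have "?r2 [x] = - brQ T \<xi> (HQ T x \<eta>) + HQ T (QH T \<xi> x) \<eta>" for x
  proof -
    \<comment> \<open>Skew-symmetry brings the 1-form into the first place, where
      \<open>bracket_one\<close> evaluates it.\<close>
    have "?r2 = - bracket 1 0 (dM 0 (form0 \<eta>)) (form0 \<xi>)"
      using bracket_skew[OF AltHQ_ops(5) c] by simp
    then show ?thesis
      using brQ_swap[of \<xi> "HQ T x \<eta>"]
      by (simp only: uminus_apply bracket_one[OF c] dM_form0) (simp add: minuses)
  qed
  ultimately show ?thesis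
    unfolding plus_fun_apply by (simp only:) (auto simp: algebra_simps)
qed

end

section \<open>The commutator of the two lower differentials\<close>

text \<open>Contracting $[d_1, d_2]$ with a first argument $x$ leaves, up to $[d_1, d_2]\iota_x$, the operator
  of \<open>commutator_lie\<close>; contracting that with $y$ leaves the one of \<open>commutator_fan\<close>, and contracting
  that with $z$ leaves the cyclic sum in the hypothesis.\<close>

lemma fan2_diff: "fan2 (\<lambda>x y ys. F x y ys - G x y ys) xs = fan2 F xs - fan2 G xs"
  by (simp add: fan2_def sg_diff sum_subtractf)

lemma fan_sum: "fan (\<lambda>x ys. \<Sum>j\<in>J. F j x ys) xs = (\<Sum>j\<in>J. fan (F j) xs)"
  unfolding fan_def sg_sum by (rule sum.swap)

text \<open>An additive map of the values commutes with every substitution into arguments, so only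
  the action on values can contribute.\<close>

lemma lie_comp:
  assumes "additive t"
  shows "lie D N (\<lambda>ys. t (f ys)) xs - t (lie D N f xs) = D (t (f xs)) - t (D (f xs))"
  by (simp add: lie_def additive.diff[OF assms] additive.sum[OF assms])

context
  fixes br :: "'x \<Rightarrow> 'x \<Rightarrow> 'x" and act :: "'x \<Rightarrow> 'm::ab_group_add \<Rightarrow> 'm"
    and tri :: "'x \<Rightarrow> 'x \<Rightarrow> 'm \<Rightarrow> 'm" and V :: "'m set"
  assumes add: "\<And>x. additive (act x)" "\<And>x y. additive (tri x y)"
    and cyclic: "\<And>x y z m. m \<in> V \<Longrightarrow>
      (act x (tri y z m) - tri y z (act x m) - tri y (br x z) m)
      - (act y (tri x z m) - tri x z (act y m) - tri x (br y z) m)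
      - tri (br x y) z m + (act z (tri x y m) - tri x y (act z m)) = 0"
begin

private abbreviation "L x \<equiv> lie (act x) (br x)"
private abbreviation "D \<equiv> ce br act"
private abbreviation "E x f \<equiv> fan (\<lambda>y ys. tri x y (f ys))"
private abbreviation "E2 f \<equiv> fan2 (\<lambda>x y ys. tri x y (f ys))"

lemma commutator_fan:
  assumes "\<And>ys. f ys \<in> V"
  shows "L x (E y f) xs - E y (L x f) xs - (L y (E x f) xs - E x (L y f) xs) - E (br x y) f xs
    + (D (\<lambda>ys. tri x y (f ys)) xs - tri x y (D f xs)) = 0"
  using assms
proof (induction xs arbitrary: f)
  case Nil
  show ?case
    by (simp add: additive.zero[OF add(1)] additive.zero[OF add(2)])
next
  case (Cons z xs)
  have 1: "L u (E v f) (z # xs) = L u (\<lambda>ys. tri v z (f ys)) xs - L u (E v (ctr z f)) xs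
      - (tri v (br u z) (f xs) - E v (ctr (br u z) f) xs)" for u v
    by (simp add: lie_diff add)
  have 2: "E v (L u f) (z # xs) = tri v z (L u f xs) - (E v (L u (ctr z f)) xs - E v (ctr (br u z) f) xs)" for u v
    by (simp add: additive.diff[OF add(2)] fan_diff)
  have 3: "E (br x y) f (z # xs) = tri (br x y) z (f xs) - E (br x y) (ctr z f) xs"
    by simp
  have 4: "D (\<lambda>ys. tri x y (f ys)) (z # xs) = L z (\<lambda>ys. tri x y (f ys)) xs - D (\<lambda>ys. tri x y (f (z # ys))) xs"
    by simp
  have 5: "tri x y (D f (z # xs)) = tri x y (L z f xs) - tri x y (D (ctr z f) xs)"
    by (simp add: additive.diff[OF add(2)])
  have 6: "L u (\<lambda>ys. tri v w (f ys)) xs = act u (tri v w (f xs)) - tri v w (act u (f xs)) + tri v w (L u f xs)" for u v w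
    using lie_comp[OF add(2)[of v w], of "act u" "br u" f xs] by (simp add: algebra_simps)
  have "L x (E y f) (z # xs) - E y (L x f) (z # xs) - (L y (E x f) (z # xs) - E x (L y f) (z # xs)) - E (br x y) f (z # xs)
      + (D (\<lambda>ys. tri x y (f ys)) (z # xs) - tri x y (D f (z # xs)))
    = ((act x (tri y z (f xs)) - tri y z (act x (f xs)) - tri y (br x z) (f xs))
      - (act y (tri x z (f xs)) - tri x z (act y (f xs)) - tri x (br y z) (f xs))
      - tri (br x y) z (f xs) + (act z (tri x y (f xs)) - tri x y (act z (f xs))))
    - (L x (E y (ctr z f)) xs - E y (L x (ctr z f)) xs - (L y (E x (ctr z f)) xs - E x (L y (ctr z f)) xs)
      - E (br x y) (ctr z f) xs + (D (\<lambda>ys. tri x y (f (z # ys))) xs - tri x y (D (ctr z f) xs)))"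
    unfolding 1 2 3 4 5 6 by simp
  also have "\<dots> = 0"
    using Cons.IH[of "ctr z f"] Cons.prems cyclic[OF Cons.prems] by simp
  finally show ?case .
qed

lemma commutator_lie:
  assumes "\<And>ys. f ys \<in> V"
  shows "L x (E2 f) xs - E2 (L x f) xs + D (E x f) xs + E x (D f) xs = 0"
  using assms
proof (induction xs arbitrary: f)
  case Nil
  show ?case
    by (simp add: additive.zero[OF add(1)])
next
  case (Cons y xs)
  have 1: "L x (E2 f) (y # xs) = L x (E2 (ctr y f)) xs - L x (E y f) xs - (E2 (ctr (br x y) f) xs - E (br x y) f xs)"
    by (simp add: lie_diff add)
  have 2: "E2 (L x f) (y # xs) = E2 (L x (ctr y f)) xs - E2 (ctr (br x y) f) xs - E y (L x f) xs"
    by (simp add: additive.diff[OF add(2)] fan2_diff)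
  have 3: "D (E x f) (y # xs) = L y (E x f) xs - (D (\<lambda>ys. tri x y (f ys)) xs - D (E x (ctr y f)) xs)"
    by (simp add: ce_diff add)
  have 4: "E x (D f) (y # xs) = tri x y (D f xs) - (E x (L y f) xs - E x (D (ctr y f)) xs)"
    by (simp add: additive.diff[OF add(2)] fan_diff)
  have "L x (E2 f) (y # xs) - E2 (L x f) (y # xs) + D (E x f) (y # xs) + E x (D f) (y # xs)
    = (L x (E2 (ctr y f)) xs - E2 (L x (ctr y f)) xs + D (E x (ctr y f)) xs + E x (D (ctr y f)) xs)
    - (L x (E y f) xs - E y (L x f) xs - (L y (E x f) xs - E x (L y f) xs) - E (br x y) f xs
      + (D (\<lambda>ys. tri x y (f ys)) xs - tri x y (D f xs)))"
    unfolding 1 2 3 4 by simp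
  also have "\<dots> = 0"
    using Cons.IH[of "ctr y f"] Cons.prems commutator_fan[where f = f and x = x and y = y and xs = xs, OF Cons.prems] by simp
  finally show ?case .
qed

lemma commutator_ce:
  assumes "\<And>ys. f ys \<in> V"
  shows "D (E2 f) xs = E2 (D f) xs"
  using assms
proof (induction xs arbitrary: f)
  case (Cons x xs)
  have "D (E2 f) (x # xs) = L x (E2 f) xs - (D (E2 (ctr x f)) xs - D (E x f) xs)"
    by (simp add: ce_diff add)
  moreover have "E2 (D f) (x # xs) = E2 (L x f) xs - E2 (D (ctr x f)) xs - E x (D f) xs"
    by (simp add: additive.diff[OF add(2)] fan2_diff)
  moreover have "L x (E2 f) xs = E2 (L x f) xs - D (E x f) xs - E x (D f) xs"
    using commutator_lie[where f = f and x = x and xs = xs, OF Cons.prems] by (simp add: algebra_simps eq_neg_iff_add_eq_0)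
  ultimately show ?case
    using Cons.IH[of "ctr x f"] Cons.prems by simp
qed simp

end

text \<open>Needed to recognise \<open>d1\<close> applied to a value of \<open>d2\<close> as an
  instance of \<open>ce\<close>, since the two formulas agree only on skew functions.\<close>

lemma fan2_skew:
  assumes add: "\<And>x y. additive (tri x y)" and swap: "\<And>x y ys. tri x y (f ys) = - tri y x (f ys)"
    and "skew f"
  shows "skew (fan2 (\<lambda>x y ys. tri x y (f ys)))"
proof (rule skewI)
  fix us x y vs
  have fan: "fan (\<lambda>w ys. tri z w (f ys)) (us @ x # y # vs) = - fan (\<lambda>w ys. tri z w (f ys)) (us @ y # x # vs)"
    if "skew f" for f :: "'a list \<Rightarrow> 'b" and us z
    using that
  proof (induction us arbitrary: f)
    case Nil
    then show ?case
      using skew_swap[OF Nil, of x y] by (simp add: additive.minus[OF add] fan_minus)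
  next
    case (Cons u us)
    then show ?case
      using skewD[OF Cons.prems, of us x y vs] Cons.IH[OF skew_ctr[OF Cons.prems, of u]]
      by (simp add: additive.minus[OF add])
  qed
  show "fan2 (\<lambda>x y ys. tri x y (f ys)) (us @ x # y # vs) = - fan2 (\<lambda>x y ys. tri x y (f ys)) (us @ y # x # vs)"
    using \<open>skew f\<close> swap
  proof (induction us arbitrary: f)
    case Nil
    have "fan2 (\<lambda>u w ys. tri u w (f (y # x # ys))) vs = - fan2 (\<lambda>u w ys. tri u w (f (x # y # ys))) vs"
      using fan2_diff[of "\<lambda>u w ys. 0" "\<lambda>u w ys. tri u w (f (x # y # ys))" vs] skew_swap[OF Nil(1), of y x]
      by (simp add: additive.minus[OF add] fan2_def)
    then show ?case
      using Nil(2)[of x y vs] by simp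
  next
    case (Cons u us)
    show ?case
      using Cons.IH[OF skew_ctr[OF Cons.prems(1), of u] Cons.prems(2)] fan[OF Cons.prems(1), of u us] by simp
  qed
qed


section \<open>Forms on Q with values in forms on H\<close>

context triple_pair
begin

text \<open>Reads a form on the carrier \<open>AltHQ T 0\<close> as a function of lists over the
  type \<open>'q\<close>, where the calculus of lists applies.\<close>

abbreviation lift :: "(('h list \<Rightarrow> 'q) list \<Rightarrow> 'h list \<Rightarrow> 'a) \<Rightarrow> 'q list \<Rightarrow> 'h list \<Rightarrow> 'a" where
  "lift f \<equiv> \<lambda>\<xi>s. f (map form0 \<xi>s)"

lemma Q0_list: "set us \<subseteq> AltHQ T 0 \<longleftrightarrow> (\<exists>\<xi>s. us = map form0 \<xi>s)"
proof
  assume "set us \<subseteq> AltHQ T 0"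
  then have "map (\<lambda>u. form0 (u [])) us = map (\<lambda>u. u) us"
    using AltHQ_0 by (intro map_cong) (auto simp: subset_iff)
  then have "us = map form0 (map (\<lambda>u. u []) us)"
    by (simp add: comp_def)
  then show "\<exists>\<xi>s. us = map form0 \<xi>s" ..
qed (auto simp: AltHQ_ops)


lemma AltQ_zero: "f \<in> PQ.AltQ p q \<Longrightarrow> \<not> (length us = p \<and> set us \<subseteq> AltHQ T 0) \<Longrightarrow> f us = 0"
  unfolding PQ.AltQ_def alt_forms_def by (auto split: if_splits)

lemma AltQ_closed: "f \<in> PQ.AltQ p q \<Longrightarrow> f us \<in> AltHA T q"
  unfolding PQ.AltQ_def alt_forms_def using AltHA_ops(1)[of q] by (auto split: if_splits)

lemma AltHA_sum: "(\<And>j. j \<in> J \<Longrightarrow> g j \<in> AltHA T n) \<Longrightarrow> sum g J \<in> AltHA T n"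
  by (induction J rule: infinite_finite_induct) (simp_all add: AltHA_ops)

lemma mul_form0: "pair_mul 0 q (form0 a) \<alpha> = (\<lambda>xs :: 'h list. (a :: 'a) * \<alpha> xs)"
  by (simp add: pair_mul_eq AltHA_ops A.shuf_form0_left)

text \<open>With the arguments from H frozen, a lifted form is an ordinary alternating A-valued form
  on Q; \<open>AltQ_I\<close> is the way back.\<close>

lemma AltQ_alt:
  assumes f: "f \<in> PQ.AltQ p q"
  shows "(\<lambda>\<xi>s. lift f \<xi>s xs) \<in> alt (sQ T) (*) p"
  unfolding alt_iff
proof (intro conjI allI impI)
  show "supp p (\<lambda>\<xi>s. lift f \<xi>s xs)"
    using AltQ_zero[OF f] by (simp add: supp_def zero_fun_apply)
next
  fix \<xi>s :: "'q list" and i assume *: "length \<xi>s = p" "i < p"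
  then have "lin_on (AltHA T 0) (AltHQ T 0) (pair_scale T 0 0) (pair_mul 0 q) (\<lambda>u. f ((map form0 \<xi>s)[i := u]))"
    using f unfolding PQ.AltQ_def alt_forms_def by (simp add: Q0_list) (metis length_map)
  note lin = this[unfolded lin_on_def]
  have "lift f (\<xi>s[i := \<xi> + \<eta>]) = lift f (\<xi>s[i := \<xi>]) + lift f (\<xi>s[i := \<eta>])" for \<xi> \<eta>
    using lin AltHQ_ops(5) by (simp add: map_update form0_add)
  moreover have "lift f (\<xi>s[i := sQ T a \<xi>]) = (\<lambda>xs. a * lift f (\<xi>s[i := \<xi>]) xs)" for a \<xi>
    using lin AltHQ_ops(5) AltHA_ops(7) by (simp add: map_update form0_scale mul_form0)
  ultimately show "lin_on UNIV UNIV (sQ T) (*) (\<lambda>\<xi>. lift f (\<xi>s[i := \<xi>]) xs)"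
    by (simp add: lin_on_def plus_fun_def)
next
  fix \<xi>s :: "'q list" and i j assume *: "length \<xi>s = p" "i < j" "j < p" "\<xi>s ! i = \<xi>s ! j"
  have "set (map form0 \<xi>s) \<subseteq> AltHQ T 0" "length (map form0 \<xi>s) = p" "map form0 \<xi>s ! i = map form0 \<xi>s ! j"
    using * by (auto simp: AltHQ_ops)
  then have "lift f \<xi>s = 0"
    using f * unfolding PQ.AltQ_def alt_forms_def by blast
  then show "lift f \<xi>s xs = 0"
    by (simp add: zero_fun_apply)
qed

lemma AltQ_I:
  assumes zero: "\<And>us. \<not> (length us = p \<and> set us \<subseteq> AltHQ T 0) \<Longrightarrow> f us = 0"
    and closed: "\<And>\<xi>s. length \<xi>s = p \<Longrightarrow> lift f \<xi>s \<in> AltHA T q"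
    and alt: "\<And>xs. (\<lambda>\<xi>s. lift f \<xi>s xs) \<in> alt (sQ T) (*) p"
  shows "f \<in> PQ.AltQ p q"
  unfolding PQ.AltQ_def alt_forms_def mem_Collect_eq
proof (intro conjI allI impI)
  show "if length us = p \<and> set us \<subseteq> AltHQ T 0 then f us \<in> AltHA T q else f us = 0" for us
    using zero closed by (auto simp: Q0_list)
next
  fix us i assume *: "length us = p" "set us \<subseteq> AltHQ T 0" "i < p"
  then obtain \<xi>s where us: "us = map form0 \<xi>s"
    by (auto simp: Q0_list)
  have lin: "lin_on UNIV UNIV (sQ T) (*) (\<lambda>\<xi>. lift f (\<xi>s[i := \<xi>]) xs)" for xs
    using alt[of xs] * us unfolding alt_iff by simp
  show "lin_on (AltHA T 0) (AltHQ T 0) (pair_scale T 0 0) (pair_mul 0 q) (\<lambda>u. f (us[i := u]))"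
    unfolding lin_on_def
  proof (intro conjI ballI)
    fix u v assume "u \<in> AltHQ T 0" "v \<in> AltHQ T 0"
    then obtain \<xi> \<eta> where "u = form0 \<xi>" "v = form0 \<eta>"
      using AltHQ_0 by blast
    moreover have "lift f (\<xi>s[i := \<xi> + \<eta>]) = lift f (\<xi>s[i := \<xi>]) + lift f (\<xi>s[i := \<eta>])"
      by (rule ext) (use lin in \<open>simp add: lin_on_def plus_fun_apply\<close>)
    ultimately show "f (us[i := u + v]) = f (us[i := u]) + f (us[i := v])"
      by (simp add: us form0_add map_update)
  next
    fix s u assume "s \<in> AltHA T 0" "u \<in> AltHQ T 0"
    then obtain a \<xi> where "s = form0 a" "u = form0 \<xi>"
      using AltHQ_0 AltHA_0 by blast
    moreover have "lift f (\<xi>s[i := sQ T a \<xi>]) = (\<lambda>xs. a * lift f (\<xi>s[i := \<xi>]) xs)"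
      by (rule ext) (use lin in \<open>simp add: lin_on_def\<close>)
    ultimately show "f (us[i := pair_scale T 0 0 s u]) = pair_mul 0 q s (f (us[i := u]))"
      by (simp add: us form0_scale mul_form0 map_update)
  qed
next
  fix us i j assume *: "length us = p" "set us \<subseteq> AltHQ T 0" "i < j" "j < p" "us ! i = us ! j"
  then obtain \<xi>s where us: "us = map form0 \<xi>s"
    by (auto simp: Q0_list)
  have inj: "\<xi> = \<eta>" if "form0 \<xi> = (form0 \<eta> :: 'h list \<Rightarrow> 'q)" for \<xi> \<eta>
    using fun_cong[OF that, of "[]"] by (simp add: form0_def)
  have "lift f \<xi>s xs = 0" for xs
    using alt[of xs] * us inj[of "\<xi>s ! i" "\<xi>s ! j"] unfolding alt_iff by simp
  then show "f us = 0"
    by (simp add: us fun_eq_iff zero_fun_apply)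
qed

text \<open>Makes the multilinear extension of \<open>f\<close> to a Q-valued form in one place well
  defined on the tensor product.\<close>

lemma extended_balanced:
  assumes f: "f \<in> PQ.AltQ p q" and len: "length \<xi>s = p" "j < p"
  shows "balanced (AltHA T 0) (pair_mul 0 r) (AltHA T r) (pair_scale T 0 0) (AltHQ T 0)
    (\<lambda>a \<xi>. sg ((p + q) * r) (pair_mul r q a (f ((map form0 \<xi>s)[j := \<xi>]))))"
proof -
  let ?g = "\<lambda>u. f ((map form0 \<xi>s)[j := u])"
  have g: "?g u \<in> AltHA T q" for u
    by (rule AltQ_closed[OF f])
  have "lin_on (AltHA T 0) (AltHQ T 0) (pair_scale T 0 0) (pair_mul 0 q) ?g"
    using f len unfolding PQ.AltQ_def alt_forms_def by (simp add: Q0_list) (metis length_map)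
  note lin = this[unfolded lin_on_def]
  \<comment> \<open>The scalar s has degree 0 and therefore passes m without a sign.\<close>
  have "pair_mul r q (pair_mul 0 r s m) (?g n) = pair_mul r q m (pair_mul 0 q s (?g n))"
    if "s \<in> AltHA T 0" "m \<in> AltHA T r" for s m n
    using DG.mul_assoc[OF that g, of n] mul_left_commute[OF that(2,1) g, of n] by simp
  with lin show ?thesis
    unfolding balanced_def by (simp add: mul_add_left mul_add_right g sg_add PQ.mul_ops)
qed

lemma extended_add:
  assumes "f \<in> PQ.AltQ p q" "length \<xi>s = p" "j < p" "u \<in> AltHQ T r" "v \<in> AltHQ T r"
  shows "PQ.extended p q r f (map form0 \<xi>s) j (u + v)
    = PQ.extended p q r f (map form0 \<xi>s) j u + PQ.extended p q r f (map form0 \<xi>s) j v"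
  unfolding PQ.extended_def by (rule PQ.extended_add[OF extended_balanced[OF assms(1-3)] assms(4,5)])

lemma extended_simple:
  assumes "f \<in> PQ.AltQ p q" "length \<xi>s = p" "j < p" "\<alpha> \<in> AltHA T r"
  shows "PQ.extended p q r f (map form0 \<xi>s) j (\<alpha> \<odot> \<xi>)
    = sg ((p + q) * r) (pair_mul r q \<alpha> (lift f (\<xi>s[j := \<xi>])))"
  unfolding PQ.extended_def simple_tensor_eq[OF assms(4)] map_update
  by (rule PQ.extended_simple[OF extended_balanced[OF assms(1-3)] assms(4) AltHQ_ops(5)])

lemma extended_closed:
  assumes "f \<in> PQ.AltQ p q" "length \<xi>s = p" "j < p" "u \<in> AltHQ T r"
  shows "PQ.extended p q r f (map form0 \<xi>s) j u \<in> AltHA T (r + q)"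
  using assms(4)
  by (induction u rule: AltHQ_induct)
    (simp_all add: extended_simple[OF assms(1-3)] extended_add[OF assms(1-3)] AltHA_ops mul_closed AltQ_closed[OF assms(1)])

text \<open>The sign p + q of the extension and the sign q of the product with a 1-form combine to
  \<open>sg p\<close>.\<close>

lemma extended_one:
  assumes "f \<in> PQ.AltQ p q" "length \<xi>s = p" "j < p" "u \<in> AltHQ T 1"
  shows "PQ.extended p q 1 f (map form0 \<xi>s) j u xs = sg p (fan (\<lambda>x. lift f (\<xi>s[j := u [x]])) xs)"
proof -
  have lin: "lin_on UNIV UNIV (sQ T) (*) (\<lambda>\<xi>. lift f (\<xi>s[j := \<xi>]) ys)" for ys
    using AltQ_alt[OF assms(1), of ys] assms(2,3) unfolding alt_iff by simp
  from assms(4) show ?thesis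
  proof (induction u rule: AltHQ_induct)
    case (simple \<alpha> \<xi>)
    have "lift f (\<xi>s[j := (\<alpha> \<odot> \<xi>) [x]]) = (\<lambda>ys. \<alpha> [x] * lift f (\<xi>s[j := \<xi>]) ys)" for x
      using lin by (simp add: lin_on_def simple_tensor_def fun_eq_iff)
    then show ?case
      by (simp only: extended_simple[OF assms(1-3) simple] pair_mul_eq[OF simple] sg_fun
          A.shuf_one[OF AltHA_supp[OF simple]] sg_sg) (simp add: sg_def)
  next
    case (add u v)
    have "(u + v) [x] = u [x] + v [x]" for x
      by (rule plus_fun_apply)
    then have "lift f (\<xi>s[j := (u + v) [x]]) = (\<lambda>ys. lift f (\<xi>s[j := u [x]]) ys + lift f (\<xi>s[j := v [x]]) ys)" for x
      using lin by (simp add: lin_on_def fun_eq_iff)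
    moreover have "PQ.extended p q 1 f (map form0 \<xi>s) j (u + v) xs
        = PQ.extended p q 1 f (map form0 \<xi>s) j u xs + PQ.extended p q 1 f (map form0 \<xi>s) j v xs"
      by (rule HOL.trans[OF fun_cong[OF extended_add[OF assms(1-3) add(1,2)]] plus_fun_apply])
    ultimately show ?case
      by (simp only: add(3,4) fan_add sg_add)
  qed
qed

text \<open>Up to sign, \<open>d0\<close> is the differential of H with coefficients in the A-valued
  forms on Q: x acts on the value and, through \<open>HQ\<close>, on each argument from Q.\<close>

lemma d0_eq:
  assumes f: "f \<in> PQ.AltQ p q" and len: "length \<xi>s = p"
  shows "lift (PQ.d0 p q f) \<xi>s xs = sg (q + 1) (dH (lift f \<xi>s) xs
    - fan (\<lambda>x ys. \<Sum>j<p. lift f (\<xi>s[j := HQ T x (\<xi>s ! j)]) ys) xs)"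
proof -
  have dM: "dM 0 (form0 \<xi>) \<in> AltHQ T 1" for \<xi>
    using dM_closed[OF AltHQ_ops(5)] by simp
  have "PQ.extended p q 1 f (map form0 \<xi>s) j (dM 0 (map form0 \<xi>s ! j)) xs
      = - sg p (fan (\<lambda>x. lift f (\<xi>s[j := HQ T x (\<xi>s ! j)])) xs)" if "j < p" for j
  proof -
    have "lin_on UNIV UNIV (sQ T) (*) (\<lambda>\<xi>. lift f (\<xi>s[j := \<xi>]) ys)" for ys
      using AltQ_alt[OF f, of ys] len that unfolding alt_iff by simp
    then have add: "additive (\<lambda>\<xi>. lift f (\<xi>s[j := \<xi>]) ys)" for ys
      by (simp add: lin_on_def additive_def)
    have "lift f (\<xi>s[j := - \<xi>]) = (\<lambda>ys. - lift f (\<xi>s[j := \<xi>]) ys)" for \<xi>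
      by (simp add: additive.minus[OF add] fun_eq_iff)
    moreover have "map form0 \<xi>s ! j = (form0 (\<xi>s ! j) :: 'h list \<Rightarrow> 'q)"
      using that len by simp
    ultimately show ?thesis
      by (simp only: extended_one[OF f len that dM] dM_form0 fan_minus sg_minus)
  qed
  then have "(\<Sum>j<p. PQ.extended p q 1 f (map form0 \<xi>s) j (dM 0 (map form0 \<xi>s ! j))) xs
      = - sg p (fan (\<lambda>x ys. \<Sum>j<p. lift f (\<xi>s[j := HQ T x (\<xi>s ! j)]) ys) xs)"
    unfolding sum_apply fan_sum sg_sum by (simp add: sum_negf)
  moreover have "lift (PQ.d0 p q f) \<xi>s = dA q (lift f \<xi>s)
      + sg (p + q + 1) (\<Sum>j<p. PQ.extended p q 1 f (map form0 \<xi>s) j (dM 0 (map form0 \<xi>s ! j)))"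
    using len Q0_list by (auto simp: PQ.d0_def)
  ultimately have "lift (PQ.d0 p q f) \<xi>s xs = dA q (lift f \<xi>s) xs + sg (p + q + 1)
      (- sg p (fan (\<lambda>x ys. \<Sum>j<p. lift f (\<xi>s[j := HQ T x (\<xi>s ! j)]) ys) xs))"
    by (simp add: plus_fun_apply minus_apply sg_apply)
  moreover have "dA q (lift f \<xi>s) xs = sg (q + 1) (dH (lift f \<xi>s) xs)"
    by (simp only: dA_eq[OF AltQ_closed[OF f]])
  ultimately show ?thesis
    by (simp add: sg_def)
qed

lemma d0_operator:
  assumes f: "f \<in> PQ.AltQ p q"
  shows "PQ.d0 p q f \<in> PQ.AltQ p (q + 1)"
proof (rule AltQ_I)
  show "PQ.d0 p q f us = 0" if "\<not> (length us = p \<and> set us \<subseteq> AltHQ T 0)" for us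
    using that by (auto simp: PQ.d0_def)
  show "lift (PQ.d0 p q f) \<xi>s \<in> AltHA T (q + 1)" if len: "length \<xi>s = p" for \<xi>s
  proof -
    have "dM 0 (map form0 \<xi>s ! j) \<in> AltHQ T 1" if "j < p" for j
      using dM_closed[OF AltHQ_ops(5)] that len by simp
    then have "PQ.extended p q 1 f (map form0 \<xi>s) j (dM 0 (map form0 \<xi>s ! j)) \<in> AltHA T (q + 1)" if "j < p" for j
      using extended_closed[OF f len that, of _ 1] that by simp
    then have "(\<Sum>j<p. PQ.extended p q 1 f (map form0 \<xi>s) j (dM 0 (map form0 \<xi>s ! j))) \<in> AltHA T (q + 1)"
      by (intro AltHA_sum) simp
    then show ?thesis
      using len Q0_list dA_closed[OF AltQ_closed[OF f]] by (auto simp: PQ.d0_def intro!: AltHA_ops)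
  qed
next
  fix xs
  \<comment> \<open>The same operator with the usual differential in place of the recursive one: the
    action part joins with the substitutions to a Lie derivative in the variables of Q. Each summand
    is then visibly alternating in those variables.\<close>
  define h where "h \<xi>s = sg (q + 1)
    (fan (\<lambda>x ys. lie (actH T x) (HQ T x) (\<lambda>\<zeta>s. lift f \<zeta>s ys) \<xi>s) xs
      + fan2 (\<lambda>x y ys. lift f \<xi>s (brH T x y # ys)) xs)" for \<xi>s
  note alt = AltQ_alt[OF f]
  have "lie (actH T x) (HQ T x) (\<lambda>\<zeta>s. lift f \<zeta>s ys) \<in> alt (sQ T) (*) p" for x ys
    using alt by (rule QA.lie_alt[where E = "actH T x"]) (simp_all add: additives actH_mult HQ_scale_right)
  then have "(\<lambda>\<xi>s. fan (\<lambda>x ys. lie (actH T x) (HQ T x) (\<lambda>\<zeta>s. lift f \<zeta>s ys) \<xi>s) xs) \<in> alt (sQ T) (*) p"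
    unfolding fan_def by (intro QA.alt_sum QA.alt_sg)
  moreover have "(\<lambda>\<xi>s. fan2 (\<lambda>x y ys. lift f \<xi>s (brH T x y # ys)) xs) \<in> alt (sQ T) (*) p"
    unfolding fan2_def by (intro QA.alt_sum QA.alt_sg alt)
  ultimately have h: "h \<in> alt (sQ T) (*) p"
    unfolding h_def by (intro QA.alt_sg QA.alt_add)
  have "lift (PQ.d0 p q f) \<xi>s xs = h \<xi>s" for \<xi>s
  proof (cases "length \<xi>s = p")
    case False
    then show ?thesis
      using suppD[OF alt_supp[OF h]] by (simp add: PQ.d0_def zero_fun_apply)
  next
    case True
    have "skew (lift f \<xi>s)"
      using AltQ_closed[OF f] unfolding AltHA_def by (rule alt_skew)
    then have "dH (lift f \<xi>s) xs = fan (\<lambda>x ys. actH T x (lift f \<xi>s ys)) xs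
        + fan2 (\<lambda>x y ys. lift f \<xi>s (brH T x y # ys)) xs"
      by (simp only: ce_eq)
    then show ?thesis
      unfolding d0_eq[OF f True] h_def by (simp add: lie_def fan_diff True algebra_simps)
  qed
  then show "(\<lambda>\<xi>s. lift (PQ.d0 p q f) \<xi>s xs) \<in> alt (sQ T) (*) p"
    using h by simp
qed


section \<open>The commutator of two elements of Q and the cyclic sum of brackets\<close>

definition compat_act where
  "compat_act \<longleftrightarrow> (\<forall>\<xi> \<eta> a. actQ T \<xi> (actQ T \<eta> a) - actQ T \<eta> (actQ T \<xi> a) - actQ T (brQ T \<xi> \<eta>) a
     = actH T (dlt T \<xi> \<eta>) a)"

text \<open>The H-component of the Jacobi identity for x, \<xi>, \<eta>: the curvature of the
  operation of Q on H, expressed by \<delta>. The next two definitions are the Q- and H-components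
  for three elements of Q; the latter is a Bianchi identity for \<delta>.\<close>

definition compat_curv where
  "compat_curv \<longleftrightarrow> (\<forall>\<xi> \<eta> x. QH T \<xi> (QH T \<eta> x) - QH T \<eta> (QH T \<xi> x) - QH T (brQ T \<xi> \<eta>) x
     = brH T (dlt T \<xi> \<eta>) x + (dlt T (HQ T x \<xi>) \<eta> + dlt T \<xi> (HQ T x \<eta>)))"

definition compat_jac_Q where
  "compat_jac_Q \<longleftrightarrow> (\<forall>\<xi> \<eta> \<theta>. brQ T (brQ T \<xi> \<eta>) \<theta> + brQ T (brQ T \<eta> \<theta>) \<xi> + brQ T (brQ T \<theta> \<xi>) \<eta>
     + (HQ T (dlt T \<xi> \<eta>) \<theta> + HQ T (dlt T \<eta> \<theta>) \<xi> + HQ T (dlt T \<theta> \<xi>) \<eta>) = 0)"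

definition compat_jac_H where
  "compat_jac_H \<longleftrightarrow> (\<forall>\<xi> \<eta> \<theta>. QH T \<xi> (dlt T \<eta> \<theta>) + QH T \<eta> (dlt T \<theta> \<xi>) + QH T \<theta> (dlt T \<xi> \<eta>)
     + (dlt T \<xi> (brQ T \<eta> \<theta>) + dlt T \<eta> (brQ T \<theta> \<xi>) + dlt T \<theta> (brQ T \<xi> \<eta>)) = 0)"

lemma d0_form0: "PQ.d0 0 q (form0 \<alpha>) = form0 (dA q \<alpha>)"
  by (auto simp: PQ.d0_def form0_def fun_eq_iff)

lemma d2_form0: "PQ.d2 0 n (form0 \<beta>) [form0 \<xi>, form0 \<eta>] = sg n (ctr (dlt T \<xi> \<eta>) \<beta>)"
proof -
  have "(form0 \<xi> :: 'h list \<Rightarrow> 'q) [] = \<xi>" "(form0 \<eta> :: 'h list \<Rightarrow> 'q) [] = \<eta>"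
    by (simp_all add: form0_def)
  moreover have "form0 \<beta> ([] :: ('h list \<Rightarrow> 'q) list) = \<beta>"
    by (simp add: form0_def)
  ultimately show ?thesis
    by (simp add: PQ.d2_def AltHQ_ops numeral_2_eq_2 pair_tri_def sg_minus)
qed

text \<open>Required for applying \<open>d0_eq\<close> to \<open>d2\<close> of a 0-form.\<close>

lemma d2_form0_AltQ:
  assumes \<alpha>: "\<alpha> \<in> AltHA T q"
  shows "PQ.d2 0 q (form0 \<alpha>) \<in> PQ.AltQ 2 (q - 1)"
proof (rule AltQ_I)
  show "PQ.d2 0 q (form0 \<alpha>) us = 0" if "\<not> (length us = 2 \<and> set us \<subseteq> AltHQ T 0)" for us
    using that by (auto simp: PQ.d2_def)
  show "lift (PQ.d2 0 q (form0 \<alpha>)) \<xi>s \<in> AltHA T (q - 1)" if len: "length \<xi>s = 2" for \<xi>s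
  proof -
    obtain \<xi> \<eta> where "\<xi>s = [\<xi>, \<eta>]"
      using len by (auto simp: numeral_2_eq_2 length_Suc_conv)
    then show ?thesis
      using ctr_closed[OF \<alpha>] by (simp add: d2_form0 AltHA_ops)
  qed
next
  fix xs
  have add: "additive (\<lambda>x. \<alpha> (x # xs))" and scale: "\<alpha> (sH T a x # xs) = a * \<alpha> (x # xs)" for a x
    using \<alpha> CA.alt_scale_head[of \<alpha> q] by (auto simp: AltHA_def intro: madd_head alt_madd)
  \<comment> \<open>The expected value at fixed arguments from H, written out for lists of every
    length so that \<open>alt_Suc\<close> applies.\<close>
  define h where "h = (\<lambda>\<xi>s. case \<xi>s of [\<xi>, \<eta>] \<Rightarrow> sg q (\<alpha> (dlt T \<xi> \<eta> # xs)) | _ \<Rightarrow> 0)"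
  have h: "h [] = 0" "h [\<xi>] = 0" "h [\<xi>, \<eta>] = sg q (\<alpha> (dlt T \<xi> \<eta> # xs))" "h (\<xi> # \<eta> # \<theta> # \<zeta>s) = 0"
    for \<xi> \<eta> \<theta> \<zeta>s
    by (simp_all add: h_def)
  have h2: "h (\<xi> # \<eta> # \<zeta>s) = (if \<zeta>s = [] then sg q (\<alpha> (dlt T \<xi> \<eta> # xs)) else 0)" for \<xi> \<eta> \<zeta>s
    by (cases \<zeta>s) (simp_all add: h)
  have h1: "h (\<xi> # \<zeta>s) = (if length \<zeta>s = 1 then sg q (\<alpha> (dlt T \<xi> (hd \<zeta>s) # xs)) else 0)" for \<xi> \<zeta>s
    by (cases \<zeta>s) (simp_all add: h h2)
  note expand = additive.add[OF dlt_add(1)] additive.add[OF dlt_add(2)] dlt_scale scale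
    additive.add[OF add] additive.zero[OF add] dlt_self A.scale_sg_right sg_add
  have "ctr \<xi> h \<in> alt (sQ T) (*) (Suc 0)" for \<xi>
    unfolding alt_Suc alt_0 by (auto simp: h h2 supp_def expand)
  then have "h \<in> alt (sQ T) (*) 2"
    unfolding numeral_2_eq_2 alt_Suc[of _ _ _ "Suc 0"] by (auto simp: h h1 expand)
  moreover have "lift (PQ.d2 0 q (form0 \<alpha>)) \<xi>s xs = h \<xi>s" for \<xi>s
  proof (cases "length \<xi>s = 2")
    case True
    then obtain \<xi> \<eta> where "\<xi>s = [\<xi>, \<eta>]"
      by (auto simp: numeral_2_eq_2 length_Suc_conv)
    then show ?thesis
      by (simp add: d2_form0 h sg_apply)
  next
    case False
    then have "h \<xi>s = 0"
      by (auto simp: h_def split: list.splits)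
    with False show ?thesis
      by (simp add: PQ.d2_def zero_fun_apply)
  qed
  ultimately show "(\<lambda>\<xi>s. lift (PQ.d2 0 q (form0 \<alpha>)) \<xi>s xs) \<in> alt (sQ T) (*) 2"
    by simp
qed

text \<open>Cartan's formula for contraction with \<delta>(\<xi>, \<eta>): the two terms with d
  \<iota> cancel and the Lie derivative remains. The extra substitution appears because
  \<open>d0\<close> also differentiates \<xi> and \<eta>, thereby varying \<delta>(\<xi>,
  \<eta>).\<close>

lemma pair_br_rhs:
  assumes \<alpha>: "\<alpha> \<in> AltHA T q"
  shows "(PQ.d0 2 (q - 1) (PQ.d2 0 q (form0 \<alpha>)) [form0 \<xi>, form0 \<eta>]
      + PQ.d2 0 (q + 1) (PQ.d0 0 q (form0 \<alpha>)) [form0 \<xi>, form0 \<eta>]) xs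
    = lie (actH T (dlt T \<xi> \<eta>)) (\<lambda>x. brH T (dlt T \<xi> \<eta>) x + (dlt T (HQ T x \<xi>) \<eta> + dlt T \<xi> (HQ T x \<eta>))) \<alpha> xs"
proof -
  let ?\<delta> = "dlt T \<xi> \<eta>" and ?K = "\<lambda>x. dlt T (HQ T x \<xi>) \<eta> + dlt T \<xi> (HQ T x \<eta>)"
  have madd: "madd \<alpha>" and skew: "skew \<alpha>"
    by (rule AltHA_madd[OF \<alpha>], rule AltHA_skew[OF \<alpha>])
  have "PQ.d2 0 (q + 1) (PQ.d0 0 q (form0 \<alpha>)) [form0 \<xi>, form0 \<eta>] xs = sg (q + 1) (dA q \<alpha> (?\<delta> # xs))"
    unfolding d0_form0 d2_form0 by (simp only: sg_fun)
  also have "\<dots> = dH \<alpha> (?\<delta> # xs)"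
    by (simp only: dA_eq[OF \<alpha>] sg_self)
  finally have 1: "PQ.d2 0 (q + 1) (PQ.d0 0 q (form0 \<alpha>)) [form0 \<xi>, form0 \<eta>] xs
      = lie (actH T ?\<delta>) (brH T ?\<delta>) \<alpha> xs - dH (ctr ?\<delta> \<alpha>) xs"
    by simp
  have lift: "lift (PQ.d2 0 q (form0 \<alpha>)) [\<xi>, \<eta>] = (\<lambda>xs. sg q (\<alpha> (dlt T \<xi> \<eta> # xs)))" for \<xi> \<eta>
    by (simp add: d2_form0 sg_fun)
  have "PQ.d0 2 (q - 1) (PQ.d2 0 q (form0 \<alpha>)) [form0 \<xi>, form0 \<eta>] xs
      = lift (PQ.d0 2 (q - 1) (PQ.d2 0 q (form0 \<alpha>))) [\<xi>, \<eta>] xs"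
    by simp
  also have "\<dots> = sg (q - 1 + 1) (dH (lift (PQ.d2 0 q (form0 \<alpha>)) [\<xi>, \<eta>]) xs
      - fan (\<lambda>x ys. \<Sum>j<2. lift (PQ.d2 0 q (form0 \<alpha>)) ([\<xi>, \<eta>][j := HQ T x ([\<xi>, \<eta>] ! j)]) ys) xs)"
    by (rule d0_eq[OF d2_form0_AltQ[OF \<alpha>]]) simp
  also have "dH (lift (PQ.d2 0 q (form0 \<alpha>)) [\<xi>, \<eta>]) xs = sg q (dH (ctr ?\<delta> \<alpha>) xs)"
    unfolding lift by (rule ce_sg) (rule additives)
  also have "(\<lambda>x ys. \<Sum>j<2. lift (PQ.d2 0 q (form0 \<alpha>)) ([\<xi>, \<eta>][j := HQ T x ([\<xi>, \<eta>] ! j)]) ys)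
      = (\<lambda>x ys. sg q (\<alpha> (?K x # ys)))"
  proof (intro ext)
    fix x ys
    have "(\<Sum>j<2. lift (PQ.d2 0 q (form0 \<alpha>)) ([\<xi>, \<eta>][j := HQ T x ([\<xi>, \<eta>] ! j)]) ys)
        = lift (PQ.d2 0 q (form0 \<alpha>)) [HQ T x \<xi>, \<eta>] ys + lift (PQ.d2 0 q (form0 \<alpha>)) [\<xi>, HQ T x \<eta>] ys"
      by (simp add: numeral_2_eq_2)
    then show "(\<Sum>j<2. lift (PQ.d2 0 q (form0 \<alpha>)) ([\<xi>, \<eta>][j := HQ T x ([\<xi>, \<eta>] ! j)]) ys) = sg q (\<alpha> (?K x # ys))"
      unfolding lift by (simp only: additive.add[OF madd_head[OF madd]] sg_add)
  qed
  also have "fan (\<lambda>x ys. sg q (\<alpha> (?K x # ys))) xs = - sg q (lie (\<lambda>a. 0) ?K \<alpha> xs)"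
    using fan_skew[OF skew, of ?K xs] by (simp add: sg_def fan_minus)
  finally have 2: "PQ.d0 2 (q - 1) (PQ.d2 0 q (form0 \<alpha>)) [form0 \<xi>, form0 \<eta>] xs
      = sg (q - 1 + 1) (sg q (dH (ctr ?\<delta> \<alpha>) xs) + sg q (lie (\<lambda>a. 0) ?K \<alpha> xs))"
    by simp
  \<comment> \<open>The number q - 1 + 1 equals q except for q = 0; in that case both terms are
    zero.\<close>
  have 3: "sg (q - 1 + 1) (sg q (dH (ctr ?\<delta> \<alpha>) xs) + sg q (lie (\<lambda>a. 0) ?K \<alpha> xs))
      = dH (ctr ?\<delta> \<alpha>) xs + lie (\<lambda>a. 0) ?K \<alpha> xs"
  proof (cases q)
    case 0
    with \<alpha> have "ctr x \<alpha> = (\<lambda>ys. 0)" for x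
      by (simp add: AltHA_def alt_0 supp_0_ctr)
    moreover from this have "lie (\<lambda>a. 0) ?K \<alpha> xs = 0"
      by (cases xs) (simp_all add: lie_zero additive_def fun_eq_iff)
    ultimately show ?thesis
      by (simp add: ce_zero additives)
  qed (simp add: sg_add sg_diff sg_minus)
  have "lie (actH T ?\<delta>) (brH T ?\<delta>) \<alpha> xs + lie (\<lambda>a. 0) ?K \<alpha> xs = lie (actH T ?\<delta>) (\<lambda>x. brH T ?\<delta> x + ?K x) \<alpha> xs"
    unfolding lie_pair_add[OF madd] by simp
  then show ?thesis
    unfolding plus_fun_apply[of "PQ.d0 _ _ _ _"] 1 2 3 by (simp add: add.commute)
qed

lemma pair_br_lhs:
  assumes \<alpha>: "\<alpha> \<in> AltHA T q"
  shows "(pairing 0 q (form0 \<xi>) (pairing 0 q (form0 \<eta>) \<alpha>)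
      - pairing 0 q (form0 \<eta>) (pairing 0 q (form0 \<xi>) \<alpha>)
      - pairing 0 q (bracket 0 0 (form0 \<xi>) (form0 \<eta>)) \<alpha>) xs
    = lie (\<lambda>a. actQ T \<xi> (actQ T \<eta> a) - actQ T \<eta> (actQ T \<xi> a) - actQ T (brQ T \<xi> \<eta>) a)
        (\<lambda>x. QH T \<xi> (QH T \<eta> x) - QH T \<eta> (QH T \<xi> x) - QH T (brQ T \<xi> \<eta>) x) \<alpha> xs"
proof -
  have madd: "madd \<alpha>"
    by (rule AltHA_madd[OF \<alpha>])
  have "- Qact (brQ T \<xi> \<eta>) \<alpha> xs = lie (\<lambda>a. - actQ T (brQ T \<xi> \<eta>) a) (\<lambda>x. - QH T (brQ T \<xi> \<eta>) x) \<alpha> xs"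
    unfolding Qact_eq by (rule lie_pair_minus[OF madd])
  moreover have "Qact \<xi> (Qact \<eta> \<alpha>) xs - Qact \<eta> (Qact \<xi> \<alpha>) xs = lie (\<lambda>a. actQ T \<xi> (actQ T \<eta> a) - actQ T \<eta> (actQ T \<xi> a))
        (\<lambda>x. QH T \<xi> (QH T \<eta> x) - QH T \<eta> (QH T \<xi> x)) \<alpha> xs"
    unfolding Qact_eq by (rule lie_lie[OF madd actQ_add(1) actQ_add(1)])
  ultimately have "Qact \<xi> (Qact \<eta> \<alpha>) xs - Qact \<eta> (Qact \<xi> \<alpha>) xs + - Qact (brQ T \<xi> \<eta>) \<alpha> xs
    = lie (\<lambda>a. actQ T \<xi> (actQ T \<eta> a) - actQ T \<eta> (actQ T \<xi> a) + - actQ T (brQ T \<xi> \<eta>) a)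
        (\<lambda>x. QH T \<xi> (QH T \<eta> x) - QH T \<eta> (QH T \<xi> x) + - QH T (brQ T \<xi> \<eta>) x) \<alpha> xs"
    by (simp only: lie_pair_add[OF madd])
  then show ?thesis
    unfolding bracket_form0 pairing_form0[OF \<alpha>] pairing_form0[OF Qact_alt[OF \<alpha>]] minus_apply by simp
qed

lemma pair_br_of_compat:
  assumes compat_act compat_curv "u \<in> AltHQ T 0" "v \<in> AltHQ T 0" "\<alpha> \<in> AltHA T q"
  shows "pairing 0 q u (pairing 0 q v \<alpha>) - pairing 0 q v (pairing 0 q u \<alpha>)
      - pairing 0 q (bracket 0 0 u v) \<alpha>
    = PQ.d0 2 (q - 1) (PQ.d2 0 q (form0 \<alpha>)) [u, v] + PQ.d2 0 (q + 1) (PQ.d0 0 q (form0 \<alpha>)) [u, v]"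
proof -
  obtain \<xi> \<eta> where uv: "u = form0 \<xi>" "v = form0 \<eta>"
    using assms(3,4) AltHQ_0 by blast
  show ?thesis
    unfolding uv
    by (rule ext) (unfold pair_br_lhs[OF assms(5)] pair_br_rhs[OF assms(5)],
      use assms(1,2) in \<open>simp add: compat_act_def compat_curv_def\<close>)
qed

text \<open>The axiom equates two Lie derivatives. A 0-form compares their actions on values; a
  1-form then compares the substitutions under an arbitrary linear form on H.\<close>

lemma compat_of_pair_br:
  assumes P: "property_P (sH T)"
    and eq: "\<And>u v \<alpha> q. u \<in> AltHQ T 0 \<Longrightarrow> v \<in> AltHQ T 0 \<Longrightarrow> \<alpha> \<in> AltHA T q \<Longrightarrow>
      pairing 0 q u (pairing 0 q v \<alpha>) - pairing 0 q v (pairing 0 q u \<alpha>)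
      - pairing 0 q (bracket 0 0 u v) \<alpha>
    = PQ.d0 2 (q - 1) (PQ.d2 0 q (form0 \<alpha>)) [u, v] + PQ.d2 0 (q + 1) (PQ.d0 0 q (form0 \<alpha>)) [u, v]"
  shows compat_act compat_curv
proof -
  have *: "lie (\<lambda>a. actQ T \<xi> (actQ T \<eta> a) - actQ T \<eta> (actQ T \<xi> a) - actQ T (brQ T \<xi> \<eta>) a)
        (\<lambda>x. QH T \<xi> (QH T \<eta> x) - QH T \<eta> (QH T \<xi> x) - QH T (brQ T \<xi> \<eta>) x) \<alpha> xs
      = lie (actH T (dlt T \<xi> \<eta>)) (\<lambda>x. brH T (dlt T \<xi> \<eta>) x + (dlt T (HQ T x \<xi>) \<eta> + dlt T \<xi> (HQ T x \<eta>))) \<alpha> xs"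
    if "\<alpha> \<in> AltHA T q" for \<alpha> q \<xi> \<eta> xs
    using fun_cong[OF eq[OF AltHQ_ops(5) AltHQ_ops(5) that, of \<xi> \<eta>], of xs]
    unfolding pair_br_lhs[OF that] pair_br_rhs[OF that] .
  show A: compat_act
    unfolding compat_act_def
  proof (intro allI)
    fix \<xi> \<eta> and a :: 'a
    have "form0 a ([] :: 'h list) = a"
      by (simp add: form0_def)
    then show "actQ T \<xi> (actQ T \<eta> a) - actQ T \<eta> (actQ T \<xi> a) - actQ T (brQ T \<xi> \<eta>) a = actH T (dlt T \<xi> \<eta>) a"
      using *[OF AltHA_ops(7)[of a], of \<xi> \<eta> "[]"] by simp
  qed
  show compat_curv
    unfolding compat_curv_def
  proof (intro allI, rule property_PD[OF P])
    fix \<xi> \<eta> x and \<phi> :: "'h \<Rightarrow> 'a"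
    assume phi: "linear_map (sH T) (*) \<phi>"
    have f: "form1 \<phi> [z] = \<phi> z" for z
      by (simp add: form1_def)
    show "\<phi> (QH T \<xi> (QH T \<eta> x) - QH T \<eta> (QH T \<xi> x) - QH T (brQ T \<xi> \<eta>) x)
        = \<phi> (brH T (dlt T \<xi> \<eta>) x + (dlt T (HQ T x \<xi>) \<eta> + dlt T \<xi> (HQ T x \<eta>)))"
      using *[OF form1_closed[OF phi], of \<xi> \<eta> "[x]"] A by (simp add: f compat_act_def)
  qed
qed

lemma d0_one:
  assumes f: "f \<in> PQ.AltQ 1 0"
  shows "PQ.d0 1 0 f [form0 \<theta>] [x] = f [form0 (HQ T x \<theta>)] [] - actH T x (f [form0 \<theta>] [])"
proof -
  have "PQ.d0 1 0 f [form0 \<theta>] [x] = lift (PQ.d0 1 0 f) [\<theta>] [x]"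
    by simp
  also have "\<dots> = sg (0 + 1) (dH (lift f [\<theta>]) [x]
      - fan (\<lambda>x ys. \<Sum>j<1. lift f ([\<theta>][j := HQ T x ([\<theta>] ! j)]) ys) [x])"
    by (rule d0_eq[OF f]) simp
  finally show ?thesis
    by simp
qed

text \<open>In the combination on the right the terms that differentiate values of \<open>f\<close>
  along \<delta> cancel, leaving \<open>f\<close> at the three vectors obtained by letting \<delta>
  act on Q. Linearity of \<open>f\<close> gathers everything into one argument.\<close>

lemma jacobi_br_iff:
  assumes f: "f \<in> PQ.AltQ 1 0"
  shows "(f [bracket 0 0 (bracket 0 0 (form0 \<xi>) (form0 \<eta>)) (form0 \<theta>)]
      + f [bracket 0 0 (bracket 0 0 (form0 \<eta>) (form0 \<theta>)) (form0 \<xi>)]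
      + f [bracket 0 0 (bracket 0 0 (form0 \<theta>) (form0 \<xi>)) (form0 \<eta>)] =
      PQ.d2 1 1 (PQ.d0 1 0 f) [form0 \<xi>, form0 \<eta>, form0 \<theta>]
      - (PQ.d2 0 1 (PQ.d0 0 0 (form0 (f [form0 \<theta>]))) [form0 \<xi>, form0 \<eta>]
        + PQ.d2 0 1 (PQ.d0 0 0 (form0 (f [form0 \<xi>]))) [form0 \<eta>, form0 \<theta>]
        + PQ.d2 0 1 (PQ.d0 0 0 (form0 (f [form0 \<eta>]))) [form0 \<theta>, form0 \<xi>]))
    \<longleftrightarrow> f [form0 (brQ T (brQ T \<xi> \<eta>) \<theta> + brQ T (brQ T \<eta> \<theta>) \<xi> + brQ T (brQ T \<theta> \<xi>) \<eta>
     + (HQ T (dlt T \<xi> \<eta>) \<theta> + HQ T (dlt T \<eta> \<theta>) \<xi> + HQ T (dlt T \<theta> \<xi>) \<eta>))] [] = 0" (is "?l = ?r \<longleftrightarrow> _")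
proof -
  let ?g = "PQ.d0 1 0 f" and ?v = "\<lambda>\<xi>. f [form0 \<xi>] []"
  note c = AltQ_closed[OF f]
  have g: "?g us \<in> AltHA T 1" for us
    using AltQ_closed[OF d0_operator[OF f]] by simp
  have v: "additive ?v"
    using alt_head[OF AltQ_alt[OF f, of "[]"], of "[]"] by simp
  have dv: "PQ.d2 0 1 (PQ.d0 0 0 (form0 (f [u]))) [form0 \<xi>, form0 \<eta>] = - ctr (dlt T \<xi> \<eta>) (dA 0 (f [u]))" for u \<xi> \<eta>
    unfolding d0_form0 d2_form0 by simp
  have e: "(form0 \<xi> :: 'h list \<Rightarrow> 'q) [] = \<xi>" for \<xi>
    by (simp add: form0_def)
  have d2g: "PQ.d2 1 1 ?g [form0 \<xi>, form0 \<eta>, form0 \<theta>] = ctr (dlt T \<xi> \<theta>) (?g [form0 \<eta>])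
      - ctr (dlt T \<xi> \<eta>) (?g [form0 \<theta>]) - ctr (dlt T \<eta> \<theta>) (?g [form0 \<xi>])"
    by (simp add: PQ.d2_def AltHQ_ops pair_tri_def e numeral_3_eq_3)
  have cl: "ctr x (?g us) \<in> AltHA T 0" "ctr x (dA 0 (f us)) \<in> AltHA T 0" for x us
    using ctr_closed[OF g] ctr_closed[OF dA_closed[OF c]] by simp_all
  have "?r \<in> AltHA T 0"
    unfolding dv d2g by (intro AltHA_ops cl)
  moreover have "?l \<in> AltHA T 0"
    by (intro AltHA_ops c)
  \<comment> \<open>Both sides are forms of degree 0 on H, hence determined by their values at
    \<open>[]\<close>.\<close>
  ultimately have 1: "?l = ?r \<longleftrightarrow> ?l [] = ?r []"
    using AltHA_0[of ?l] AltHA_0[of ?r] by metis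
  have 2: "?l [] = ?v (brQ T (brQ T \<xi> \<eta>) \<theta>) + ?v (brQ T (brQ T \<eta> \<theta>) \<xi>) + ?v (brQ T (brQ T \<theta> \<xi>) \<eta>)"
    by (simp add: bracket_form0 plus_fun_apply)
  have "dA 0 (f us) [x] = - actH T x (f us [])" for us x
    by (simp add: dA_eq[OF c])
  then have 3: "?r [] = - ?v (HQ T (dlt T \<xi> \<eta>) \<theta>) - ?v (HQ T (dlt T \<eta> \<theta>) \<xi>) - ?v (HQ T (dlt T \<theta> \<xi>) \<eta>)"
    unfolding dv d2g using dlt_swap[of \<xi> \<theta>]
    by (simp add: plus_fun_apply minus_apply uminus_apply d0_one[OF f, simplified] minuses
         additive.minus[OF v])
  show ?thesis
    unfolding 1 2 3 additive.add[OF v] by (simp add: algebra_simps eq_neg_iff_add_eq_0)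
qed

end

lemma lie_cong:
  assumes "\<And>ys. length ys = length xs \<Longrightarrow> f ys = g ys"
  shows "lie D N f xs = lie D N g xs"
  using assms by (simp add: lie_def)

text \<open>Congruence restricted to the lengths that are actually read. The operators
  \<open>d1\<close> and \<open>d2\<close> are cut off to 0 outside their degree, so they agree with
  their uncut versions only there.\<close>

lemma ce_cong:
  assumes "\<And>ys. Suc (length ys) = length xs \<Longrightarrow> f ys = g ys"
  shows "ce br act f xs = ce br act g xs"
  using assms
proof (induction xs arbitrary: f g)
  case (Cons x xs)
  have "lie (act x) (br x) f xs = lie (act x) (br x) g xs"
    by (rule lie_cong) (simp add: Cons.prems)
  moreover have "ce br act (ctr x f) xs = ce br act (ctr x g) xs"
    by (rule Cons.IH) (simp add: Cons.prems)
  ultimately show ?case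
    by simp
qed simp

lemma fan_cong:
  assumes "\<And>x ys. Suc (length ys) = length xs \<Longrightarrow> F x ys = G x ys"
  shows "fan F xs = fan G xs"
  using assms
proof (induction xs arbitrary: F G)
  case (Cons x xs)
  have "fan (\<lambda>y. ctr x (F y)) xs = fan (\<lambda>y. ctr x (G y)) xs"
    by (rule Cons.IH) (simp add: Cons.prems)
  then show ?case
    by (simp add: Cons.prems)
qed simp

lemma fan2_cong:
  assumes "\<And>x y ys. Suc (Suc (length ys)) = length xs \<Longrightarrow> F x y ys = G x y ys"
  shows "fan2 F xs = fan2 G xs"
  using assms
proof (induction xs arbitrary: F G)
  case (Cons x xs)
  have "fan2 (\<lambda>y z. ctr x (F y z)) xs = fan2 (\<lambda>y z. ctr x (G y z)) xs"
    by (rule Cons.IH) (simp add: Cons.prems)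
  moreover have "fan (F x) xs = fan (G x) xs"
    by (rule fan_cong) (simp add: Cons.prems)
  ultimately show ?case
    by simp
qed simp

lemma fan2_sg: "fan2 (\<lambda>x y ys. sg n (F x y ys)) xs = sg n (fan2 F xs)"
  by (simp add: fan2_def sg_sum sg_sg add.commute)

context triple_pair
begin

section \<open>The commutator of the operators \<open>d1\<close> and \<open>d2\<close>\<close>

lemma additive_Qact: "additive (Qact \<xi>)"
  by (rule additive.intro) (simp add: plus_fun_def Qact_add_right[abs_def])

lemma additive_ctr: "additive (\<lambda>\<alpha>. ctr x \<alpha>)"
  by (rule additive.intro) (simp add: plus_fun_def)

text \<open>Allows the cyclic hypothesis of \<open>commutator_ce\<close> to collapse into one
  contraction with a vector of H.\<close>

lemma Qact_ctr: "Qact \<xi> (ctr h \<alpha>) - ctr h (Qact \<xi> \<alpha>) = ctr (QH T \<xi> h) \<alpha>"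
  by (simp add: fun_eq_iff minus_apply Qact_eq)

text \<open>Formally the Chevalley-Eilenberg operator of Q with coefficients in forms on H. Neither
  a Jacobi identity on Q nor flatness is available, so only its commutation with \<open>dQ2\<close>
  is of interest.\<close>

abbreviation dQ1 where "dQ1 \<equiv> ce (brQ T) Qact"
abbreviation dQ2 where "dQ2 F \<equiv> fan2 (\<lambda>\<xi> \<eta> \<zeta>s. ctr (dlt T \<xi> \<eta>) (F \<zeta>s))"

lemma dQ1_dQ2:
  assumes compat_jac_H "\<And>\<zeta>s. F \<zeta>s \<in> AltHA T q"
  shows "dQ1 (dQ2 F) \<xi>s = dQ2 (dQ1 F) \<xi>s"
proof (rule commutator_ce[where V = "AltHA T q"])
  fix \<xi> \<eta> \<theta> \<alpha>
  assume "\<alpha> \<in> AltHA T q"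
  then have add: "additive (\<lambda>x. \<alpha> (x # xs))" for xs
    unfolding AltHA_def by (intro madd_head alt_madd)
  \<comment> \<open>The cyclic identity with its arguments brought into increasing order, the shape
    in which contracting one argument after the other produces it.\<close>
  have jac: "QH T \<xi> (dlt T \<eta> \<theta>) - dlt T \<eta> (brQ T \<xi> \<theta>) - (QH T \<eta> (dlt T \<xi> \<theta>) - dlt T \<xi> (brQ T \<eta> \<theta>))
      - dlt T (brQ T \<xi> \<eta>) \<theta> + QH T \<theta> (dlt T \<xi> \<eta>) = 0"
  proof -
    have "QH T \<xi> (dlt T \<eta> \<theta>) + QH T \<eta> (dlt T \<theta> \<xi>) + QH T \<theta> (dlt T \<xi> \<eta>)
     + (dlt T \<xi> (brQ T \<eta> \<theta>) + dlt T \<eta> (brQ T \<theta> \<xi>) + dlt T \<theta> (brQ T \<xi> \<eta>)) = 0"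
      using assms(1) by (simp add: compat_jac_H_def)
    then show ?thesis
      unfolding dlt_swap[of \<theta> \<xi>] brQ_swap[of \<theta> \<xi>] dlt_swap[of \<theta> "brQ T \<xi> \<eta>"]
      by (simp add: minuses algebra_simps)
  qed
  have "\<alpha> ((QH T \<xi> (dlt T \<eta> \<theta>) - dlt T \<eta> (brQ T \<xi> \<theta>) - (QH T \<eta> (dlt T \<xi> \<theta>) - dlt T \<xi> (brQ T \<eta> \<theta>))
      - dlt T (brQ T \<xi> \<eta>) \<theta> + QH T \<theta> (dlt T \<xi> \<eta>)) # xs) = 0" for xs
    unfolding jac by (rule additive.zero[OF add])
  then show "Qact \<xi> (ctr (dlt T \<eta> \<theta>) \<alpha>) - ctr (dlt T \<eta> \<theta>) (Qact \<xi> \<alpha>) - ctr (dlt T \<eta> (brQ T \<xi> \<theta>)) \<alpha>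
      - (Qact \<eta> (ctr (dlt T \<xi> \<theta>) \<alpha>) - ctr (dlt T \<xi> \<theta>) (Qact \<eta> \<alpha>) - ctr (dlt T \<xi> (brQ T \<eta> \<theta>)) \<alpha>)
      - ctr (dlt T (brQ T \<xi> \<eta>) \<theta>) \<alpha> + (Qact \<theta> (ctr (dlt T \<xi> \<eta>) \<alpha>) - ctr (dlt T \<xi> \<eta>) (Qact \<theta> \<alpha>)) = 0"
    unfolding Qact_ctr
    by (simp add: fun_eq_iff minus_apply plus_fun_apply zero_fun_apply additive.add[OF add] additive.diff[OF add])
qed (simp_all add: additive_Qact additive_ctr assms)

lemma d1_lift:
  assumes closed: "\<And>\<zeta>s. lift g \<zeta>s \<in> AltHA T q" and skew: "skew (lift g)" and len: "length \<xi>s = p + 1"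
  shows "lift (PQ.d1 p q g) \<xi>s = sg (p + q + 1) (dQ1 (lift g) \<xi>s)"
proof -
  have "set (map form0 \<xi>s) \<subseteq> AltHQ T 0"
    by (auto simp: AltHQ_ops)
  then show ?thesis
    unfolding ce_eq[OF skew, symmetric] PQ.d1_def
    using len by (simp add: fan_def fan2_def nths_map pairing_form0[OF closed] bracket_form0 del: sum.lessThan_Suc)
qed

lemma d2_lift:
  assumes len: "length \<xi>s = p + 2"
  shows "lift (PQ.d2 p q g) \<xi>s = sg (p + q + 1) (sg p (dQ2 (lift g) \<xi>s))"
proof -
  have "set (map form0 \<xi>s) \<subseteq> AltHQ T 0"
    by (auto simp: AltHQ_ops)
  moreover have "(form0 \<xi> :: 'h list \<Rightarrow> 'q) [] = \<xi>" for \<xi>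
    by (simp add: form0_def)
  ultimately show ?thesis
    unfolding PQ.d2_def
    using len by (simp add: fan2_def nths_map pair_tri_def del: sum.lessThan_Suc)
qed

text \<open>The degrees of the intermediate forms give the two compositions opposite signs, so the
  anticommutator of \<open>d1\<close> and \<open>d2\<close> becomes a commutator of the unsigned
  operators.\<close>

lemma d1_d2_lift:
  assumes f: "f \<in> PQ.AltQ p q" and len: "length \<xi>s = p + 3"
  shows "lift (PQ.d1 (p + 2) (q - 1) (PQ.d2 p q f)) \<xi>s + lift (PQ.d2 (p + 1) q (PQ.d1 p q f)) \<xi>s
    = sg p (dQ2 (dQ1 (lift f)) \<xi>s - dQ1 (dQ2 (lift f)) \<xi>s)"
proof -
  let ?F = "lift f" and ?g = "PQ.d2 p q f"
  note c = AltQ_closed[OF f]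
  have skew: "skew ?F"
  proof (rule skewI)
    fix us x y vs
    show "?F (us @ x # y # vs) = - ?F (us @ y # x # vs)"
      using skewD[OF alt_skew[OF AltQ_alt[OF f]], of us x y vs] by (simp add: fun_eq_iff uminus_apply)
  qed
  have g: "lift ?g \<zeta>s = (if length \<zeta>s = p + 2 then sg (p + q + 1) (sg p (dQ2 ?F \<zeta>s)) else 0)" for \<zeta>s
    using d2_lift[of \<zeta>s p q f] by (simp add: PQ.d2_def)
  have closed: "lift ?g \<zeta>s \<in> AltHA T (q - 1)" for \<zeta>s
    unfolding g fan2_def using ctr_closed[OF c] by (auto intro!: AltHA_ops AltHA_sum)
  have skew_g: "skew (lift ?g)"
  proof (rule skewI)
    fix us x y vs
    have "skew (dQ2 ?F)"
    proof (rule fan2_skew[OF additive_ctr _ skew])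
      fix \<xi> \<eta> \<zeta>s
      have add: "additive (\<lambda>x. lift f \<zeta>s (x # xs))" for xs
        using c[of "map form0 \<zeta>s"] unfolding AltHA_def by (intro madd_head alt_madd)
      show "ctr (dlt T \<xi> \<eta>) (lift f \<zeta>s) = - ctr (dlt T \<eta> \<xi>) (lift f \<zeta>s)"
        unfolding dlt_swap[of \<xi> \<eta>] by (simp add: fun_eq_iff uminus_apply additive.minus[OF add])
    qed
    from skewD[OF this, of us x y vs]
    show "lift ?g (us @ x # y # vs) = - lift ?g (us @ y # x # vs)"
      unfolding g by (simp add: sg_minus)
  qed
  have "lift (PQ.d1 (p + 2) (q - 1) ?g) \<xi>s = sg (p + 2 + (q - 1) + 1) (dQ1 (lift ?g) \<xi>s)"
    by (rule d1_lift[OF closed skew_g]) (simp add: len)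
  \<comment> \<open>On a list of length p + 3 the operator reads only lists of length p + 2, where
    the cut-off \<open>d2\<close> agrees with the uncut one.\<close>
  also have "dQ1 (lift ?g) \<xi>s = dQ1 (\<lambda>\<zeta>s. sg (p + q + 1) (sg p (dQ2 ?F \<zeta>s))) \<xi>s"
    by (rule ce_cong) (simp add: g len)
  also have "\<dots> = sg (p + q + 1) (sg p (dQ1 (dQ2 ?F) \<xi>s))"
    by (simp only: ce_sg[OF additive_Qact])
  finally have 1: "lift (PQ.d1 (p + 2) (q - 1) ?g) \<xi>s
      = sg (p + 2 + (q - 1) + 1) (sg (p + q + 1) (sg p (dQ1 (dQ2 ?F) \<xi>s)))" .
  have "lift (PQ.d2 (p + 1) q (PQ.d1 p q f)) \<xi>s = sg (p + 1 + q + 1) (sg (p + 1) (dQ2 (lift (PQ.d1 p q f)) \<xi>s))"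
    by (rule d2_lift) (simp add: len)
  also have "dQ2 (lift (PQ.d1 p q f)) \<xi>s = fan2 (\<lambda>\<xi> \<eta> \<zeta>s. sg (p + q + 1) (ctr (dlt T \<xi> \<eta>) (dQ1 ?F \<zeta>s))) \<xi>s"
    by (rule fan2_cong) (simp add: d1_lift[OF c skew] len sg_fun)
  also have "\<dots> = sg (p + q + 1) (dQ2 (dQ1 ?F) \<xi>s)"
    by (rule fan2_sg)
  finally have 2: "lift (PQ.d2 (p + 1) q (PQ.d1 p q f)) \<xi>s
      = sg (p + 1 + q + 1) (sg (p + 1) (sg (p + q + 1) (dQ2 (dQ1 ?F) \<xi>s)))" .
  show ?thesis
  \<comment> \<open>The sign in the first identity has the right parity only if q - 1 is not
    truncated. For q = 0 contractions of values of \<open>f\<close> vanish, and that composition is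
    zero anyway.\<close>
  proof (cases q)
    case 0
    have "dQ2 ?F = (\<lambda>\<zeta>s. 0)"
    proof
      fix \<zeta>s
      have "ctr h (?F \<zeta>s) = 0" for h \<zeta>s
        using c[of "map form0 \<zeta>s"] 0 by (simp add: AltHA_def alt_0 supp_0_ctr zero_fun_def)
      then show "dQ2 ?F \<zeta>s = 0"
        by (simp add: fan2_def)
    qed
    then have "dQ1 (dQ2 ?F) \<xi>s = 0"
      by (simp add: ce_zero additive_Qact)
    then show ?thesis
      unfolding 1 2 by (simp add: 0 sg_def)
  next
    case (Suc n)
    then show ?thesis
      unfolding 1 2 by (simp add: sg_def)
  qed
qed

lemma d1_d2_of_compat:
  assumes compat_jac_H and f: "f \<in> PQ.AltQ p q"
  shows "PQ.d1 (p + 2) (q - 1) (PQ.d2 p q f) us + PQ.d2 (p + 1) q (PQ.d1 p q f) us = 0"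
proof (cases "length us = p + 3 \<and> set us \<subseteq> AltHQ T 0")
  case True
  then obtain \<xi>s where "us = map form0 \<xi>s"
    by (auto simp: Q0_list)
  then show ?thesis
    using True by (simp only: d1_d2_lift[OF f] dQ1_dQ2[where F = "lift f", OF assms(1) AltQ_closed[OF f]]
        length_map diff_self sg_zero)
next
  case False
  have 1: "\<not> (length us = p + 2 + 1 \<and> set us \<subseteq> AltHQ T 0)" and 2: "\<not> (length us = p + 1 + 2 \<and> set us \<subseteq> AltHQ T 0)"
    using False by auto
  have "PQ.d1 (p + 2) (q - 1) g us = 0" "PQ.d2 (p + 1) q g us = 0" for g
    unfolding PQ.d1_def if_not_P[OF 1] PQ.d2_def if_not_P[OF 2] by rule+
  then show ?thesis
    by simp
qed

text \<open>The test form has degree 0 on Q and its value is a linear form on H. Both compositions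
  then contract that value once, and evaluation at \<open>[]\<close> gives the linear form at a
  vector of H.\<close>

lemma compat_of_d1_d2:
  assumes P: "property_P (sH T)"
    and eq: "\<And>f p q us. f \<in> PQ.AltQ p q \<Longrightarrow>
      PQ.d1 (p + 2) (q - 1) (PQ.d2 p q f) us + PQ.d2 (p + 1) q (PQ.d1 p q f) us = 0"
  shows compat_jac_H
  unfolding compat_jac_H_def
proof (intro allI, rule property_PD[OF P])
  fix \<xi> \<eta> \<theta> and \<phi> :: "'h \<Rightarrow> 'a"
  assume phi: "linear_map (sH T) (*) \<phi>"
  then have add: "additive \<phi>"
    by (auto simp: lin_on_def additive_def)
  let ?\<alpha> = "form1 \<phi>" and ?f = "form0 (form1 \<phi>) :: ('h list \<Rightarrow> 'q) list \<Rightarrow> 'h list \<Rightarrow> 'a"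
  define F where "F = lift ?f"
  have \<alpha>: "?\<alpha> [z] = \<phi> z" for z
    by (simp add: form1_def)
  have "?f \<in> PQ.AltQ 0 1"
  proof (rule AltQ_I)
    show "(\<lambda>\<xi>s. lift ?f \<xi>s xs) \<in> alt (sQ T) (*) 0" for xs
      by (auto simp: alt_0 supp_def form0_def zero_fun_apply)
    show "lift ?f \<xi>s \<in> AltHA T 1" for \<xi>s
      using form1_closed[OF phi] by (auto simp: form0_def AltHA_ops)
  qed (auto simp: form0_def)
  note f = this
  have "sg 0 (dQ2 (dQ1 F) [\<xi>, \<eta>, \<theta>] - dQ1 (dQ2 F) [\<xi>, \<eta>, \<theta>]) =
      lift (PQ.d1 (0 + 2) (1 - 1) (PQ.d2 0 1 ?f)) [\<xi>, \<eta>, \<theta>] + lift (PQ.d2 (0 + 1) 1 (PQ.d1 0 1 ?f)) [\<xi>, \<eta>, \<theta>]"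
    unfolding F_def by (rule d1_d2_lift[symmetric, OF f]) simp
  also have "\<dots> = 0"
    by (rule eq[OF f])
  finally have "dQ2 (dQ1 F) [\<xi>, \<eta>, \<theta>] = dQ1 (dQ2 F) [\<xi>, \<eta>, \<theta>]"
    unfolding sg_0 by (rule eq_iff_diff_eq_0[THEN iffD2])
  moreover have "F [] = ?\<alpha>"
    by (simp add: F_def form0_def)
  moreover have "F (x # xs) = 0" for x xs
    by (simp add: F_def form0_def)
  moreover have "Qact \<zeta> 0 = 0" for \<zeta>
    using additive.zero[OF additive_Qact] .
  moreover have "ctr x (0 :: 'h list \<Rightarrow> 'a) = 0" for x
    using additive.zero[OF additive_ctr[of x]] .
  \<comment> \<open>Since \<open>F\<close> vanishes on nonempty lists, only the terms that reduce to
    \<open>F []\<close> survive in the two recursions.\<close>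
  ultimately have "- ctr (dlt T \<eta> \<theta>) (Qact \<xi> ?\<alpha>) - (ctr (dlt T \<xi> \<eta>) (Qact \<theta> ?\<alpha>) - ctr (dlt T \<xi> \<theta>) (Qact \<eta> ?\<alpha>))
     = Qact \<xi> (- ctr (dlt T \<eta> \<theta>) ?\<alpha>) + ctr (dlt T \<eta> (brQ T \<xi> \<theta>)) ?\<alpha> + ctr (dlt T (brQ T \<xi> \<eta>) \<theta>) ?\<alpha>
      - (Qact \<eta> (- ctr (dlt T \<xi> \<theta>) ?\<alpha>) + ctr (dlt T \<xi> (brQ T \<eta> \<theta>)) ?\<alpha> - Qact \<theta> (- ctr (dlt T \<xi> \<eta>) ?\<alpha>))"
    by simp
  from fun_cong[OF this, of "[]"]
  have "\<phi> (QH T \<xi> (dlt T \<eta> \<theta>)) - \<phi> (QH T \<eta> (dlt T \<xi> \<theta>)) + \<phi> (QH T \<theta> (dlt T \<xi> \<eta>)) + \<phi> (dlt T \<xi> (brQ T \<eta> \<theta>))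
      - \<phi> (dlt T \<eta> (brQ T \<xi> \<theta>)) - \<phi> (dlt T (brQ T \<xi> \<eta>) \<theta>) = 0"
    by (simp add: Qact_eq \<alpha> minus_apply plus_fun_apply uminus_apply minuses)
      (simp add: algebra_simps)
  then show "\<phi> (QH T \<xi> (dlt T \<eta> \<theta>) + QH T \<eta> (dlt T \<theta> \<xi>) + QH T \<theta> (dlt T \<xi> \<eta>)
     + (dlt T \<xi> (brQ T \<eta> \<theta>) + dlt T \<eta> (brQ T \<theta> \<xi>) + dlt T \<theta> (brQ T \<xi> \<eta>))) = \<phi> 0"
    unfolding dlt_swap[of \<theta> \<xi>] brQ_swap[of \<theta> \<xi>] dlt_swap[of \<theta> "brQ T \<xi> \<eta>"]
    by (simp add: minuses additive.add[OF add]
        additive.minus[OF add] additive.diff[OF add] additive.zero[OF add] algebra_simps)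
qed

end

section \<open>Lie-Rinehart triples\<close>

context triple_pair
begin

definition compatible where
  "compatible \<longleftrightarrow> compat_A \<and> compat_H \<and> compat_Q \<and> compat_act \<and> compat_curv \<and> compat_jac_Q \<and> compat_jac_H"

text \<open>The Jacobiator on the direct sum. Together with its cyclic symmetry, additivity in the
  first variable gives additivity in the others.\<close>

definition jac where
  "jac u v w = brL T u (brL T v w) + brL T v (brL T w u) + brL T w (brL T u v)"

lemma brL_add: "brL T (u + u') v = brL T u v + brL T u' v" "brL T v (u + u') = brL T v u + brL T v u'"
  by (cases u; cases u'; cases v; simp add: brL_def adds algebra_simps)+

lemma jac_add: "jac (u + u') v w = jac u v w + jac u' v w"
  by (simp add: jac_def brL_add algebra_simps)

lemma jac_cyclic: "jac u v w = jac v w u"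
  by (simp add: jac_def algebra_simps)

lemma jac_HHH: "jac (x, 0) (y, 0) (z, 0) = 0"
  using lie_rinehart.jacobi[OF lie_rinehart_H, of x y z]
  by (simp add: jac_def brL_def zeros zero_prod_def)

text \<open>The Q-component vanishes by \<open>HQ_br\<close>, the flatness already contained in a
  pre-Lie-Rinehart triple.\<close>

lemma jac_QHH: "jac (0, \<xi>) (x, 0) (y, 0) =
  (QH T (HQ T x \<xi>) y - (brH T x (QH T \<xi> y) - QH T \<xi> (brH T x y) + brH T (QH T \<xi> x) y + QH T (HQ T y \<xi>) x), 0)"
  unfolding jac_def brL_def
  by (simp add: zeros minuses CA.br_swap[of y "QH T \<xi> x"] HQ_br)

lemma jac_HQQ: "jac (x, 0) (0, \<xi>) (0, \<eta>) =
  (QH T \<xi> (QH T \<eta> x) - QH T \<eta> (QH T \<xi> x) - QH T (brQ T \<xi> \<eta>) x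
     - (brH T (dlt T \<xi> \<eta>) x + (dlt T (HQ T x \<xi>) \<eta> + dlt T \<xi> (HQ T x \<eta>))),
   HQ T x (brQ T \<xi> \<eta>)
     - (brQ T (HQ T x \<xi>) \<eta> + brQ T \<xi> (HQ T x \<eta>) + HQ T (QH T \<eta> x) \<xi> - HQ T (QH T \<xi> x) \<eta>))"
  unfolding jac_def brL_def
  by (simp add: zeros minuses CA.br_swap[of x "dlt T \<xi> \<eta>"] dlt_swap[of \<eta> "HQ T x \<xi>"] brQ_swap[of \<eta> "HQ T x \<xi>"])

lemma jac_QQQ: "jac (0, \<xi>) (0, \<eta>) (0, \<theta>) =
  (QH T \<xi> (dlt T \<eta> \<theta>) + QH T \<eta> (dlt T \<theta> \<xi>) + QH T \<theta> (dlt T \<xi> \<eta>)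
     + (dlt T \<xi> (brQ T \<eta> \<theta>) + dlt T \<eta> (brQ T \<theta> \<xi>) + dlt T \<theta> (brQ T \<xi> \<eta>)),
   - (brQ T (brQ T \<xi> \<eta>) \<theta> + brQ T (brQ T \<eta> \<theta>) \<xi> + brQ T (brQ T \<theta> \<xi>) \<eta>
     + (HQ T (dlt T \<xi> \<eta>) \<theta> + HQ T (dlt T \<eta> \<theta>) \<xi> + HQ T (dlt T \<theta> \<xi>) \<eta>)))"
  unfolding jac_def brL_def
  by (simp add: zeros minuses brQ_swap[of \<xi> "brQ T \<eta> \<theta>"] brQ_swap[of \<eta> "brQ T \<theta> \<xi>"] brQ_swap[of \<theta> "brQ T \<xi> \<eta>"])

text \<open>Triadditivity gives eight terms with arguments purely in H or in Q; cyclic rotation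
  brings each into one of the four evaluated types.\<close>

lemma jac_zero:
  assumes compatible
  shows "jac u v w = 0"
proof -
  have QHH: "jac (0, \<xi>) (x, 0) (y, 0) = 0" for \<xi> x y
    unfolding jac_QHH using assms by (simp add: compatible_def compat_H_def zero_prod_def)
  have HQQ: "jac (x, 0) (0, \<xi>) (0, \<eta>) = 0" for \<xi> x \<eta>
    unfolding jac_HQQ using assms by (simp add: compatible_def compat_Q_def compat_curv_def zero_prod_def)
  have QQQ: "jac (0, \<xi>) (0, \<eta>) (0, \<theta>) = 0" for \<xi> \<eta> \<theta>
    unfolding jac_QQQ using assms by (simp add: compatible_def compat_jac_Q_def compat_jac_H_def zero_prod_def)
  have 0: "jac (x, \<xi>) v w = jac (x, 0) v w + jac (0, \<xi>) v w" for x \<xi> v w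
    using jac_add[of "(x, 0)" "(0, \<xi>)" v w] by simp
  have split1: "jac u (x, \<xi>) w = jac u (x, 0) w + jac u (0, \<xi>) w" for u x \<xi> w
    unfolding jac_cyclic[of u "(x, \<xi>)" w] jac_cyclic[of u "(x, 0)" w] jac_cyclic[of u "(0, \<xi>)" w] by (rule 0)
  have split2: "jac u w (x, \<xi>) = jac u w (x, 0) + jac u w (0, \<xi>)" for u x \<xi> w
    unfolding jac_cyclic[of "(x, \<xi>)" u w, symmetric] jac_cyclic[of "(x, 0)" u w, symmetric]
      jac_cyclic[of "(0, \<xi>)" u w, symmetric] by (rule 0)
  obtain x \<xi> y \<eta> z \<theta> where "u = (x, \<xi>)" "v = (y, \<eta>)" "w = (z, \<theta>)"
    by (cases u; cases v; cases w)
  moreover have "jac (x, \<xi>) (y, \<eta>) (z, \<theta>) = jac (x, 0) (y, 0) (z, 0) + jac (x, 0) (y, 0) (0, \<theta>)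
      + (jac (x, 0) (0, \<eta>) (z, 0) + jac (x, 0) (0, \<eta>) (0, \<theta>))
      + (jac (0, \<xi>) (y, 0) (z, 0) + jac (0, \<xi>) (y, 0) (0, \<theta>)
      + (jac (0, \<xi>) (0, \<eta>) (z, 0) + jac (0, \<xi>) (0, \<eta>) (0, \<theta>)))"
    by (simp only: 0[of x \<xi>] split1[of _ y \<eta>] split2[of _ _ z \<theta>] ac_simps)
  moreover have "jac (x, 0) (0, \<eta>) (z, 0) = 0" "jac (x, 0) (y, 0) (0, \<theta>) = 0"
    using QHH[of \<eta> z x] QHH[of \<theta> x y] jac_cyclic[of "(x, 0)" "(0, \<eta>)" "(z, 0)"]
      jac_cyclic[of "(0, \<theta>)" "(x, 0)" "(y, 0)"] by simp_all
  moreover have "jac (0, \<xi>) (0, \<eta>) (z, 0) = 0" "jac (0, \<xi>) (y, 0) (0, \<theta>) = 0"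
    using HQQ[of z \<xi> \<eta>] HQQ[of y \<theta> \<xi>] jac_cyclic[of "(z, 0)" "(0, \<xi>)" "(0, \<eta>)"]
      jac_cyclic[of "(0, \<xi>)" "(y, 0)" "(0, \<theta>)"] by simp_all
  ultimately show ?thesis
    by (simp only: jac_HHH QHH HQQ QQQ add_0_left)
qed

text \<open>Only the Jacobi identity and the compatibility of action and bracket carry conditions
  beyond those of a pre-Lie-Rinehart triple; evaluated on pure arguments they are the components of
  \<open>compatible\<close>.\<close>

lemma lie_rinehart_triple_iff: "lie_rinehart_triple T \<longleftrightarrow> compatible"
proof
  assume "lie_rinehart_triple T"
  then interpret L: lie_rinehart "rsc T" "sL T" "brL T" "actL T"
    by (rule lie_rinehart_triple.lie_rinehart_L)
  have jac: "jac u v w = 0" for u v w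
    unfolding jac_def by (rule L.jacobi)
  have compat_A
    unfolding compat_A_def
  proof (intro allI)
    fix x \<xi> a
    show "actH T x (actQ T \<xi> a) - actQ T \<xi> (actH T x a) + actH T (QH T \<xi> x) a = actQ T (HQ T x \<xi>) a"
      using L.act_br[of "(x, 0)" "(0, \<xi>)" a] by (simp add: actL_def brL_def zeros minuses algebra_simps)
  qed
  moreover have compat_act
    unfolding compat_act_def
  proof (intro allI)
    fix \<xi> \<eta> a
    show "actQ T \<xi> (actQ T \<eta> a) - actQ T \<eta> (actQ T \<xi> a) - actQ T (brQ T \<xi> \<eta>) a = actH T (dlt T \<xi> \<eta>) a"
      using L.act_br[of "(0, \<xi>)" "(0, \<eta>)" a] by (simp add: actL_def brL_def zeros minuses algebra_simps)
  qed
  moreover have compat_H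
    unfolding compat_H_def
  proof (intro allI)
    fix x \<xi> y
    show "brH T x (QH T \<xi> y) - QH T \<xi> (brH T x y) + brH T (QH T \<xi> x) y + QH T (HQ T y \<xi>) x = QH T (HQ T x \<xi>) y"
      using jac[of "(0, \<xi>)" "(x, 0)" "(y, 0)"] unfolding jac_QHH zero_prod_def by simp
  qed
  moreover have compat_Q
    unfolding compat_Q_def
  proof (intro allI)
    fix x \<xi> \<eta>
    show "HQ T x (brQ T \<xi> \<eta>)
      = brQ T (HQ T x \<xi>) \<eta> + brQ T \<xi> (HQ T x \<eta>) + HQ T (QH T \<eta> x) \<xi> - HQ T (QH T \<xi> x) \<eta>"
      using jac[of "(x, 0)" "(0, \<xi>)" "(0, \<eta>)"] unfolding jac_HQQ zero_prod_def
      by (simp only: prod.inject right_minus_eq)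
  qed
  moreover have compat_curv
    unfolding compat_curv_def
  proof (intro allI)
    fix \<xi> \<eta> x
    show "QH T \<xi> (QH T \<eta> x) - QH T \<eta> (QH T \<xi> x) - QH T (brQ T \<xi> \<eta>) x
      = brH T (dlt T \<xi> \<eta>) x + (dlt T (HQ T x \<xi>) \<eta> + dlt T \<xi> (HQ T x \<eta>))"
      using jac[of "(x, 0)" "(0, \<xi>)" "(0, \<eta>)"] unfolding jac_HQQ zero_prod_def
      by (simp only: prod.inject right_minus_eq)
  qed
  moreover have compat_jac_Q
    unfolding compat_jac_Q_def
  proof (intro allI)
    fix \<xi> \<eta> \<theta>
    show "brQ T (brQ T \<xi> \<eta>) \<theta> + brQ T (brQ T \<eta> \<theta>) \<xi> + brQ T (brQ T \<theta> \<xi>) \<eta>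
      + (HQ T (dlt T \<xi> \<eta>) \<theta> + HQ T (dlt T \<eta> \<theta>) \<xi> + HQ T (dlt T \<theta> \<xi>) \<eta>) = 0"
      using jac[of "(0, \<xi>)" "(0, \<eta>)" "(0, \<theta>)"] unfolding jac_QQQ zero_prod_def
      by (simp only: prod.inject neg_equal_0_iff_equal)
  qed
  moreover have compat_jac_H
    unfolding compat_jac_H_def
  proof (intro allI)
    fix \<xi> \<eta> \<theta>
    show "QH T \<xi> (dlt T \<eta> \<theta>) + QH T \<eta> (dlt T \<theta> \<xi>) + QH T \<theta> (dlt T \<xi> \<eta>)
      + (dlt T \<xi> (brQ T \<eta> \<theta>) + dlt T \<eta> (brQ T \<theta> \<xi>) + dlt T \<theta> (brQ T \<xi> \<eta>)) = 0"
      using jac[of "(0, \<xi>)" "(0, \<eta>)" "(0, \<theta>)"] unfolding jac_QQQ zero_prod_def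
      by (simp only: prod.inject)
  qed
  ultimately show compatible
    by (simp add: compatible_def)
next
  assume compat: compatible
  have "lie_rinehart (rsc T) (sL T) (brL T) (actL T)"
  proof
    show "bilinear_map (induced_rscale (rsc T) (sL T)) (induced_rscale (rsc T) (sL T))
        (induced_rscale (rsc T) (sL T)) (brL T)"
      using brH_bilinear brQ_bilinear dlt_bilinear HQ_bilinear QH_bilinear
      by (auto simp: bilin_on_def lin_on_def brL_add induced_rscale_def)
       (simp_all add: brL_def sL_def CQ.M.scale_add_right CQ.M.scale_diff_right CA.X.scale_add_right CA.X.scale_diff_right)
    show "brL T u (brL T v w) + brL T v (brL T w u) + brL T w (brL T u v) = 0" for u v w
      using jac_zero[OF compat, of u v w] by (simp add: jac_def)
    show "derivation (rsc T) (actL T u)" for u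
      by (cases u) (simp add: derivation_def lin_on_def actL_def adds actQ_rsc actH_rsc R.scale_add_right
          actH_mult actQ_mult algebra_simps)
    show "linear_map (induced_rscale (rsc T) (sL T)) (rsc T) (\<lambda>u. actL T u a)" for a
      by (auto simp: lin_on_def actL_def adds induced_rscale_def sL_def actH_scale actQ_scale R.scale_add_right
          rsc_eq[of _ "actH T _ _"] rsc_eq[of _ "actQ T _ _"] algebra_simps)
    show "actL T (brL T u v) a = actL T u (actL T v a) - actL T v (actL T u a)" for u v a
    proof -
      obtain x \<xi> y \<eta> where uv: "u = (x, \<xi>)" "v = (y, \<eta>)"
        by (cases u; cases v)
      have A: "actQ T (HQ T x \<xi>) a = actH T x (actQ T \<xi> a) - actQ T \<xi> (actH T x a) + actH T (QH T \<xi> x) a" for x \<xi>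
        using compat by (simp add: compatible_def compat_A_def)
      have B: "actH T (dlt T \<xi> \<eta>) a = actQ T \<xi> (actQ T \<eta> a) - actQ T \<eta> (actQ T \<xi> a) - actQ T (brQ T \<xi> \<eta>) a"
        using compat by (simp add: compatible_def compat_act_def)
      show ?thesis
        unfolding uv
        by (simp add: actL_def brL_def adds additive.diff[OF actH_add(2)] additive.diff[OF actQ_add(2)] A B actH_br)
    qed
  next
    fix u v a b
    show "brL T u u = 0"
      by (cases u) (simp add: brL_def brH_self brQ_self dlt_self zero_prod_def)
    show "actL T (sL T a u) b = a * actL T u b"
      by (cases u) (simp add: actL_def sL_def actH_scale actQ_scale algebra_simps)
    show "brL T u (sL T a v) = sL T (actL T u a) v + sL T a (brL T u v)"
      by (cases u; cases v) (simp add: brL_def sL_def actL_def brH_scale brQ_scale dlt_scale HQ_scale_left HQ_scale_right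
          QH_scale_left QH_scale_right CQ.M.scale_add_left CA.X.scale_add_left CQ.M.scale_add_right CA.X.scale_add_right
          CQ.M.scale_diff_right CA.X.scale_diff_right algebra_simps)
  qed (auto simp: sL_def CQ.M.scale_add_left CA.X.scale_add_left CQ.M.scale_add_right CA.X.scale_add_right
      CQ.M.scale_scale CA.X.scale_scale CQ.M.scale_one CA.X.scale_one)
  then show "lie_rinehart_triple T"
    by (intro lie_rinehart_triple.intro lie_rinehart_triple_axioms.intro almost_pre_lie_rinehart_triple_axioms)
qed


section \<open>Quasi-Lie-Rinehart algebras\<close>

abbreviation quasi where
  "quasi \<equiv> quasi_lie_rinehart (pair_rscale T) (AltHA T) pair_mul (form0 1) dA
    (AltHQ T) (pair_scale T) dM (bracket) (pairing) (pair_tri T)"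

lemma quasi_of_compatible:
  assumes compatible
  shows quasi
proof (intro quasi_lie_rinehart.intro pre_quasi quasi_lie_rinehart_axioms.intro)
  note compat = assms[unfolded compatible_def]
  have gen: "dA q (pairing 0 q u \<alpha>) = pairing 1 q (dM 0 u) \<alpha> + pairing 0 (q + 1) u (dA q \<alpha>)"
    if u: "u \<in> AltHQ T 0" and \<alpha>: "\<alpha> \<in> AltHA T q" for u \<alpha> q
  proof -
    obtain \<xi> where "u = form0 \<xi>"
      using u AltHQ_0 by blast
    then show ?thesis
      using d_pair_form0_iff[OF \<alpha>, of \<xi>] dH_Qact[OF _ _ \<alpha>] compat by blast
  qed
  show d_pair: "dA (p + q) (pairing p q u \<alpha>)
      = pairing (p + 1) q (dM p u) \<alpha> + sg p (pairing p (q + 1) u (dA q \<alpha>))"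
    if "u \<in> AltHQ T p" "\<alpha> \<in> AltHA T q" for u \<alpha> p q
    using PQ.d_pair_generators[OF gen that] .
  have gen2: "dM 0 (bracket 0 0 u v) = bracket 1 0 (dM 0 u) v + bracket 0 1 u (dM 0 v)"
    if uv: "u \<in> AltHQ T 0" "v \<in> AltHQ T 0" for u v
  proof -
    obtain \<xi> \<eta> where "u = form0 \<xi>" "v = form0 \<eta>"
      using uv AltHQ_0 by blast
    then show ?thesis
      using dM_bracket_iff[of \<xi> \<eta>] compat unfolding compat_Q_def by blast
  qed
  show "dM (p + q) (bracket p q u v)
      = bracket (p + 1) q (dM p u) v + sg p (bracket p (q + 1) u (dM q v))"
    if "u \<in> AltHQ T p" "v \<in> AltHQ T q" for u v p q
    using PQ.dQ_br_generators[OF d_pair gen2 that] .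
  show "f \<in> PQ.AltQ p q \<Longrightarrow> PQ.d0 p q f \<in> PQ.AltQ p (q + 1)" for f p q
    by (rule d0_operator)
  show "pairing 0 q u (pairing 0 q v \<alpha>) - pairing 0 q v (pairing 0 q u \<alpha>)
      - pairing 0 q (bracket 0 0 u v) \<alpha>
    = PQ.d0 2 (q - 1) (PQ.d2 0 q (form0 \<alpha>)) [u, v] + PQ.d2 0 (q + 1) (PQ.d0 0 q (form0 \<alpha>)) [u, v]"
    if "u \<in> AltHQ T 0" "v \<in> AltHQ T 0" "\<alpha> \<in> AltHA T q" for u v \<alpha> q
    using pair_br_of_compat[OF _ _ that] compat by blast
  show "PQ.d1 (p + 2) (q - 1) (PQ.d2 p q f) us + PQ.d2 (p + 1) q (PQ.d1 p q f) us = 0" if "f \<in> PQ.AltQ p q" for f p q us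
    using d1_d2_of_compat[OF _ that] compat by blast
  show "f [bracket 0 0 (bracket 0 0 u v) w] + f [bracket 0 0 (bracket 0 0 v w) u]
      + f [bracket 0 0 (bracket 0 0 w u) v] =
      PQ.d2 1 1 (PQ.d0 1 0 f) [u, v, w]
      - (PQ.d2 0 1 (PQ.d0 0 0 (form0 (f [w]))) [u, v] + PQ.d2 0 1 (PQ.d0 0 0 (form0 (f [u]))) [v, w]
        + PQ.d2 0 1 (PQ.d0 0 0 (form0 (f [v]))) [w, u])"
    if uvw: "u \<in> AltHQ T 0" "v \<in> AltHQ T 0" "w \<in> AltHQ T 0" and f: "f \<in> PQ.AltQ 1 0" for u v w f
  proof -
    obtain \<xi> \<eta> \<theta> where eq: "u = form0 \<xi>" "v = form0 \<eta>" "w = form0 \<theta>"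
      using uvw AltHQ_0 by blast
    have "additive (\<lambda>\<xi>. f [form0 \<xi>] [])"
      using alt_head[OF AltQ_alt[OF f, of "[]"], of "[]"] by simp
    then have "f [form0 0] [] = 0"
      by (rule additive.zero)
    then show ?thesis
      unfolding eq jacobi_br_iff[OF f] using compat by (simp add: compat_jac_Q_def)
  qed
qed

lemma compatible_of_quasi:
  assumes quasi and P: "property_P (sH T)" "property_P (sQ T)"
  shows compatible
proof -
  interpret quasi_lie_rinehart "pair_rscale T" "AltHA T" pair_mul "form0 1" dA
    "AltHQ T" "pair_scale T" dM "bracket" "pairing" "pair_tri T"
    by (rule assms(1))
  have "dH (Qact \<xi> \<alpha>) xs - Qact \<xi> (dH \<alpha>) xs = fan (\<lambda>x. Qact (HQ T x \<xi>) \<alpha>) xs"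
    if "\<alpha> \<in> AltHA T q" for \<xi> \<alpha> q xs
    using d_pair_form0_iff[OF that, of \<xi>] d_pair[OF AltHQ_ops(5) that, of \<xi>] by simp
  then have "compat_A" "compat_H"
    using compat_AH_of_dH_Qact[OF P(1)] by blast+
  moreover have compat_Q
    using dM_bracket_iff dQ_br[OF AltHQ_ops(5) AltHQ_ops(5)] by (simp add: compat_Q_def)
  moreover have compat_act compat_curv
    using compat_of_pair_br[OF P(1) pair_br] by blast+
  moreover have compat_jac_H
    using compat_of_d1_d2[OF P(1)] d1_d2 by blast
  moreover have compat_jac_Q
    unfolding compat_jac_Q_def
  proof (intro allI)
    fix \<xi> \<eta> \<theta>
    let ?J = "brQ T (brQ T \<xi> \<eta>) \<theta> + brQ T (brQ T \<eta> \<theta>) \<xi> + brQ T (brQ T \<theta> \<xi>) \<eta>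
     + (HQ T (dlt T \<xi> \<eta>) \<theta> + HQ T (dlt T \<eta> \<theta>) \<xi> + HQ T (dlt T \<theta> \<xi>) \<eta>)"
    have "\<phi> ?J = 0" if phi: "linear_map (sQ T) (*) \<phi>" for \<phi>
    proof -
      \<comment> \<open>A linear form on Q, regarded as a 1-form with values in degree 0; the
        cut-off makes it vanish outside lists of length one over \<open>AltHQ T 0\<close>, as
        membership in \<open>AltQ\<close> demands.\<close>
      define f :: "('h list \<Rightarrow> 'q) list \<Rightarrow> 'h list \<Rightarrow> 'a"
        where "f us = (if length us = 1 \<and> set us \<subseteq> AltHQ T 0 then form0 (\<phi> (hd us [])) else 0)" for us
      have e: "(form0 \<xi> :: 'h list \<Rightarrow> 'q) [] = \<xi>" for \<xi>
        by (simp add: form0_def)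
      have f1: "lift f \<xi>s = (if length \<xi>s = 1 then form0 (\<phi> (hd \<xi>s)) else 0)" for \<xi>s
        using Q0_list by (cases \<xi>s) (auto simp: f_def e AltHQ_ops)
      have "f \<in> PQ.AltQ 1 0"
      proof (rule AltQ_I)
        show "f us = 0" if "\<not> (length us = 1 \<and> set us \<subseteq> AltHQ T 0)" for us
          using that by (auto simp: f_def)
        show "lift f \<xi>s \<in> AltHA T 0" for \<xi>s
          by (simp add: f1 AltHA_ops)
        show "(\<lambda>\<xi>s. lift f \<xi>s xs) \<in> alt (sQ T) (*) 1" for xs
          using phi by (auto simp: alt_iff supp_def f1 zero_fun_apply lin_on_def form0_def length_Suc_conv)
      qed
      then have "lift f [?J] [] = 0"
        using jacobi_br_iff[of f \<xi> \<eta> \<theta>] jacobi_br[OF AltHQ_ops(5) AltHQ_ops(5) AltHQ_ops(5), of f \<xi> \<eta> \<theta>] by simp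
      then show ?thesis
        unfolding f1 by (simp add: form0_def)
    qed
    then show "?J = 0"
      using P(2) unfolding property_P_def by blast
  qed
  ultimately show ?thesis
    by (simp add: compatible_def)
qed

end

theorem theorem4p13:
  fixes T :: "('r::{comm_ring,comm_monoid_mult}, 'a::{comm_ring,comm_monoid_mult},
      'h::ab_group_add, 'q::ab_group_add) triple"
  assumes "pre_lie_rinehart_triple T"
    and "property_P (sH T)"
    and "property_P (sQ T)"
    and "canonical_map_iso T"
  shows "lie_rinehart_triple T \<longleftrightarrow>
    quasi_lie_rinehart
      (pair_rscale T) (AltHA T) pair_mul (form0 1) (alt_diff (brH T) (actH T))
      (AltHQ T) (pair_scale T) (alt_diff (brH T) (HQ T))
      (pair_bracket T) (pair_pairing T) (pair_tri T)"
proof -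
  interpret triple_pair T
    by (intro triple_pair.intro triple_pair_axioms.intro assms)
  show ?thesis
    using lie_rinehart_triple_iff quasi_of_compatible compatible_of_quasi[OF _ assms(2,3)] by blast
qed

end
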